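(* On any pseudo-Hermitian manifold $(M^{2m+1},\theta,J,h)$ there is a unique pseudo-Hermitian connection $\nabla$ with $\Theta^{(1,1)}=0$ and $h(\sigma(X),Y)=-h(X,\sigma(Y))$ for all $X,Y\in T(M)$.
   Context: All objects are smooth. For a $1$-form, $2d\theta(X,Y)=X(\theta(Y))-Y(\theta(X))-\theta([X,Y])$. A CR structure on an orientable manifold $M$ of dimension $2m+1$ is a complex rank-$m$ subbundle $H^{1,0}(M)\subset T(M)\otimes\mathbb C$ with $H^{1,0}(M)\cap H^{0,1}(M)=\{0\}$, where $H^{0,1}(M)=\overline{H^{1,0}(M)}$, and $[\Gamma(H^{1,0}(M)),\Gamma(H^{1,0}(M))]\subseteq\Gamma(H^{1,0}(M))$. Put $H(M)=\mathrm{Re}(H^{1,0}(M)\oplus H^{0,1}(M))$ and $J_b(Z+\overline Z)=\sqrt{-1}(Z-\overline Z)$ for $Z\in H^{1,0}(M)$. A pseudo-Hermitian $1$-form is a nowhere vanishing real $1$-form $\theta$ with $\ker\theta=H(M)$; its Levi form is $L_\theta(X,Y)=d\theta(X,J_bY)$ on $H(M)$. The CR manifold is non-degenerate if $L_\theta$ is non-degenerate. Then there is a unique (Reeb) vector field $\xi$ with $\theta(\xi)=1$, $i_\xi d\theta=0$; $T(M)=H(M)\oplus\mathbb R\xi$ with projection $\pi_H:T(M)\to H(M)$, and $J$ is the endomorphism of $T(M)$ with $J|_{H(M)}=J_b$, $J\xi=0$. A pseudo-Hermitian manifold $(M,\theta,J,h)$ is a non-degenerate CR manifold with a fixed pseudo-Hermitian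 $1$-form $\theta$ and a (positive definite) fiber metric $h$ on $H(M)$ with $h(J_bX,J_bY)=h(X,Y)$. The symbol $h$ also denotes the tensor $h(\pi_H\cdot,\pi_H\cdot)$ on $M$; $g_{h,\theta}=h+\theta\otimes\theta$ is a Riemannian metric. There is the decomposition $T(M)\otimes\mathbb C=H^{1,0}(M)\oplus H^{0,1}(M)\oplus\mathbb C\xi$ with projections $\pi_+,\pi_-,\pi_0$. A pseudo-Hermitian connection is a linear connection $\nabla$ on $M$ preserving this decomposition (each summand is preserved by covariant differentiation) and satisfying $\nabla g_{h,\theta}=0$. Its torsion is $T_\nabla(X,Y)=\nabla_XY-\nabla_YX-[X,Y]$, extended complex bilinearly. With $\Theta=\pi_+(T_\nabla(\cdot,\cdot))$, set $\Theta^{(1,1)}(Z,W)=\Theta(\pi_+Z,\pi_-W)+\Theta(\pi_-Z,\pi_+W)$. Also $\tau(X)=T_\nabla(\xi,X)$ and $\sigma=\tau\circ J+J\circ\tau$. *)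

theory Defs
  imports "HOL-Analysis.Analysis" "HOL-Library.FuncSet" "HOL-Library.Function_Algebras"
begin

text \<open>The following two predicates are only meaningful on open sets.\<close>

fun Ck_on :: "nat \<Rightarrow> ('e::euclidean_space) set \<Rightarrow> ('e \<Rightarrow> 'f::real_normed_vector) \<Rightarrow> bool" where
  "Ck_on 0 S f \<longleftrightarrow> continuous_on S f"
| "Ck_on (Suc k) S f \<longleftrightarrow> (\<forall>x\<in>S. f differentiable (at x)) \<and>
     (\<forall>v. Ck_on k S (\<lambda>x. frechet_derivative f (at x) v))"

definition smooth_on :: "('e::euclidean_space) set \<Rightarrow> ('e \<Rightarrow> 'f::real_normed_vector) \<Rightarrow> bool" where
  "smooth_on S f \<longleftrightarrow> (\<forall>k. Ck_on k S f)"

text \<open>The manifold is the whole type \<open>'a\<close> and its dimension is \<open>CARD('n)\<close>. Atlases need not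
  be maximal.\<close>

type_synonym ('a, 'n) chart = "'a set \<times> ('a \<Rightarrow> real ^ 'n)"

definition smooth_atlas :: "('a::topological_space, 'n::finite) chart set \<Rightarrow> bool" where
  "smooth_atlas A \<longleftrightarrow>
     (\<forall>(U, \<phi>)\<in>A. open U \<and> open (\<phi> ` U) \<and> homeomorphism U (\<phi> ` U) \<phi> (inv_into U \<phi>)) \<and>
     (\<Union>(U, \<phi>)\<in>A. U) = UNIV \<and>
     (\<forall>(U, \<phi>)\<in>A. \<forall>(V, \<psi>)\<in>A. smooth_on (\<phi> ` (U \<inter> V)) (\<psi> \<circ> inv_into U \<phi>))"

definition orientable :: "('a::topological_space, 'n::finite) chart set \<Rightarrow> bool" where
  "orientable A \<longleftrightarrow> (\<exists>B. smooth_atlas (A \<union> B) \<and> (\<Union>(U, \<phi>)\<in>B. U) = UNIV \<and>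
     (\<forall>(U, \<phi>)\<in>B. \<forall>(V, \<psi>)\<in>B. \<forall>x\<in>\<phi> ` (U \<inter> V).
        det (matrix (frechet_derivative (\<psi> \<circ> inv_into U \<phi>) (at x))) > 0))"

text \<open>A tangent vector is represented by its action on real functions, an element of
  \<open>T\<^sub>p(M) \<otimes> \<complex>\<close> by the action \<open>f \<mapsto> u f + \<i> v f\<close> with \<open>u, v\<close> in \<open>T\<^sub>p(M)\<close>.\<close>

type_synonym 'a tvec = "('a \<Rightarrow> real) \<Rightarrow> real"
type_synonym 'a ctvec = "('a \<Rightarrow> real) \<Rightarrow> complex"
type_synonym 'a vfield = "'a \<Rightarrow> 'a tvec"
type_synonym 'a cvfield = "'a \<Rightarrow> 'a ctvec"

definition fscale :: "('a \<Rightarrow> real) \<Rightarrow> 'a vfield \<Rightarrow> 'a vfield" where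
  "fscale u X = (\<lambda>p f. u p * X p f)"

definition cplx :: "'a tvec \<Rightarrow> 'a ctvec" where
  "cplx u = (\<lambda>f. complex_of_real (u f))"

definition vec_cnj :: "'a ctvec \<Rightarrow> 'a ctvec" where
  "vec_cnj z = (\<lambda>f. cnj (z f))"

definition Re_field :: "'a cvfield \<Rightarrow> 'a vfield" where
  "Re_field Z = (\<lambda>p f. Re (Z p f))"

definition Im_field :: "'a cvfield \<Rightarrow> 'a vfield" where
  "Im_field Z = (\<lambda>p f. Im (Z p f))"

text \<open>The complex bilinear extension of an operation on real vector fields.\<close>

definition cbilinear :: "('a vfield \<Rightarrow> 'a vfield \<Rightarrow> 'a vfield) \<Rightarrow> 'a cvfield \<Rightarrow> 'a cvfield \<Rightarrow> 'a cvfield"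
  where "cbilinear B Z W = (\<lambda>p f. Complex
     (B (Re_field Z) (Re_field W) p f - B (Im_field Z) (Im_field W) p f)
     (B (Re_field Z) (Im_field W) p f + B (Im_field Z) (Re_field W) p f))"

locale smooth_manifold =
  fixes atlas :: "('a::{t2_space, second_countable_topology}, 'n::finite) chart set"
  assumes atlas: "smooth_atlas atlas"
begin

definition smooth_fun :: "'a set \<Rightarrow> ('a \<Rightarrow> real) \<Rightarrow> bool" where
  "smooth_fun W f \<longleftrightarrow> (\<forall>(U, \<phi>)\<in>atlas. smooth_on (\<phi> ` (U \<inter> W)) (f \<circ> inv_into U \<phi>))"

definition smooth_near :: "'a \<Rightarrow> ('a \<Rightarrow> real) \<Rightarrow> bool" where
  "smooth_near p f \<longleftrightarrow> (\<exists>W. open W \<and> p \<in> W \<and> smooth_fun W f)"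

text \<open>\<open>T\<^sub>p(M)\<close> consists of the directional derivatives at \<open>p\<close> in a chart. They act on the functions
  that are smooth near \<open>p\<close>, so that vector fields, brackets and forms can be evaluated locally; the
  value 0 on all other functions makes the representation unique.\<close>

definition tangent_space :: "'a \<Rightarrow> 'a tvec set" where
  "tangent_space p = {u. \<exists>(U, \<phi>)\<in>atlas. p \<in> U \<and> (\<exists>w. u = (\<lambda>f.
     if smooth_near p f then frechet_derivative (f \<circ> inv_into U \<phi>) (at (\<phi> p)) w else 0))}"

definition vfields :: "'a set \<Rightarrow> 'a vfield set" where
  "vfields U = {X. (\<forall>p\<in>U. X p \<in> tangent_space p) \<and>
     (\<forall>V f. open V \<and> V \<subseteq> U \<and> smooth_fun V f \<longrightarrow> smooth_fun V (\<lambda>p. X p f))}"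

definition cvfields :: "'a set \<Rightarrow> 'a cvfield set" where
  "cvfields U = {Z. Re_field Z \<in> vfields U \<and> Im_field Z \<in> vfields U}"

text \<open>The smooth sections over \<open>U\<close> of a family \<open>E\<close> of subspaces of \<open>T(M) \<otimes> \<complex>\<close>.\<close>

definition sections :: "'a set \<Rightarrow> ('a \<Rightarrow> 'a ctvec set) \<Rightarrow> 'a cvfield set" where
  "sections U E = {Z \<in> cvfields U. \<forall>p\<in>U. Z p \<in> E p}"

definition lie_bracket :: "'a vfield \<Rightarrow> 'a vfield \<Rightarrow> 'a vfield" where
  "lie_bracket X Y = (\<lambda>p f.
     if smooth_near p f then X p (\<lambda>q. Y q f) - Y p (\<lambda>q. X q f) else 0)"

definition one_form :: "('a \<Rightarrow> 'a tvec \<Rightarrow> real) \<Rightarrow> bool" where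
  "one_form \<omega> \<longleftrightarrow>
     (\<forall>p. \<forall>u\<in>tangent_space p. \<forall>v\<in>tangent_space p. \<forall>a b.
        \<omega> p (\<lambda>f. a * u f + b * v f) = a * \<omega> p u + b * \<omega> p v) \<and>
     (\<forall>U. open U \<longrightarrow> (\<forall>X\<in>vfields U. smooth_fun U (\<lambda>p. \<omega> p (X p))))"

text \<open>The value at \<open>p\<close> of \<open>d\<omega>\<close> on tangent vectors, through arbitrary extensions to vector fields
  near \<open>p\<close>; note the factor 2.\<close>

definition ext_deriv :: "('a \<Rightarrow> 'a tvec \<Rightarrow> real) \<Rightarrow> 'a \<Rightarrow> 'a tvec \<Rightarrow> 'a tvec \<Rightarrow> real" where
  "ext_deriv \<omega> p u v = (THE c. \<forall>U X Y.
     open U \<and> p \<in> U \<and> X \<in> vfields U \<and> Y \<in> vfields U \<and> X p = u \<and> Y p = v \<longrightarrow>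
     2 * c = X p (\<lambda>q. \<omega> q (Y q)) - Y p (\<lambda>q. \<omega> q (X q)) - \<omega> p (lie_bracket X Y p))"

definition complex_subbundle :: "nat \<Rightarrow> ('a \<Rightarrow> 'a ctvec set) \<Rightarrow> bool" where
  "complex_subbundle r E \<longleftrightarrow> (\<forall>p. \<exists>U Z. open U \<and> p \<in> U \<and> (\<forall>i<r. Z i \<in> cvfields U) \<and>
     (\<forall>q\<in>U. E q = {(\<lambda>f. \<Sum>i<r. c i * Z i q f) | c. True} \<and>
        (\<forall>c. (\<lambda>f. \<Sum>i<r. c i * Z i q f) = 0 \<longrightarrow> (\<forall>i<r. c i = 0))))"

definition linear_connection :: "('a vfield \<Rightarrow> 'a vfield \<Rightarrow> 'a vfield) \<Rightarrow> bool" where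
  "linear_connection D \<longleftrightarrow>
     D \<in> vfields UNIV \<rightarrow>\<^sub>E vfields UNIV \<rightarrow>\<^sub>E vfields UNIV \<and>
     (\<forall>X\<in>vfields UNIV. \<forall>Y\<in>vfields UNIV. \<forall>Z\<in>vfields UNIV.
        D (X + Y) Z = D X Z + D Y Z \<and> D X (Y + Z) = D X Y + D X Z) \<and>
     (\<forall>X\<in>vfields UNIV. \<forall>Y\<in>vfields UNIV. \<forall>u. smooth_fun UNIV u \<longrightarrow>
        D (fscale u X) Y = fscale u (D X Y) \<and>
        D X (fscale u Y) = fscale (\<lambda>p. X p u) Y + fscale u (D X Y))"

definition torsion :: "('a vfield \<Rightarrow> 'a vfield \<Rightarrow> 'a vfield) \<Rightarrow> 'a vfield \<Rightarrow> 'a vfield \<Rightarrow> 'a vfield"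
  where "torsion D X Y = D X Y - D Y X - lie_bracket X Y"

end

locale cr_manifold = smooth_manifold atlas
  for atlas :: "('a::{t2_space, second_countable_topology}, 'n::finite) chart set" +
  fixes m :: nat and H10 :: "'a \<Rightarrow> 'a ctvec set"
  assumes dimension: "CARD('n) = 2 * m + 1"
    and orientable: "orientable atlas"
    and subbundle: "complex_subbundle m H10"
    and H10_Int_H01: "H10 p \<inter> vec_cnj ` H10 p = {0}"
    and integrable: "\<lbrakk>Z \<in> sections UNIV H10; W \<in> sections UNIV H10\<rbrakk> \<Longrightarrow>
      cbilinear lie_bracket Z W \<in> sections UNIV H10"
begin

definition H01 :: "'a \<Rightarrow> 'a ctvec set" where
  "H01 p = vec_cnj ` H10 p"

definition H :: "'a \<Rightarrow> 'a tvec set" where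
  "H p = {(\<lambda>f. Re (z f + w f)) | z w. z \<in> H10 p \<and> w \<in> H01 p}"

definition Jb :: "'a \<Rightarrow> 'a tvec \<Rightarrow> 'a tvec" where
  "Jb p u = (THE v. \<exists>z\<in>H10 p. cplx u = z + vec_cnj z \<and> cplx v = (\<lambda>f. \<i> * (z f - vec_cnj z f)))"

definition levi_form :: "('a \<Rightarrow> 'a tvec \<Rightarrow> real) \<Rightarrow> 'a \<Rightarrow> 'a tvec \<Rightarrow> 'a tvec \<Rightarrow> real" where
  "levi_form \<theta> p u v = ext_deriv \<theta> p u (Jb p v)"

definition pseudo_hermitian_form :: "('a \<Rightarrow> 'a tvec \<Rightarrow> real) \<Rightarrow> bool" where
  "pseudo_hermitian_form \<theta> \<longleftrightarrow> one_form \<theta> \<and>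
     (\<forall>p. (\<exists>u\<in>tangent_space p. \<theta> p u \<noteq> 0) \<and> {u \<in> tangent_space p. \<theta> p u = 0} = H p)"

text \<open>Only the values of a fiber metric on vectors in \<open>H(M)\<close> are constrained.\<close>

definition fiber_metric :: "('a \<Rightarrow> 'a tvec \<Rightarrow> 'a tvec \<Rightarrow> real) \<Rightarrow> bool" where
  "fiber_metric h \<longleftrightarrow>
     (\<forall>p. \<forall>u\<in>H p. \<forall>v\<in>H p. h p u v = h p v u) \<and>
     (\<forall>p. \<forall>u\<in>H p. \<forall>v\<in>H p. \<forall>w\<in>H p. \<forall>a b.
        h p (\<lambda>f. a * u f + b * v f) w = a * h p u w + b * h p v w) \<and>
     (\<forall>p. \<forall>u\<in>H p. u \<noteq> 0 \<longrightarrow> h p u u > 0) \<and>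
     (\<forall>U. open U \<longrightarrow> (\<forall>X\<in>vfields U. \<forall>Y\<in>vfields U.
        (\<forall>p\<in>U. X p \<in> H p \<and> Y p \<in> H p) \<longrightarrow> smooth_fun U (\<lambda>p. h p (X p) (Y p))))"

end

locale pseudo_hermitian_manifold = cr_manifold atlas m H10
  for atlas :: "('a::{t2_space, second_countable_topology}, 'n::finite) chart set"
    and m :: nat and H10 :: "'a \<Rightarrow> 'a ctvec set" +
  fixes \<theta> :: "'a \<Rightarrow> 'a tvec \<Rightarrow> real" and h :: "'a \<Rightarrow> 'a tvec \<Rightarrow> 'a tvec \<Rightarrow> real"
  assumes form: "pseudo_hermitian_form \<theta>"
    and nondegenerate: "\<lbrakk>u \<in> H p; \<And>v. v \<in> H p \<Longrightarrow> levi_form \<theta> p u v = 0\<rbrakk> \<Longrightarrow> u = 0"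
    and metric: "fiber_metric h"
    and metric_Jb: "\<lbrakk>u \<in> H p; v \<in> H p\<rbrakk> \<Longrightarrow> h p (Jb p u) (Jb p v) = h p u v"
begin

definition reeb :: "'a vfield" where
  "reeb = (THE \<xi>. \<xi> \<in> vfields UNIV \<and>
     (\<forall>p. \<theta> p (\<xi> p) = 1 \<and> (\<forall>v\<in>tangent_space p. ext_deriv \<theta> p (\<xi> p) v = 0)))"

definition pi_H :: "'a \<Rightarrow> 'a tvec \<Rightarrow> 'a tvec" where
  "pi_H p u = (\<lambda>f. u f - \<theta> p u * reeb p f)"

definition J :: "'a vfield \<Rightarrow> 'a vfield" where
  "J X = (\<lambda>p. Jb p (pi_H p (X p)))"

definition h_tensor :: "'a vfield \<Rightarrow> 'a vfield \<Rightarrow> 'a \<Rightarrow> real" where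
  "h_tensor X Y = (\<lambda>p. h p (pi_H p (X p)) (pi_H p (Y p)))"

definition g_metric :: "'a vfield \<Rightarrow> 'a vfield \<Rightarrow> 'a \<Rightarrow> real" where
  "g_metric X Y = (\<lambda>p. h_tensor X Y p + \<theta> p (X p) * \<theta> p (Y p))"

definition reeb_line :: "'a \<Rightarrow> 'a ctvec set" where
  "reeb_line p = {(\<lambda>f. c * cplx (reeb p) f) | c. True}"

definition pi_plus :: "'a cvfield \<Rightarrow> 'a cvfield" where
  "pi_plus Z = (\<lambda>p. THE z. z \<in> H10 p \<and> (\<exists>w\<in>H01 p. \<exists>r\<in>reeb_line p. Z p = z + w + r))"

definition pi_minus :: "'a cvfield \<Rightarrow> 'a cvfield" where
  "pi_minus Z = (\<lambda>p. THE w. w \<in> H01 p \<and> (\<exists>z\<in>H10 p. \<exists>r\<in>reeb_line p. Z p = z + w + r))"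

definition preserves :: "('a vfield \<Rightarrow> 'a vfield \<Rightarrow> 'a vfield) \<Rightarrow> ('a \<Rightarrow> 'a ctvec set) \<Rightarrow> bool" where
  "preserves D E \<longleftrightarrow> (\<forall>X\<in>vfields UNIV. \<forall>Z\<in>sections UNIV E.
     cbilinear D (\<lambda>p. cplx (X p)) Z \<in> sections UNIV E)"

definition pseudo_hermitian_connection :: "('a vfield \<Rightarrow> 'a vfield \<Rightarrow> 'a vfield) \<Rightarrow> bool" where
  "pseudo_hermitian_connection D \<longleftrightarrow> linear_connection D \<and>
     preserves D H10 \<and> preserves D H01 \<and> preserves D reeb_line \<and>
     (\<forall>X\<in>vfields UNIV. \<forall>Y\<in>vfields UNIV. \<forall>Z\<in>vfields UNIV. \<forall>p.
        X p (g_metric Y Z) = g_metric (D X Y) Z p + g_metric Y (D X Z) p)"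

definition \<Theta> :: "('a vfield \<Rightarrow> 'a vfield \<Rightarrow> 'a vfield) \<Rightarrow> 'a cvfield \<Rightarrow> 'a cvfield \<Rightarrow> 'a cvfield" where
  "\<Theta> D Z W = pi_plus (cbilinear (torsion D) Z W)"

definition \<Theta>11 :: "('a vfield \<Rightarrow> 'a vfield \<Rightarrow> 'a vfield) \<Rightarrow> 'a cvfield \<Rightarrow> 'a cvfield \<Rightarrow> 'a cvfield" where
  "\<Theta>11 D Z W = \<Theta> D (pi_plus Z) (pi_minus W) + \<Theta> D (pi_minus Z) (pi_plus W)"

definition \<tau> :: "('a vfield \<Rightarrow> 'a vfield \<Rightarrow> 'a vfield) \<Rightarrow> 'a vfield \<Rightarrow> 'a vfield" where
  "\<tau> D X = torsion D reeb X"

definition \<sigma> :: "('a vfield \<Rightarrow> 'a vfield \<Rightarrow> 'a vfield) \<Rightarrow> 'a vfield \<Rightarrow> 'a vfield" where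
  "\<sigma> D X = \<tau> D (J X) + J (\<tau> D X)"

end

end

theory Submission imports Defs begin

text \<open>
  The connection preserves \<open>H(M)\<close> and \<open>J\<close> and annihilates \<open>\<xi>\<close>, so only \<open>h(\<nabla>\<^sub>X Y, Z)\<close> for \<open>Y, Z\<close> in
  \<open>H(M)\<close> has to be found. Put \<open>Q\<^sub>X Y = \<nabla>\<^sub>X Y + J \<nabla>\<^sub>J\<^sub>X Y\<close> and
  \<open>P\<^sub>X Y = (1/2) \<pi>\<^sub>H ([X, \<pi>\<^sub>H Y] + [JX, JY] + J [JX, \<pi>\<^sub>H Y] - J [X, JY])\<close>. The condition on
  \<open>\<Theta>\<close> says that \<open>Q\<^sub>X = P\<^sub>X\<close> for \<open>X\<close> in \<open>H(M)\<close>, and the condition on \<open>\<sigma>\<close> says that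
  \<open>Q\<^sub>\<xi> - P\<^sub>\<xi>\<close> is self-adjoint. In both cases metric compatibility yields
  \<open>2 h(\<nabla>\<^sub>X Y, Z) = X h(Y, Z) - (JX) h(JY, Z) + h(P\<^sub>X Y, Z) - h(Y, P\<^sub>X Z)\<close>,
  which proves uniqueness. The right-hand side is function-linear in \<open>Z\<close>, hence defines a connection.
  For it \<open>N\<^sub>X = Q\<^sub>X - P\<^sub>X\<close> is self-adjoint and commutes with \<open>J\<close>, and \<open>N\<^sub>J\<^sub>X = - J N\<^sub>X\<close> on
  \<open>H(M)\<close>; so \<open>J N\<^sub>X\<close> is both self-adjoint and skew, and \<open>N\<^sub>X = 0\<close>.

  Smooth fields are obtained from nondegenerate bilinear forms by Cramer's rule in local frames;
  bump functions extend tangent vectors to global fields.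
\<close>

section \<open>Calculus of smooth functions\<close>

text \<open>Since (1,0) vectors have the form \<open>u - \<i> J u\<close>, multiplication by \<i>
  acts on their real parts as \<open>J\<close>. Hence \<open>Q\<close> is the real form of
  differentiating (1,0) fields along (0,1) directions, and \<open>P\<close> is the bracket
  expression that vanishing mixed torsion prescribes for it. Along \<open>H(M)\<close> the
  connection is therefore built like a Chern connection: the (0,1) part is prescribed, and
  compatibility with \<open>h\<close> determines the rest. Along \<xi> there is no conjugate
  direction, because \<open>J \<xi> = 0\<close>. There \<open>Q\<close> is the whole derivative,
  compatibility leaves a skew endomorphism commuting with \<open>J\<close> undetermined, and the
  condition on \<sigma> removes it. The obstacle is that connections act on global fields, while
  metric and forms act on vectors: an expression that is function-linear in a field has to be shown
  to depend on values only before the metric can represent it by a field.\<close>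

lemma Ck_on_subset: "Ck_on k S f \<Longrightarrow> T \<subseteq> S \<Longrightarrow> Ck_on k T f"
  by (induction k arbitrary: f) (auto intro: continuous_on_subset)

lemma Ck_on_imp_continuous_on: "Ck_on k S f \<Longrightarrow> continuous_on S f"
  by (cases k) (auto intro!: continuous_at_imp_continuous_on differentiable_imp_continuous_within)

lemma Ck_on_SucD: "Ck_on (Suc k) S f \<Longrightarrow> Ck_on k S f"
proof (induction k arbitrary: f)
  case 0
  then show ?case using Ck_on_imp_continuous_on[OF 0] by simp
next
  case (Suc k)
  then show ?case by (metis Ck_on.simps(2))
qed

lemma Ck_on_cong:
  assumes "open S" "\<And>x. x \<in> S \<Longrightarrow> f x = g x" "Ck_on k S f"
  shows "Ck_on k S g"
  using assms(2,3)
proof (induction k arbitrary: f g)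
  case 0
  then show ?case by (auto cong: continuous_on_cong)
next
  case (Suc k)
  have d: "f differentiable (at x)" if "x \<in> S" for x using that Suc.prems by simp
  have "g differentiable (at x)" if "x \<in> S" for x
    using d[OF that] Suc.prems(1) \<open>open S\<close> that
    by (meson differentiable_def has_derivative_transform_within_open)
  moreover have "frechet_derivative f (at x) = frechet_derivative g (at x)" if "x \<in> S" for x
    using frechet_derivative_transform_within_open[OF d[OF that] \<open>open S\<close> that] Suc.prems(1) by auto
  ultimately show ?case
    using Suc.prems Suc.IH[of "\<lambda>x. frechet_derivative f (at x) v" "\<lambda>x. frechet_derivative g (at x) v" for v]
    by auto
qed

lemma Ck_on_SucI:
  assumes "open S" "\<And>x. x \<in> S \<Longrightarrow> (f has_derivative f' x) (at x)" "\<And>v. Ck_on k S (\<lambda>x. f' x v)"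
  shows "Ck_on (Suc k) S f"
proof -
  have "frechet_derivative f (at x) = f' x" if "x \<in> S" for x
    using assms(2)[OF that] frechet_derivative_at by metis
  then have "Ck_on k S (\<lambda>x. frechet_derivative f (at x) v)" for v
    using Ck_on_cong[OF assms(1) _ assms(3)] by simp
  then show ?thesis using assms(2) by (auto simp: differentiable_def)
qed

lemma Ck_on_Suc_has_derivative:
  "Ck_on (Suc k) S f \<Longrightarrow> x \<in> S \<Longrightarrow> (f has_derivative frechet_derivative f (at x)) (at x)"
  by (simp add: frechet_derivative_works[symmetric])

lemma Ck_on_const: "Ck_on k S (\<lambda>x. c)"
  by (induction k arbitrary: c) auto

lemma Ck_on_bounded_linear:
  assumes "bounded_linear T" "open S" "Ck_on k S f"
  shows "Ck_on k S (\<lambda>x. T (f x))"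
  using assms(3)
proof (induction k arbitrary: f)
  case 0
  then show ?case by (simp add: bounded_linear.continuous_on[OF assms(1)])
next
  case (Suc k)
  show ?case
  proof (rule Ck_on_SucI[OF assms(2)])
    show "((\<lambda>x. T (f x)) has_derivative (\<lambda>v. T (frechet_derivative f (at x) v))) (at x)" if "x \<in> S" for x
      using bounded_linear.has_derivative[OF assms(1) Ck_on_Suc_has_derivative[OF Suc.prems that]] .
    show "Ck_on k S (\<lambda>x. T (frechet_derivative f (at x) v))" for v
      using Suc by auto
  qed
qed

lemma Ck_on_id: "open S \<Longrightarrow> Ck_on k S (\<lambda>x. x)"
proof (cases k)
  case (Suc j)
  assume "open S"
  then show ?thesis unfolding Suc
    by (rule Ck_on_SucI[where f' = "\<lambda>x v. v"]) (auto intro: Ck_on_const)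
qed auto

lemma Ck_on_add:
  assumes "open S" "Ck_on k S f" "Ck_on k S g"
  shows "Ck_on k S (\<lambda>x. f x + g x)"
  using assms(2,3)
proof (induction k arbitrary: f g)
  case 0
  then show ?case by (auto intro: continuous_intros)
next
  case (Suc k)
  show ?case
    by (rule Ck_on_SucI[OF assms(1) has_derivative_add[OF Ck_on_Suc_has_derivative[OF Suc.prems(1)]
          Ck_on_Suc_has_derivative[OF Suc.prems(2)]]]) (use Suc in auto)
qed

lemma Ck_on_bilinear:
  assumes "bounded_bilinear B" "open S" "Ck_on k S f" "Ck_on k S g"
  shows "Ck_on k S (\<lambda>x. B (f x) (g x))"
  using assms(3,4)
proof (induction k arbitrary: f g)
  case 0
  then show ?case by (auto intro: bounded_bilinear.continuous_on[OF assms(1)])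
next
  case (Suc k)
  have "Ck_on k S (\<lambda>x. B (f x) (frechet_derivative g (at x) v) + B (frechet_derivative f (at x) v) (g x))" for v
    by (intro Ck_on_add assms Suc.IH) (use Suc.prems Ck_on_SucD in auto)
  note * = this
  show ?case
    by (rule Ck_on_SucI[OF assms(2) bounded_bilinear.FDERIV[OF assms(1) Ck_on_Suc_has_derivative[OF Suc.prems(1)]
          Ck_on_Suc_has_derivative[OF Suc.prems(2)]] *])
qed

lemma Ck_on_sum:
  assumes "open S" "\<And>i. i \<in> I \<Longrightarrow> Ck_on k S (f i)"
  shows "Ck_on k S (\<lambda>x. \<Sum>i\<in>I. f i x)"
  using assms(2)
proof (induction I rule: infinite_finite_induct)
  case (insert i I)
  then show ?case by (auto intro: Ck_on_add[OF assms(1)])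
qed (auto intro: Ck_on_const)

text \<open>The derivative of the composite applies a linear map depending on \<open>x\<close> to a
  vector depending on \<open>x\<close>. Expanding this vector in \<open>Basis\<close> gives a finite
  sum of scalar multiples of derivatives of \<open>g\<close> in fixed directions, to which the
  induction hypothesis applies.\<close>

lemma Ck_on_compose:
  fixes f :: "'e::euclidean_space \<Rightarrow> 'd::euclidean_space" and g :: "'d \<Rightarrow> 'f::real_normed_vector"
  assumes "open S" "open T" "f ` S \<subseteq> T" "Ck_on k S f" "Ck_on k T g"
  shows "Ck_on k S (\<lambda>x. g (f x))"
  using assms(3-5)
proof (induction k arbitrary: g)
  case 0
  then show ?case by (auto intro: continuous_on_compose2)
next
  case (Suc k)
  let ?f' = "\<lambda>x. frechet_derivative f (at x)" and ?g' = "\<lambda>y. frechet_derivative g (at y)"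
  have df: "(f has_derivative ?f' x) (at x)" if "x \<in> S" for x
    using Ck_on_Suc_has_derivative[OF Suc.prems(2) that] .
  have dg: "(g has_derivative ?g' (f x)) (at (f x))" if "x \<in> S" for x
    using Ck_on_Suc_has_derivative[OF Suc.prems(3)] that Suc.prems(1) by auto
  show ?case
  proof (rule Ck_on_SucI[OF assms(1)])
    fix x assume x: "x \<in> S"
    interpret linear "?g' (f x)" using dg[OF x] by (rule has_derivative_linear)
    have "(\<lambda>v. ?g' (f x) (?f' x v)) = (\<lambda>v. \<Sum>b\<in>Basis. (?f' x v \<bullet> b) *\<^sub>R ?g' (f x) b)"
      by (subst (1) euclidean_representation[symmetric]) (simp add: sum scaleR)
    then show "((\<lambda>x. g (f x)) has_derivative (\<lambda>v. \<Sum>b\<in>Basis. (?f' x v \<bullet> b) *\<^sub>R ?g' (f x) b)) (at x)"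
      using has_derivative_compose[OF df[OF x] dg[OF x]] by simp
  next
    fix v
    show "Ck_on k S (\<lambda>x. \<Sum>b\<in>Basis. (?f' x v \<bullet> b) *\<^sub>R ?g' (f x) b)"
    proof (intro Ck_on_sum[OF assms(1)] Ck_on_bilinear[OF bounded_bilinear_scaleR assms(1)]
        Ck_on_bounded_linear[OF bounded_linear_inner_left assms(1)])
      show "Ck_on k S (\<lambda>x. ?f' x v)" using Suc.prems(2) by simp
      show "Ck_on k S (\<lambda>x. ?g' (f x) b)" for b
        by (rule Suc.IH) (use Suc.prems Ck_on_SucD[OF Suc.prems(2)] in auto)
    qed
  qed
qed

text \<open>The derivative of \<open>1/f\<close> is a product of two factors \<open>1/f\<close> and
  a derivative of \<open>f\<close>, so the induction hypothesis for the same \<open>f\<close>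
  suffices.\<close>

lemma Ck_on_inverse:
  fixes f :: "'e::euclidean_space \<Rightarrow> real"
  assumes "open S" "\<And>x. x \<in> S \<Longrightarrow> f x \<noteq> 0" "Ck_on k S f"
  shows "Ck_on k S (\<lambda>x. inverse (f x))"
  using assms(3)
proof (induction k)
  case 0
  then show ?case using assms(2) by (auto intro!: continuous_intros)
next
  case (Suc k)
  have "Ck_on k S (\<lambda>x. - (inverse (f x) * frechet_derivative f (at x) v * inverse (f x)))" for v
    by (intro Ck_on_bounded_linear[OF bounded_linear_minus[OF bounded_linear_ident] assms(1)]
        Ck_on_bilinear[OF bounded_bilinear_mult assms(1)] Suc.IH) (use Suc.prems Ck_on_SucD in auto)
  note * = this
  show ?case
    by (rule Ck_on_SucI[OF assms(1) Deriv.has_derivative_inverse[OF assms(2) Ck_on_Suc_has_derivative[OF Suc.prems]] *])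
qed

lemma Ck_on_local:
  assumes "\<And>x. x \<in> S \<Longrightarrow> \<exists>T. open T \<and> x \<in> T \<and> Ck_on k T f"
  shows "Ck_on k S f"
  using assms
proof (induction k arbitrary: f)
  case 0
  then have "continuous (at x) f" if "x \<in> S" for x
    using that by (metis Ck_on.simps(1) continuous_on_eq_continuous_at)
  then show ?case by (auto intro: continuous_at_imp_continuous_on)
next
  case (Suc k)
  have "f differentiable (at x)" if "x \<in> S" for x using Suc.prems[OF that] by auto
  moreover have "Ck_on k S (\<lambda>x. frechet_derivative f (at x) v)" for v
    by (rule Suc.IH) (use Suc.prems in force)
  ultimately show ?case by simp
qed

lemma smooth_on_subset: "smooth_on S f \<Longrightarrow> T \<subseteq> S \<Longrightarrow> smooth_on T f"
  unfolding smooth_on_def by (blast intro: Ck_on_subset)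

lemma smooth_on_cong: "open S \<Longrightarrow> (\<And>x. x \<in> S \<Longrightarrow> f x = g x) \<Longrightarrow> smooth_on S f \<Longrightarrow> smooth_on S g"
  unfolding smooth_on_def by (blast intro: Ck_on_cong)

lemma smooth_on_imp_continuous_on: "smooth_on S f \<Longrightarrow> continuous_on S f"
  unfolding smooth_on_def by (blast intro: Ck_on_imp_continuous_on)

lemma smooth_on_imp_differentiable: "smooth_on S f \<Longrightarrow> x \<in> S \<Longrightarrow> f differentiable (at x)"
  unfolding smooth_on_def by (meson Ck_on.simps(2))

lemma smooth_on_has_derivative:
  "smooth_on S f \<Longrightarrow> x \<in> S \<Longrightarrow> (f has_derivative frechet_derivative f (at x)) (at x)"
  using smooth_on_imp_differentiable frechet_derivative_works by blast

lemma smooth_on_frechet_derivative: "smooth_on S f \<Longrightarrow> smooth_on S (\<lambda>x. frechet_derivative f (at x) v)"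
  unfolding smooth_on_def by (metis Ck_on.simps(2))

lemma smooth_on_const: "smooth_on S (\<lambda>x. c)"
  by (simp add: smooth_on_def Ck_on_const)

lemma smooth_on_id: "open S \<Longrightarrow> smooth_on S (\<lambda>x. x)"
  by (simp add: smooth_on_def Ck_on_id)

lemma smooth_on_bounded_linear:
  "bounded_linear T \<Longrightarrow> open S \<Longrightarrow> smooth_on S f \<Longrightarrow> smooth_on S (\<lambda>x. T (f x))"
  unfolding smooth_on_def by (blast intro: Ck_on_bounded_linear)

lemma smooth_on_add: "open S \<Longrightarrow> smooth_on S f \<Longrightarrow> smooth_on S g \<Longrightarrow> smooth_on S (\<lambda>x. f x + g x)"
  unfolding smooth_on_def by (blast intro: Ck_on_add)

lemma smooth_on_bilinear:
  "bounded_bilinear B \<Longrightarrow> open S \<Longrightarrow> smooth_on S f \<Longrightarrow> smooth_on S g \<Longrightarrow> smooth_on S (\<lambda>x. B (f x) (g x))"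
  unfolding smooth_on_def by (blast intro: Ck_on_bilinear)

lemmas smooth_on_mult = smooth_on_bilinear[OF bounded_bilinear_mult]

lemma smooth_on_compose:
  "open S \<Longrightarrow> open T \<Longrightarrow> f ` S \<subseteq> T \<Longrightarrow> smooth_on S f \<Longrightarrow> smooth_on T g \<Longrightarrow> smooth_on S (\<lambda>x. g (f x))"
  unfolding smooth_on_def by (blast intro: Ck_on_compose)

lemma smooth_on_inverse:
  fixes f :: "'e::euclidean_space \<Rightarrow> real"
  shows "open S \<Longrightarrow> (\<And>x. x \<in> S \<Longrightarrow> f x \<noteq> 0) \<Longrightarrow> smooth_on S f \<Longrightarrow> smooth_on S (\<lambda>x. inverse (f x))"
  by (simp add: smooth_on_def Ck_on_inverse)

lemma smooth_on_local:
  "(\<And>x. x \<in> S \<Longrightarrow> \<exists>T. open T \<and> x \<in> T \<and> smooth_on T f) \<Longrightarrow> smooth_on S f"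
  unfolding smooth_on_def by (intro allI Ck_on_local) meson

section \<open>A smooth function that is flat at 0\<close>

text \<open>The family \<open>E n\<close> is closed under differentiation, which makes its member
  \<open>E 0\<close> smooth. At 0 the difference quotient from the right is
  \<open>t^(n+1) / exp t\<close> with \<open>t = 1/y\<close>, and it tends to 0 because the
  exponential dominates.\<close>

lemma has_field_derivative_exp_inverse:
  fixes x :: real
  defines "E \<equiv> \<lambda>n x. if x > 0 then inverse x ^ n * exp (- inverse x) else (0::real)"
  shows "(E n has_field_derivative E (n + 2) x - real n * E (Suc n) x) (at x)"
proof -
  consider "x > 0" | "x < 0" | "x = 0" by linarith
  then show ?thesis
  proof cases
    case 1
    have "((\<lambda>x. inverse x ^ n * exp (- inverse x)) has_field_derivative E (n + 2) x - real n * E (Suc n) x) (at x)"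
    proof -
      have "(inverse has_field_derivative - (inverse x * inverse x)) (at x)"
        using DERIV_inverse[of x] 1 by (simp add: power2_eq_square)
      note DERIV_mult[OF DERIV_power[OF this] DERIV_fun_exp[OF DERIV_minus[OF this]], of n]
      then show ?thesis
        \<comment> \<open>The power rule produces the exponent \<open>n - 1\<close>, truncated when
          \<open>n = 0\<close>; hence the case split.\<close>
        by (rule DERIV_cong) (use 1 in \<open>cases n; simp add: E_def algebra_simps\<close>)
    qed
    then show ?thesis
      by (rule has_field_derivative_transform_within_open[where S = "{0<..}"]) (use 1 in \<open>auto simp: E_def\<close>)
  next
    case 2
    have "((\<lambda>x. 0) has_field_derivative 0) (at x)" by simp
    then show ?thesis
      by (rule has_field_derivative_transform_within_open[where S = "{..<0}", THEN DERIV_cong])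
        (use 2 in \<open>auto simp: E_def\<close>)
  next
    case 3
    have "((\<lambda>y. E n y / y) \<longlongrightarrow> 0) (at_right 0)"
    proof -
      have "((\<lambda>t::real. t ^ Suc n / exp t) \<longlongrightarrow> 0) at_top" by (rule tendsto_power_div_exp_0)
      then have "((\<lambda>y::real. inverse y ^ Suc n / exp (inverse y)) \<longlongrightarrow> 0) (at_right 0)"
        by (rule filterlim_compose[OF _ filterlim_inverse_at_top_right])
      moreover have "eventually (\<lambda>y. inverse y ^ Suc n / exp (inverse y) = E n y / y) (at_right 0)"
        using eventually_at_right_less[of "0::real"]
        by eventually_elim (auto simp: E_def exp_minus divide_inverse mult_ac)
      ultimately show ?thesis by (rule Lim_transform_eventually)
    qed
    moreover have "((\<lambda>y. E n y / y) \<longlongrightarrow> 0) (at_left 0)"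
      by (rule Lim_transform_eventually[OF tendsto_const eventually_at_leftI[of "-1"]]) (auto simp: E_def)
    ultimately have "((\<lambda>y. E n y / y) \<longlongrightarrow> 0) (at 0)"
      by (rule filterlim_split_at[rotated])
    then show ?thesis using 3 by (simp add: has_field_derivative_iff E_def)
  qed
qed

text \<open>The induction on \<open>k\<close> treats all \<open>n\<close> at once, since
  differentiation raises \<open>n\<close>; the claim is the case \<open>n = 0\<close>.\<close>

lemma smooth_on_exp_inverse: "smooth_on UNIV (\<lambda>x::real. if x > 0 then exp (- inverse x) else 0)"
proof -
  let ?E = "\<lambda>n x. if x > 0 then inverse x ^ n * exp (- inverse x) else (0::real)"
  have "Ck_on k UNIV (?E n)" for k n
  proof (induction k arbitrary: n)
    case 0
    show ?case
      unfolding Ck_on.simps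
      by (intro continuous_at_imp_continuous_on ballI DERIV_isCont[OF has_field_derivative_exp_inverse])
  next
    case (Suc k)
    have "Ck_on k UNIV (\<lambda>x. (?E (n + 2) x + (- real n) * ?E (Suc n) x) * v)" for v
      by (intro Ck_on_bilinear[OF bounded_bilinear_mult] Ck_on_add Ck_on_const Suc.IH open_UNIV)
    moreover have "(?E n has_derivative (\<lambda>v. (?E (n + 2) x + (- real n) * ?E (Suc n) x) * v)) (at x)" for x
      using has_field_derivative_exp_inverse[of n x] unfolding has_field_derivative_def by simp
    ultimately show ?case by (intro Ck_on_SucI) auto
  qed
  from this[of _ 0] show ?thesis unfolding smooth_on_def by (simp cong: if_cong)
qed

text \<open>Schwarz's theorem: both orders of differentiation occur as mean values of one second difference.\<close>

lemma second_difference: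
  fixes F :: "'e::euclidean_space \<Rightarrow> real"
  assumes F: "smooth_on S F" and t: "t > 0"
    and S: "\<And>s r. 0 \<le> s \<Longrightarrow> s \<le> t \<Longrightarrow> 0 \<le> r \<Longrightarrow> r \<le> t \<Longrightarrow> x + s *\<^sub>R u + r *\<^sub>R v \<in> S"
  shows "\<exists>s r. 0 \<le> s \<and> s \<le> t \<and> 0 \<le> r \<and> r \<le> t \<and>
     F (x + t *\<^sub>R u + t *\<^sub>R v) - F (x + t *\<^sub>R u) - F (x + t *\<^sub>R v) + F x =
     t * t * frechet_derivative (\<lambda>y. frechet_derivative F (at y) u) (at (x + s *\<^sub>R u + r *\<^sub>R v)) v"
proof -
  let ?Fu = "\<lambda>y. frechet_derivative F (at y) u"
  have line: "((\<lambda>s. G (z + s *\<^sub>R w)) has_real_derivative frechet_derivative G (at (z + s *\<^sub>R w)) w) (at s)"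
    if "smooth_on S G" "z + s *\<^sub>R w \<in> S" for G :: "'e \<Rightarrow> real" and z w s
  proof -
    have dG: "(G has_derivative frechet_derivative G (at (z + s *\<^sub>R w))) (at (z + s *\<^sub>R w))"
      by (rule smooth_on_has_derivative[OF that])
    interpret linear "frechet_derivative G (at (z + s *\<^sub>R w))" using dG by (rule has_derivative_linear)
    have "((\<lambda>s. z + s *\<^sub>R w) has_derivative (\<lambda>d. d *\<^sub>R w)) (at s)"
      by (auto intro!: derivative_eq_intros)
    from has_derivative_compose[OF this dG] show ?thesis
      by (simp add: has_field_derivative_def scaleR mult_commute_abs)
  qed
  \<comment> \<open>The second difference is the increment of \<open>\<phi>\<close> over
    \<open>[0, t]\<close>. The mean value theorem in direction \<open>u\<close> leaves an increment
    of \<open>?Fu\<close> in direction \<open>v\<close>, to which it is applied again.\<close>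
  define \<phi> where "\<phi> s = F ((x + t *\<^sub>R v) + s *\<^sub>R u) - F (x + s *\<^sub>R u)" for s
  have eq: "(x + t *\<^sub>R v) + s *\<^sub>R u = x + s *\<^sub>R u + t *\<^sub>R v" "x + s *\<^sub>R u = x + s *\<^sub>R u + 0 *\<^sub>R v" for s
    by auto
  have d1: "(\<phi> has_real_derivative ?Fu ((x + t *\<^sub>R v) + s *\<^sub>R u) - ?Fu (x + s *\<^sub>R u)) (at s)"
    if "0 \<le> s" "s \<le> t" for s
    unfolding \<phi>_def[abs_def]
    by (rule DERIV_diff[OF line[OF F, of "x + t *\<^sub>R v" s u] line[OF F, of x s u]])
      (use S[of s t] S[of s 0] that t in \<open>simp_all add: eq(1)\<close>)
  obtain s where s: "0 < s" "s < t"
    "\<phi> t - \<phi> 0 = (t - 0) * (?Fu ((x + t *\<^sub>R v) + s *\<^sub>R u) - ?Fu (x + s *\<^sub>R u))"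
    using MVT2[OF t d1] by metis
  have d2: "((\<lambda>r. ?Fu ((x + s *\<^sub>R u) + r *\<^sub>R v)) has_real_derivative
      frechet_derivative ?Fu (at ((x + s *\<^sub>R u) + r *\<^sub>R v)) v) (at r)" if "0 \<le> r" "r \<le> t" for r
    by (rule line[OF smooth_on_frechet_derivative[OF F]]) (use S[of s r] s that in auto)
  obtain r where r: "0 < r" "r < t"
    "?Fu ((x + s *\<^sub>R u) + t *\<^sub>R v) - ?Fu ((x + s *\<^sub>R u) + 0 *\<^sub>R v) =
     (t - 0) * frechet_derivative ?Fu (at ((x + s *\<^sub>R u) + r *\<^sub>R v)) v"
    using MVT2[OF t d2] by metis
  show ?thesis
    using s r by (intro exI[of _ s] exI[of _ r]) (auto simp: \<phi>_def eq(1) algebra_simps)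
qed

text \<open>If the two values at \<open>x\<close> differed, continuity would keep the values of both
  mixed derivatives apart on a ball around \<open>x\<close>. A small parallelogram at
  \<open>x\<close> yields two points of that ball at which a value of one equals a value of the
  other.\<close>

lemma frechet_derivative_commute:
  fixes F :: "'e::euclidean_space \<Rightarrow> real"
  assumes "open S" "smooth_on S F" "x \<in> S"
  shows "frechet_derivative (\<lambda>y. frechet_derivative F (at y) u) (at x) v =
         frechet_derivative (\<lambda>y. frechet_derivative F (at y) v) (at x) u" (is "?A x = ?B x")
proof (rule ccontr)
  assume "?A x \<noteq> ?B x"
  then have e: "0 < \<bar>?A x - ?B x\<bar> / 2" (is "0 < ?e") by simp
  have "continuous_on S ?A" "continuous_on S ?B"
    by (intro smooth_on_imp_continuous_on smooth_on_frechet_derivative assms)+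
  then have "isCont ?A x" "isCont ?B x"
    by (simp_all add: continuous_on_eq_continuous_at[OF assms(1)] assms(3))
  then have "\<exists>d>0. \<forall>y. dist y x < d \<longrightarrow> dist (?A y) (?A x) < ?e" "\<exists>d>0. \<forall>y. dist y x < d \<longrightarrow> dist (?B y) (?B x) < ?e"
    using e unfolding continuous_at_eps_delta by blast+
  then obtain d1 d2 where d: "d1 > 0" "\<And>y. dist y x < d1 \<Longrightarrow> dist (?A y) (?A x) < ?e"
    "d2 > 0" "\<And>y. dist y x < d2 \<Longrightarrow> dist (?B y) (?B x) < ?e" by blast
  obtain d3 where d3: "d3 > 0" "ball x d3 \<subseteq> S" using assms open_contains_ball by blast
  define d where "d = min d1 (min d2 d3)"
  \<comment> \<open>The summand 1 keeps the denominator positive when \<open>u\<close> and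
    \<open>v\<close> vanish; the factor 2 leaves room for the strict inequality in
    \<open>dist\<close>.\<close>
  define t where "t = d / (2 * (norm u + norm v + 1))"
  have pos: "norm u + norm v + 1 > 0" by (smt (verit) norm_ge_zero)
  have "d / (2 * N) * N = d / 2" if "N > 0" for N :: real using that by simp
  from this[OF pos] have half: "t * (norm u + norm v + 1) = d / 2" unfolding t_def .
  have dpos: "d > 0" using d d3 by (simp add: d_def)
  then have t: "t > 0" using pos by (simp add: t_def)
  have dist: "dist (x + s *\<^sub>R u + r *\<^sub>R v) x < d" if "0 \<le> s" "s \<le> t" "0 \<le> r" "r \<le> t" for s r
  proof -
    have "dist (x + s *\<^sub>R u + r *\<^sub>R v) x \<le> s * norm u + r * norm v"
      using that norm_triangle_ineq[of "s *\<^sub>R u" "r *\<^sub>R v"] by (simp add: dist_norm add.assoc)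
    also have "\<dots> \<le> t * (norm u + norm v + 1)"
      using that t mult_right_mono[of s t "norm u"] mult_right_mono[of r t "norm v"] by (simp add: algebra_simps)
    also have "\<dots> = d / 2" by (rule half)
    finally show ?thesis using dpos by simp
  qed
  then have S: "x + s *\<^sub>R u + r *\<^sub>R v \<in> S" if "0 \<le> s" "s \<le> t" "0 \<le> r" "r \<le> t" for s r
    using that d3(2) by (force simp: d_def mem_ball dist_commute)
  obtain s r where 1: "0 \<le> s" "s \<le> t" "0 \<le> r" "r \<le> t"
    "F (x + t *\<^sub>R u + t *\<^sub>R v) - F (x + t *\<^sub>R u) - F (x + t *\<^sub>R v) + F x = t * t * ?A (x + s *\<^sub>R u + r *\<^sub>R v)"
    using second_difference[OF assms(2) t S] by blast
  \<comment> \<open>The second difference is symmetric in \<open>u\<close> and \<open>v\<close>, so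
    exchanging the directions evaluates the same number.\<close>
  have "\<exists>s' r'. 0 \<le> s' \<and> s' \<le> t \<and> 0 \<le> r' \<and> r' \<le> t \<and>
     F (x + t *\<^sub>R v + t *\<^sub>R u) - F (x + t *\<^sub>R v) - F (x + t *\<^sub>R u) + F x = t * t * ?B (x + s' *\<^sub>R v + r' *\<^sub>R u)"
  proof (rule second_difference[OF assms(2) t])
    fix s r assume "0 \<le> s" "s \<le> t" "0 \<le> r" "r \<le> t"
    then show "x + s *\<^sub>R v + r *\<^sub>R u \<in> S" using S[of r s] by (simp add: algebra_simps)
  qed
  then obtain s' r' where 2: "0 \<le> s'" "s' \<le> t" "0 \<le> r'" "r' \<le> t"
    "F (x + t *\<^sub>R v + t *\<^sub>R u) - F (x + t *\<^sub>R v) - F (x + t *\<^sub>R u) + F x = t * t * ?B (x + s' *\<^sub>R v + r' *\<^sub>R u)"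
    by blast
  have c1: "x + s' *\<^sub>R v + r' *\<^sub>R u = x + r' *\<^sub>R u + s' *\<^sub>R v" by simp
  have c2: "x + t *\<^sub>R v + t *\<^sub>R u = x + t *\<^sub>R u + t *\<^sub>R v" by simp
  have "t * t * ?A (x + s *\<^sub>R u + r *\<^sub>R v) = t * t * ?B (x + r' *\<^sub>R u + s' *\<^sub>R v)"
    using 1(5) 2(5)[unfolded c1 c2] by linarith
  then have "?A (x + s *\<^sub>R u + r *\<^sub>R v) = ?B (x + r' *\<^sub>R u + s' *\<^sub>R v)" using t by simp
  moreover have "dist (?A (x + s *\<^sub>R u + r *\<^sub>R v)) (?A x) < ?e"
    using dist[of s r] 1 by (intro d(2)) (simp add: d_def)
  moreover have "dist (?B (x + r' *\<^sub>R u + s' *\<^sub>R v)) (?B x) < ?e"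
    using dist[of r' s'] 2 by (intro d(4)) (simp add: d_def)
  ultimately show False by (simp add: dist_real_def abs_if split: if_splits)
qed


section \<open>Tangent vectors and vector fields\<close>

context smooth_manifold
begin

section \<open>Charts and smooth functions\<close>

abbreviation XM :: "'a vfield set" where "XM \<equiv> vfields UNIV"
abbreviation CM :: "('a \<Rightarrow> real) \<Rightarrow> bool" where "CM \<equiv> smooth_fun UNIV"

lemma chart:
  assumes "(C, \<phi>) \<in> atlas"
  shows "open C" "open (\<phi> ` C)" "homeomorphism C (\<phi> ` C) \<phi> (inv_into C \<phi>)"
    and "\<And>q. q \<in> C \<Longrightarrow> inv_into C \<phi> (\<phi> q) = q"
  using assms atlas by (auto simp: smooth_atlas_def homeomorphism_def)

lemma chart_at:
  obtains C \<phi> where "(C, \<phi>) \<in> atlas" "p \<in> C"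
proof -
  have "p \<in> (\<Union>(U, \<phi>)\<in>atlas. U)" using atlas by (simp add: smooth_atlas_def)
  then show ?thesis using that by auto
qed

lemma chart_transition:
  assumes "(C, \<phi>) \<in> atlas" "(D, \<psi>) \<in> atlas"
  shows "smooth_on (\<phi> ` (C \<inter> D)) (\<psi> \<circ> inv_into C \<phi>)"
proof -
  have "\<forall>(U, \<phi>)\<in>atlas. \<forall>(V, \<psi>)\<in>atlas. smooth_on (\<phi> ` (U \<inter> V)) (\<psi> \<circ> inv_into U \<phi>)"
    using atlas by (simp add: smooth_atlas_def)
  then show ?thesis using assms by fastforce
qed

lemma chart_image_open:
  assumes "(C, \<phi>) \<in> atlas" "open W"
  shows "open (\<phi> ` (C \<inter> W))"
proof -
  have "openin (top_of_set (\<phi> ` C)) (\<phi> ` (C \<inter> W))"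
    by (rule homeomorphism_imp_open_map[OF chart(3)[OF assms(1)]]) (use assms(2) in \<open>simp add: openin_open_Int\<close>)
  then show ?thesis using chart(2)[OF assms(1)] openin_open_eq by blast
qed

lemma smooth_funD:
  assumes "smooth_fun W f" "(C, \<phi>) \<in> atlas"
  shows "smooth_on (\<phi> ` (C \<inter> W)) (f \<circ> inv_into C \<phi>)"
  using assms unfolding smooth_fun_def by fastforce

lemma smooth_funI:
  assumes "\<And>C \<phi>. (C, \<phi>) \<in> atlas \<Longrightarrow> smooth_on (\<phi> ` (C \<inter> W)) (f \<circ> inv_into C \<phi>)"
  shows "smooth_fun W f"
  using assms unfolding smooth_fun_def by fastforce

lemma smooth_fun_subset: "smooth_fun W f \<Longrightarrow> V \<subseteq> W \<Longrightarrow> smooth_fun V f"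
  by (rule smooth_funI, rule smooth_on_subset[OF smooth_funD]) auto

lemma smooth_fun_local:
  assumes "\<And>p. p \<in> W \<Longrightarrow> \<exists>V. open V \<and> p \<in> V \<and> smooth_fun V f"
  shows "smooth_fun W f"
proof (rule smooth_funI, rule smooth_on_local)
  fix C \<phi> x assume C: "(C, \<phi>) \<in> atlas" and "x \<in> \<phi> ` (C \<inter> W)"
  then obtain p where p: "p \<in> C" "p \<in> W" "x = \<phi> p" by auto
  then obtain V where "open V" "p \<in> V" "smooth_fun V f" using assms by blast
  then show "\<exists>T. open T \<and> x \<in> T \<and> smooth_on T (f \<circ> inv_into C \<phi>)"
    using p chart_image_open[OF C, of V] smooth_funD[OF _ C, of V f] by (intro exI[of _ "\<phi> ` (C \<inter> V)"]) auto
qed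

lemma smooth_fun_cong:
  assumes "open W" "\<And>p. p \<in> W \<Longrightarrow> f p = g p" "smooth_fun W f"
  shows "smooth_fun W g"
proof (rule smooth_funI)
  fix C \<phi> assume C: "(C, \<phi>) \<in> atlas"
  show "smooth_on (\<phi> ` (C \<inter> W)) (g \<circ> inv_into C \<phi>)"
    by (rule smooth_on_cong[OF chart_image_open[OF C assms(1)] _ smooth_funD[OF assms(3) C]])
      (use assms(2) chart(4)[OF C] in auto)
qed

text \<open>The definition of \<open>smooth_fun\<close> tests every chart; composition with the
  smooth transition maps reduces this to a single chart around \<open>V\<close>.\<close>

lemma smooth_fun_chartI:
  assumes C: "(C, \<phi>) \<in> atlas" and V: "open V" "V \<subseteq> C" and f: "smooth_on (\<phi> ` V) (f \<circ> inv_into C \<phi>)"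
  shows "smooth_fun V f"
proof (rule smooth_funI)
  fix D \<psi> assume D: "(D, \<psi>) \<in> atlas"
  have VC: "C \<inter> V = V" using V by auto
  have S: "open (\<psi> ` (D \<inter> V))" "open (\<phi> ` V)"
    using chart_image_open[OF D V(1)] chart_image_open[OF C V(1)] VC by auto
  have t: "smooth_on (\<psi> ` (D \<inter> V)) (\<phi> \<circ> inv_into D \<psi>)"
    by (rule smooth_on_subset[OF chart_transition[OF D C]]) (use V in auto)
  have "smooth_on (\<psi> ` (D \<inter> V)) (\<lambda>x. (f \<circ> inv_into C \<phi>) ((\<phi> \<circ> inv_into D \<psi>) x))"
    by (rule smooth_on_compose[OF S _ t f]) (use chart(4)[OF D] in auto)
  then show "smooth_on (\<psi> ` (D \<inter> V)) (f \<circ> inv_into D \<psi>)"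
    by (rule smooth_on_cong[OF S(1), rotated]) (use chart(4)[OF D] chart(4)[OF C] V in auto)
qed

lemma smooth_fun_const [simp, intro]: "smooth_fun W (\<lambda>p. c)"
  by (rule smooth_funI) (simp add: comp_def smooth_on_const)

lemma smooth_fun_add:
  assumes "open W" "smooth_fun W f" "smooth_fun W g"
  shows "smooth_fun W (\<lambda>p. f p + g p)"
  by (rule smooth_funI, use smooth_on_add[OF chart_image_open[OF _ assms(1)] smooth_funD[OF assms(2)] smooth_funD[OF assms(3)]]
      in \<open>simp add: comp_def\<close>)

lemma smooth_fun_mult:
  assumes "open W" "smooth_fun W f" "smooth_fun W g"
  shows "smooth_fun W (\<lambda>p. f p * g p)"
  by (rule smooth_funI, use smooth_on_mult[OF chart_image_open[OF _ assms(1)] smooth_funD[OF assms(2)] smooth_funD[OF assms(3)]]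
      in \<open>simp add: comp_def\<close>)

lemma smooth_fun_inverse:
  assumes "open W" "\<And>p. p \<in> W \<Longrightarrow> f p \<noteq> 0" "smooth_fun W f"
  shows "smooth_fun W (\<lambda>p. inverse (f p))"
proof (rule smooth_funI)
  fix C \<phi> assume C: "(C, \<phi>) \<in> atlas"
  have "smooth_on (\<phi> ` (C \<inter> W)) (\<lambda>x. inverse ((f \<circ> inv_into C \<phi>) x))"
    by (rule smooth_on_inverse[OF chart_image_open[OF C assms(1)] _ smooth_funD[OF assms(3) C]])
      (use assms(2) chart(4)[OF C] in auto)
  then show "smooth_on (\<phi> ` (C \<inter> W)) ((\<lambda>p. inverse (f p)) \<circ> inv_into C \<phi>)" by (simp add: comp_def)
qed

lemma smooth_fun_minus:
  assumes "open W" "smooth_fun W f" shows "smooth_fun W (\<lambda>p. - f p)"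
  using smooth_fun_mult[OF assms(1) smooth_fun_const[of W "-1"] assms(2)] by simp

lemma smooth_fun_diff:
  assumes "open W" "smooth_fun W f" "smooth_fun W g"
  shows "smooth_fun W (\<lambda>p. f p - g p)"
  using smooth_fun_add[OF assms(1,2) smooth_fun_minus[OF assms(1,3)]] by simp

lemma smooth_fun_sum:
  assumes "open W" "\<And>i. i \<in> I \<Longrightarrow> smooth_fun W (f i)"
  shows "smooth_fun W (\<lambda>p. \<Sum>i\<in>I. f i p)"
  using assms(2)
  by (induction I rule: infinite_finite_induct) (auto intro: smooth_fun_add[OF assms(1)])

lemma smooth_fun_prod:
  assumes "open W" "\<And>i. i \<in> I \<Longrightarrow> smooth_fun W (f i)"
  shows "smooth_fun W (\<lambda>p. \<Prod>i\<in>I. f i p)"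
  using assms(2)
  by (induction I rule: infinite_finite_induct) (auto intro: smooth_fun_mult[OF assms(1)])

lemma smooth_nearI: "open W \<Longrightarrow> p \<in> W \<Longrightarrow> smooth_fun W f \<Longrightarrow> smooth_near p f"
  unfolding smooth_near_def by blast

lemma smooth_near_subset:
  assumes "smooth_near p f" "open U" "p \<in> U"
  obtains W where "open W" "p \<in> W" "W \<subseteq> U" "smooth_fun W f"
proof -
  obtain W where "open W" "p \<in> W" "smooth_fun W f" using assms(1) unfolding smooth_near_def by blast
  then show ?thesis using that[of "W \<inter> U"] assms smooth_fun_subset[of W f "W \<inter> U"] by auto
qed

lemma smooth_near_cong:
  assumes "open W" "p \<in> W" "\<And>q. q \<in> W \<Longrightarrow> f q = g q"
  shows "smooth_near p f \<longleftrightarrow> smooth_near p g"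
proof -
  have "smooth_near p g" if "smooth_near p f" "\<And>q. q \<in> W \<Longrightarrow> f q = g q" for f g
  proof -
    from that(1) assms(1,2) obtain V where V: "open V" "p \<in> V" "V \<subseteq> W" "smooth_fun V f"
      by (rule smooth_near_subset)
    then have "smooth_fun V g" using smooth_fun_cong[OF V(1) _ V(4)] that(2) by blast
    then show ?thesis using smooth_nearI V by blast
  qed
  from this[of f g] this[of g f] assms(3) show ?thesis by auto
qed

lemma smooth_near_has_derivative:
  assumes C: "(C, \<phi>) \<in> atlas" "p \<in> C" and "smooth_near p f"
  shows "((f \<circ> inv_into C \<phi>) has_derivative frechet_derivative (f \<circ> inv_into C \<phi>) (at (\<phi> p))) (at (\<phi> p))"
proof -
  obtain W where "open W" "p \<in> W" "smooth_fun W f" using assms(3) unfolding smooth_near_def by blast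
  then show ?thesis using smooth_on_has_derivative[OF smooth_funD[OF _ C(1)]] C(2) by blast
qed

section \<open>Tangent spaces in a fixed chart\<close>

definition chart_vec :: "'a set \<Rightarrow> ('a \<Rightarrow> real ^ 'n) \<Rightarrow> 'a \<Rightarrow> real ^ 'n \<Rightarrow> 'a tvec" where
  "chart_vec C \<phi> p w = (\<lambda>f. if smooth_near p f then frechet_derivative (f \<circ> inv_into C \<phi>) (at (\<phi> p)) w else 0)"

text \<open>By the chain rule, differentiation along \<open>w\<close> in another chart is
  differentiation in this chart along the image of \<open>w\<close> under the derivative of the
  transition map. One chart therefore carries the whole tangent space, and with it the linear
  structure.\<close>

lemma tangent_space_chart:
  assumes C: "(C, \<phi>) \<in> atlas" "p \<in> C"
  shows "tangent_space p = range (chart_vec C \<phi> p)"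
proof
  show "range (chart_vec C \<phi> p) \<subseteq> tangent_space p"
    using C unfolding tangent_space_def chart_vec_def by fastforce
  show "tangent_space p \<subseteq> range (chart_vec C \<phi> p)"
  proof
    fix u assume "u \<in> tangent_space p"
    then obtain D \<psi> w where D: "(D, \<psi>) \<in> atlas" "p \<in> D" and u: "u = chart_vec D \<psi> p w"
      unfolding tangent_space_def chart_vec_def by fastforce
    let ?t = "\<phi> \<circ> inv_into D \<psi>"
    have inv: "inv_into D \<psi> (\<psi> p) = p" using chart(4)[OF D(1)] D(2) by simp
    have S: "open (\<psi> ` (D \<inter> C))" by (rule chart_image_open[OF D(1) chart(1)[OF C(1)]])
    have t: "(?t has_derivative frechet_derivative ?t (at (\<psi> p))) (at (\<psi> p))"
      by (rule smooth_on_has_derivative[OF chart_transition[OF D(1) C(1)]]) (use C D in auto)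
    have "u f = chart_vec C \<phi> p (frechet_derivative ?t (at (\<psi> p)) w) f" for f
    proof (cases "smooth_near p f")
      case True
      have "((f \<circ> inv_into C \<phi>) has_derivative frechet_derivative (f \<circ> inv_into C \<phi>) (at (\<phi> p))) (at (?t (\<psi> p)))"
        using smooth_near_has_derivative[OF C True] by (simp add: inv)
      from has_derivative_compose[OF t this]
      have "((f \<circ> inv_into D \<psi>) has_derivative
          (\<lambda>x. frechet_derivative (f \<circ> inv_into C \<phi>) (at (\<phi> p)) (frechet_derivative ?t (at (\<psi> p)) x))) (at (\<psi> p))"
        by (rule has_derivative_transform_within_open[OF _ S])
          (use C D chart(4)[OF D(1)] chart(4)[OF C(1)] in auto)
      then have "frechet_derivative (f \<circ> inv_into D \<psi>) (at (\<psi> p)) =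
          (\<lambda>x. frechet_derivative (f \<circ> inv_into C \<phi>) (at (\<phi> p)) (frechet_derivative ?t (at (\<psi> p)) x))"
        using frechet_derivative_at by metis
      then show ?thesis by (simp add: u chart_vec_def)
    qed (simp add: u chart_vec_def)
    then show "u \<in> range (chart_vec C \<phi> p)" by blast
  qed
qed

lemma chart_vec_in_tangent_space:
  "(C, \<phi>) \<in> atlas \<Longrightarrow> p \<in> C \<Longrightarrow> chart_vec C \<phi> p w \<in> tangent_space p"
  by (simp add: tangent_space_chart)

lemma chart_vec_lincomb:
  assumes C: "(C, \<phi>) \<in> atlas" "p \<in> C"
  shows "chart_vec C \<phi> p (a *\<^sub>R v + b *\<^sub>R w) f = a * chart_vec C \<phi> p v f + b * chart_vec C \<phi> p w f"
proof (cases "smooth_near p f")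
  case True
  interpret linear "frechet_derivative (f \<circ> inv_into C \<phi>) (at (\<phi> p))"
    using smooth_near_has_derivative[OF C True] has_derivative_linear by blast
  show ?thesis by (simp add: True chart_vec_def add scaleR)
qed (simp add: chart_vec_def)

lemma tangent_lincomb:
  assumes "u \<in> tangent_space p" "v \<in> tangent_space p"
  shows "(\<lambda>f. a * u f + b * v f) \<in> tangent_space p"
proof -
  obtain C \<phi> where C: "(C, \<phi>) \<in> atlas" "p \<in> C" by (rule chart_at)
  then obtain w z where "u = chart_vec C \<phi> p w" "v = chart_vec C \<phi> p z"
    using assms tangent_space_chart by auto
  then have "(\<lambda>f. a * u f + b * v f) = chart_vec C \<phi> p (a *\<^sub>R w + b *\<^sub>R z)"
    using chart_vec_lincomb[OF C] by auto
  then show ?thesis using chart_vec_in_tangent_space[OF C] by simp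
qed

lemma tangent_not_smooth_near: "u \<in> tangent_space p \<Longrightarrow> \<not> smooth_near p f \<Longrightarrow> u f = 0"
  unfolding tangent_space_def by auto

text \<open>Functions that agree near \<open>p\<close> are smooth near \<open>p\<close>
  simultaneously, so the default value 0 respects locality as well.\<close>

lemma tangent_cong:
  assumes u: "u \<in> tangent_space p" and W: "open W" "p \<in> W" "\<And>q. q \<in> W \<Longrightarrow> f q = g q"
  shows "u f = u g"
proof (cases "smooth_near p f")
  case True
  obtain C \<phi> where C: "(C, \<phi>) \<in> atlas" "p \<in> C" by (rule chart_at)
  then obtain w where w: "u = chart_vec C \<phi> p w" using u tangent_space_chart by auto
  have "frechet_derivative (f \<circ> inv_into C \<phi>) (at (\<phi> p)) = frechet_derivative (g \<circ> inv_into C \<phi>) (at (\<phi> p))"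
    by (rule frechet_derivative_transform_within_open[OF _ chart_image_open[OF C(1) W(1)]])
      (use smooth_near_has_derivative[OF C True] C W chart(4)[OF C(1)] in \<open>auto simp: differentiable_def\<close>)
  then show ?thesis using smooth_near_cong[OF W(1,2), of f g] W(3) by (simp add: w chart_vec_def)
next
  case False
  then show ?thesis
    using smooth_near_cong[OF W(1,2), of f g] W(3) tangent_not_smooth_near[OF u] by metis
qed

lemma tangent_const: "u \<in> tangent_space p \<Longrightarrow> u (\<lambda>q. c) = 0"
  unfolding tangent_space_def by (auto simp: comp_def)

lemma tangent_derivation:
  assumes u: "u \<in> tangent_space p" and f: "smooth_near p f" and g: "smooth_near p g"
  shows "u (\<lambda>q. f q + g q) = u f + u g" "u (\<lambda>q. f q * g q) = f p * u g + g p * u f"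
proof -
  obtain C \<phi> where C: "(C, \<phi>) \<in> atlas" "p \<in> C" by (rule chart_at)
  then obtain w where w: "u = chart_vec C \<phi> p w" using u tangent_space_chart by auto
  from f open_UNIV UNIV_I obtain W1 where W1: "open W1" "p \<in> W1" "smooth_fun W1 f"
    by (rule smooth_near_subset)
  from g W1(1,2) obtain W where W: "open W" "p \<in> W" "W \<subseteq> W1" "smooth_fun W g"
    by (rule smooth_near_subset)
  have fW: "smooth_fun W f" using smooth_fun_subset W1 W by blast
  have s: "smooth_near p (\<lambda>q. f q + g q)" "smooth_near p (\<lambda>q. f q * g q)"
    using smooth_nearI[OF W(1,2)] smooth_fun_add[OF W(1) fW W(4)] smooth_fun_mult[OF W(1) fW W(4)] by auto
  have inv: "inv_into C \<phi> (\<phi> p) = p" using chart(4) C by simp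
  note d = smooth_near_has_derivative[OF C f] smooth_near_has_derivative[OF C g]
  from frechet_derivative_at[OF has_derivative_add[OF d]] frechet_derivative_at[OF has_derivative_mult[OF d]]
  show "u (\<lambda>q. f q + g q) = u f + u g" "u (\<lambda>q. f q * g q) = f p * u g + g p * u f"
    using f g s by (auto simp: w chart_vec_def comp_def inv fun_eq_iff algebra_simps)
qed

lemmas tangent_add = tangent_derivation(1)
lemmas tangent_mult = tangent_derivation(2)

lemma tangent_minus:
  assumes "u \<in> tangent_space p" "smooth_near p f"
  shows "u (\<lambda>q. - f q) = - u f"
  using tangent_mult[OF assms(1) smooth_nearI[OF open_UNIV UNIV_I smooth_fun_const] assms(2), of "-1"]
    tangent_const[OF assms(1)] by simp

lemma tangent_sum:
  assumes "u \<in> tangent_space p" "open W" "p \<in> W" "\<And>i. i \<in> I \<Longrightarrow> smooth_fun W (g i)"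
  shows "u (\<lambda>q. \<Sum>i\<in>I. g i q) = (\<Sum>i\<in>I. u (g i))"
  using assms(4)
proof (induction I rule: infinite_finite_induct)
  case (insert i I)
  have "smooth_near p (g i)" "smooth_near p (\<lambda>q. \<Sum>i\<in>I. g i q)"
    using insert.prems by (auto intro!: smooth_nearI[OF assms(2,3)] smooth_fun_sum[OF assms(2)])
  from tangent_add[OF assms(1) this] show ?case using insert by simp
qed (use tangent_const[OF assms(1)] in auto)

section \<open>Vector fields\<close>

lemma vfields_tangent: "X \<in> vfields U \<Longrightarrow> p \<in> U \<Longrightarrow> X p \<in> tangent_space p"
  by (simp add: vfields_def)

lemma vfields_smooth: "X \<in> vfields U \<Longrightarrow> open V \<Longrightarrow> V \<subseteq> U \<Longrightarrow> smooth_fun V f \<Longrightarrow> smooth_fun V (\<lambda>p. X p f)"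
  by (simp add: vfields_def)

lemma vfieldsI:
  assumes "\<And>p. p \<in> U \<Longrightarrow> X p \<in> tangent_space p"
    and "\<And>V f. open V \<Longrightarrow> V \<subseteq> U \<Longrightarrow> smooth_fun V f \<Longrightarrow> smooth_fun V (\<lambda>p. X p f)"
  shows "X \<in> vfields U"
  using assms by (simp add: vfields_def)

lemma vfields_subset: "X \<in> vfields U \<Longrightarrow> V \<subseteq> U \<Longrightarrow> X \<in> vfields V"
  by (auto simp: vfields_def)

text \<open>Meant for fields that are chosen point by point or extended by 0, whose smoothness is
  visible only on suitable neighbourhoods.\<close>

lemma vfields_local:
  assumes "\<And>p. p \<in> U \<Longrightarrow> \<exists>V Y. open V \<and> p \<in> V \<and> Y \<in> vfields V \<and> (\<forall>q\<in>V. X q = Y q)"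
  shows "X \<in> vfields U"
proof (rule vfieldsI)
  show "X p \<in> tangent_space p" if "p \<in> U" for p
    using assms[OF that] vfields_tangent by metis
  fix W f assume W: "open W" "W \<subseteq> U" "smooth_fun W f"
  show "smooth_fun W (\<lambda>p. X p f)"
  proof (rule smooth_fun_local)
    fix p assume p: "p \<in> W"
    then obtain V Y where V: "open V" "p \<in> V" "Y \<in> vfields V" "\<forall>q\<in>V. X q = Y q" using assms W by blast
    have o: "open (V \<inter> W)" using V W by auto
    have "smooth_fun (V \<inter> W) (\<lambda>p. Y p f)"
      by (rule vfields_smooth[OF V(3) o]) (auto intro: smooth_fun_subset[OF W(3)])
    then have "smooth_fun (V \<inter> W) (\<lambda>p. X p f)"
      by (rule smooth_fun_cong[OF o, rotated]) (use V in auto)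
    then show "\<exists>V. open V \<and> p \<in> V \<and> smooth_fun V (\<lambda>p. X p f)" using o p V by blast
  qed
qed

lemma vfields_cong:
  assumes "open U" "\<And>q. q \<in> U \<Longrightarrow> X q = Y q" "Y \<in> vfields U"
  shows "X \<in> vfields U"
  by (rule vfields_local) (use assms in blast)

lemma vfields_lincomb:
  assumes "open U" "X \<in> vfields U" "Y \<in> vfields U" "smooth_fun U a" "smooth_fun U b"
  shows "(\<lambda>p f. a p * X p f + b p * Y p f) \<in> vfields U"
proof (rule vfieldsI)
  show "(\<lambda>f. a p * X p f + b p * Y p f) \<in> tangent_space p" if "p \<in> U" for p
    by (rule tangent_lincomb[OF vfields_tangent[OF assms(2) that] vfields_tangent[OF assms(3) that]])
  fix V f assume V: "open V" "V \<subseteq> U" "smooth_fun V f"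
  show "smooth_fun V (\<lambda>p. a p * X p f + b p * Y p f)"
    by (intro smooth_fun_add smooth_fun_mult V(1) vfields_smooth[OF assms(2) V] vfields_smooth[OF assms(3) V]
        smooth_fun_subset[OF assms(4) V(2)] smooth_fun_subset[OF assms(5) V(2)])
qed

lemma tangent_zero: "(\<lambda>f. 0) \<in> tangent_space p"
proof -
  obtain C \<phi> where C: "(C, \<phi>) \<in> atlas" "p \<in> C" by (rule chart_at)
  from tangent_lincomb[OF chart_vec_in_tangent_space[OF this] chart_vec_in_tangent_space[OF this], of 0 undefined 0 undefined]
  show ?thesis by simp
qed

lemma tangent_lincomb_sum:
  assumes "\<And>i. i \<in> I \<Longrightarrow> u i \<in> tangent_space p"
  shows "(\<lambda>f. \<Sum>i\<in>I. c i * u i f) \<in> tangent_space p"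
  using assms
proof (induction I rule: infinite_finite_induct)
  case (insert i I)
  then have "u i \<in> tangent_space p" "(\<lambda>f. \<Sum>i\<in>I. c i * u i f) \<in> tangent_space p" by auto
  from tangent_lincomb[OF this, of "c i" 1] show ?case by (simp add: insert.hyps)
qed (auto simp: tangent_zero)

lemma vfields_sum:
  assumes "open U" "\<And>i. i \<in> I \<Longrightarrow> E i \<in> vfields U" "\<And>i. i \<in> I \<Longrightarrow> smooth_fun U (c i)"
  shows "(\<lambda>p f. \<Sum>i\<in>I. c i p * E i p f) \<in> vfields U"
proof (rule vfieldsI)
  show "(\<lambda>f. \<Sum>i\<in>I. c i p * E i p f) \<in> tangent_space p" if "p \<in> U" for p
    by (rule tangent_lincomb_sum) (rule vfields_tangent[OF assms(2) that])
  fix V f assume V: "open V" "V \<subseteq> U" "smooth_fun V f"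
  show "smooth_fun V (\<lambda>p. \<Sum>i\<in>I. c i p * E i p f)"
    by (intro smooth_fun_sum smooth_fun_mult V(1) vfields_smooth[OF assms(2) V]
        smooth_fun_subset[OF assms(3) V(2)])
qed

section \<open>Coordinate fields and the Lie bracket\<close>

definition coord_field :: "'a set \<Rightarrow> ('a \<Rightarrow> real ^ 'n) \<Rightarrow> 'n \<Rightarrow> 'a vfield" where
  "coord_field C \<phi> i = (\<lambda>p. chart_vec C \<phi> p (axis i 1))"

lemma coord_field_in_chart:
  assumes C: "(C, \<phi>) \<in> atlas" and V: "open V" "V \<subseteq> C" and f: "smooth_fun V f" and x: "x \<in> \<phi> ` V"
  shows "coord_field C \<phi> i (inv_into C \<phi> x) f = frechet_derivative (f \<circ> inv_into C \<phi>) (at x) (axis i 1)"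
proof -
  obtain p where p: "p \<in> V" "x = \<phi> p" using x by auto
  then have "inv_into C \<phi> x = p" using chart(4)[OF C] V by auto
  then show ?thesis using p smooth_nearI[OF V(1) p(1) f] by (simp add: coord_field_def chart_vec_def)
qed

lemma coord_field_vfields:
  assumes C: "(C, \<phi>) \<in> atlas"
  shows "coord_field C \<phi> i \<in> vfields C"
proof (rule vfieldsI)
  show "coord_field C \<phi> i p \<in> tangent_space p" if "p \<in> C" for p
    using chart_vec_in_tangent_space[OF C that] by (simp add: coord_field_def)
  fix V f assume V: "open V" "V \<subseteq> C" "smooth_fun V f"
  have VC: "C \<inter> V = V" using V by auto
  have o: "open (\<phi> ` V)" using chart_image_open[OF C V(1)] VC by simp
  have "smooth_on (\<phi> ` V) (\<lambda>x. frechet_derivative (f \<circ> inv_into C \<phi>) (at x) (axis i 1))"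
    using smooth_on_frechet_derivative[OF smooth_funD[OF V(3) C]] VC by simp
  then have "smooth_on (\<phi> ` V) ((\<lambda>p. coord_field C \<phi> i p f) \<circ> inv_into C \<phi>)"
    by (rule smooth_on_cong[OF o, rotated]) (simp add: coord_field_in_chart[OF C V])
  then show "smooth_fun V (\<lambda>p. coord_field C \<phi> i p f)" by (rule smooth_fun_chartI[OF C V(1,2)])
qed

text \<open>Read in the chart, both sides are second partial derivatives of the same function, so
  Schwarz's theorem applies.\<close>

lemma coord_field_commute:
  assumes C: "(C, \<phi>) \<in> atlas" and p: "p \<in> C" and f: "smooth_near p f"
  shows "coord_field C \<phi> i p (\<lambda>q. coord_field C \<phi> j q f) = coord_field C \<phi> j p (\<lambda>q. coord_field C \<phi> i q f)"
proof -
  from f chart(1)[OF C] p obtain W where W: "open W" "p \<in> W" "W \<subseteq> C" "smooth_fun W f"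
    by (rule smooth_near_subset)
  let ?F = "f \<circ> inv_into C \<phi>"
  have CW: "C \<inter> W = W" using W by auto
  have o: "open (\<phi> ` W)" and F: "smooth_on (\<phi> ` W) ?F"
    using chart_image_open[OF C W(1)] smooth_funD[OF W(4) C] CW by auto
  have "coord_field C \<phi> i p (\<lambda>q. coord_field C \<phi> j q f) =
      frechet_derivative (\<lambda>x. frechet_derivative ?F (at x) (axis j 1)) (at (\<phi> p)) (axis i 1)" for i j
  proof -
    have sf: "smooth_fun W (\<lambda>q. coord_field C \<phi> j q f)"
      by (rule vfields_smooth[OF coord_field_vfields[OF C] W(1,3,4)])
    have sm: "smooth_on (\<phi> ` W) (\<lambda>x. frechet_derivative ?F (at x) (axis j 1))"
      by (rule smooth_on_frechet_derivative[OF F])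
    have eq: "frechet_derivative (\<lambda>x. frechet_derivative ?F (at x) (axis j 1)) (at (\<phi> p)) =
        frechet_derivative ((\<lambda>q. coord_field C \<phi> j q f) \<circ> inv_into C \<phi>) (at (\<phi> p))"
      by (rule frechet_derivative_transform_within_open[OF smooth_on_imp_differentiable[OF sm] o])
        (use W in \<open>auto simp: coord_field_in_chart[OF C W(1,3,4)]\<close>)
    show ?thesis
      using coord_field_in_chart[OF C W(1,3) sf, of "\<phi> p" i] W(2) p chart(4)[OF C p] eq by simp
  qed
  then show ?thesis using frechet_derivative_commute[OF o F, of "\<phi> p"] W(2) by simp
qed

text \<open>Outside \<open>C\<close> the coordinate function is arbitrary; this is harmless because
  tangent vectors see functions only near their base point.\<close>

lemma chart_component_smooth:
  assumes C: "(C, \<phi>) \<in> atlas"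
  shows "smooth_fun C (\<lambda>q. \<phi> q $ i)"
proof (rule smooth_fun_chartI[OF C chart(1)[OF C] subset_refl])
  have "smooth_on (\<phi> ` C) (\<lambda>x::real^'n. x $ i)"
    by (rule smooth_on_bounded_linear[OF bounded_linear_vec_nth chart(2)[OF C] smooth_on_id[OF chart(2)[OF C]]])
  then show "smooth_on (\<phi> ` C) ((\<lambda>q. \<phi> q $ i) \<circ> inv_into C \<phi>)"
    by (rule smooth_on_cong[OF chart(2)[OF C], rotated]) (use chart(4)[OF C] in auto)
qed

lemma chart_vec_component:
  assumes C: "(C, \<phi>) \<in> atlas" "p \<in> C"
  shows "chart_vec C \<phi> p w (\<lambda>q. \<phi> q $ i) = w $ i"
proof -
  have s: "smooth_near p (\<lambda>q. \<phi> q $ i)"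
    by (rule smooth_nearI[OF chart(1)[OF C(1)] C(2) chart_component_smooth[OF C(1)]])
  have "((\<lambda>x::real^'n. x $ i) has_derivative (\<lambda>x. x $ i)) (at (\<phi> p))"
    by (rule bounded_linear_imp_has_derivative[OF bounded_linear_vec_nth])
  then have "((\<lambda>q. \<phi> q $ i) \<circ> inv_into C \<phi> has_derivative (\<lambda>x. x $ i)) (at (\<phi> p))"
    by (rule has_derivative_transform_within_open[OF _ chart(2)[OF C(1)]])
      (use C chart(4)[OF C(1)] in auto)
  from frechet_derivative_at[OF this, symmetric] show ?thesis by (simp add: chart_vec_def s)
qed

lemma chart_vec_coord:
  assumes C: "(C, \<phi>) \<in> atlas" "p \<in> C"
  shows "chart_vec C \<phi> p w f = (\<Sum>i\<in>UNIV. w $ i * coord_field C \<phi> i p f)"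
proof (cases "smooth_near p f")
  case True
  interpret linear "frechet_derivative (f \<circ> inv_into C \<phi>) (at (\<phi> p))"
    using smooth_near_has_derivative[OF C True] has_derivative_linear by blast
  have "frechet_derivative (f \<circ> inv_into C \<phi>) (at (\<phi> p)) (\<Sum>i\<in>UNIV. w $ i *\<^sub>R axis i 1) =
      (\<Sum>i\<in>UNIV. w $ i * frechet_derivative (f \<circ> inv_into C \<phi>) (at (\<phi> p)) (axis i 1))"
    by (simp only: sum scaleR real_scaleR_def)
  then show ?thesis using True by (simp add: chart_vec_def coord_field_def basis_expansion scalar_mult_eq_scaleR[symmetric])
qed (simp add: chart_vec_def coord_field_def)

text \<open>Coordinate functions and coordinate vectors are dual, so applying \<open>u\<close> to
  the former gives its coefficients. For a vector field these coefficients are smooth, because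
  fields map smooth functions to smooth functions.\<close>

lemma tangent_coord:
  assumes C: "(C, \<phi>) \<in> atlas" "p \<in> C" and u: "u \<in> tangent_space p"
  shows "u = (\<lambda>f. \<Sum>i\<in>UNIV. u (\<lambda>q. \<phi> q $ i) * coord_field C \<phi> i p f)"
proof -
  obtain w where "u = chart_vec C \<phi> p w" using u tangent_space_chart[OF C] by auto
  then show ?thesis using chart_vec_coord[OF C] chart_vec_component[OF C] by auto
qed


lemma vfields_zero: "(\<lambda>p f. 0) \<in> vfields U"
  by (rule vfieldsI) (auto simp: tangent_zero)

text \<open>The iterated derivative is split into a first-order part and a double sum over second
  derivatives. The double sum is symmetric in \<open>X\<close> and \<open>Y\<close>, so only the
  first-order part can contribute to the bracket.\<close>

lemma vfields_iterated:
  assumes "open U" "p \<in> U" "X \<in> vfields U" "Y \<in> vfields U"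
    and C: "(C, \<phi>) \<in> atlas" "p \<in> C" and f: "smooth_near p f"
  shows "X p (\<lambda>q. Y q f) = (\<Sum>i\<in>UNIV. X p (\<lambda>q. Y q (\<lambda>r. \<phi> r $ i)) * coord_field C \<phi> i p f) +
     (\<Sum>i\<in>UNIV. \<Sum>j\<in>UNIV. X p (\<lambda>q. \<phi> q $ i) * Y p (\<lambda>q. \<phi> q $ j) *
        coord_field C \<phi> i p (\<lambda>q. coord_field C \<phi> j q f))"
proof -
  let ?E = "coord_field C \<phi>" and ?b = "\<lambda>i q. Y q (\<lambda>r. \<phi> r $ i)"
  have "open (C \<inter> U)" "p \<in> C \<inter> U" using assms chart(1)[OF C(1)] by auto
  with f obtain W where W: "open W" "p \<in> W" "W \<subseteq> C \<inter> U" "smooth_fun W f"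
    by (rule smooth_near_subset)
  have XT: "X p \<in> tangent_space p" by (rule vfields_tangent[OF assms(3,2)])
  have sb: "smooth_fun W (?b i)" for i
    by (rule vfields_smooth[OF assms(4) W(1)])
      (use W in \<open>auto intro: smooth_fun_subset[OF chart_component_smooth[OF C(1)]]\<close>)
  have sE: "smooth_fun W (\<lambda>q. ?E i q f)" for i
    by (rule vfields_smooth[OF coord_field_vfields[OF C(1)] W(1) _ W(4)]) (use W in auto)
  have "X p (\<lambda>q. Y q f) = X p (\<lambda>q. \<Sum>i\<in>UNIV. ?b i q * ?E i q f)"
  proof (rule tangent_cong[OF XT W(1,2)])
    fix q assume "q \<in> W"
    then have "q \<in> C" "q \<in> U" using W by auto
    then show "Y q f = (\<Sum>i\<in>UNIV. ?b i q * ?E i q f)"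
      by (rule fun_cong[OF tangent_coord[OF C(1) _ vfields_tangent[OF assms(4)]]])
  qed
  also have "\<dots> = (\<Sum>i\<in>UNIV. X p (\<lambda>q. ?b i q * ?E i q f))"
    by (rule tangent_sum[OF XT W(1,2)]) (intro smooth_fun_mult W sb sE)
  also have "\<dots> = (\<Sum>i\<in>UNIV. ?b i p * X p (\<lambda>q. ?E i q f) + ?E i p f * X p (?b i))"
    by (intro sum.cong refl tangent_mult[OF XT] smooth_nearI[OF W(1,2)] sb sE)
  also have "\<dots> = (\<Sum>i\<in>UNIV. ?b i p * (\<Sum>j\<in>UNIV. X p (\<lambda>q. \<phi> q $ j) * ?E j p (\<lambda>q. ?E i q f)) + ?E i p f * X p (?b i))"
    by (intro sum.cong refl arg_cong2[where f = "(+)"] arg_cong2[where f = "(*)"] fun_cong[OF tangent_coord[OF C XT]])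
  also have "\<dots> = (\<Sum>i\<in>UNIV. X p (?b i) * ?E i p f) +
      (\<Sum>i\<in>UNIV. \<Sum>j\<in>UNIV. X p (\<lambda>q. \<phi> q $ j) * ?b i p * ?E j p (\<lambda>q. ?E i q f))"
    by (simp add: sum.distrib sum_distrib_left mult_ac)
  also have "(\<Sum>i\<in>UNIV. \<Sum>j\<in>UNIV. X p (\<lambda>q. \<phi> q $ j) * ?b i p * ?E j p (\<lambda>q. ?E i q f)) =
      (\<Sum>i\<in>UNIV. \<Sum>j\<in>UNIV. X p (\<lambda>q. \<phi> q $ i) * ?b j p * ?E i p (\<lambda>q. ?E j q f))"
    by (rule sum.swap)
  finally show ?thesis .
qed

lemma lie_bracket_coord:
  assumes "open U" "p \<in> U" "X \<in> vfields U" "Y \<in> vfields U" and C: "(C, \<phi>) \<in> atlas" "p \<in> C"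
  shows "lie_bracket X Y p = (\<lambda>f. \<Sum>i\<in>UNIV.
    (X p (\<lambda>q. Y q (\<lambda>r. \<phi> r $ i)) - Y p (\<lambda>q. X q (\<lambda>r. \<phi> r $ i))) * coord_field C \<phi> i p f)"
proof
  fix f
  let ?E = "coord_field C \<phi>"
  show "lie_bracket X Y p f = (\<Sum>i\<in>UNIV.
    (X p (\<lambda>q. Y q (\<lambda>r. \<phi> r $ i)) - Y p (\<lambda>q. X q (\<lambda>r. \<phi> r $ i))) * ?E i p f)"
  proof (cases "smooth_near p f")
    case True
    \<comment> \<open>The second-order terms of the two iterated derivatives coincide and cancel;
      this is what makes the bracket a tangent vector.\<close>
    have "(\<Sum>i\<in>UNIV. \<Sum>j\<in>UNIV. X p (\<lambda>q. \<phi> q $ i) * Y p (\<lambda>q. \<phi> q $ j) * ?E i p (\<lambda>q. ?E j q f)) =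
        (\<Sum>i\<in>UNIV. \<Sum>j\<in>UNIV. Y p (\<lambda>q. \<phi> q $ i) * X p (\<lambda>q. \<phi> q $ j) * ?E i p (\<lambda>q. ?E j q f))"
      by (subst sum.swap) (simp add: coord_field_commute[OF C True] mult_ac)
    then show ?thesis
      using vfields_iterated[OF assms True] vfields_iterated[OF assms(1,2,4,3) C True] True
      by (simp add: lie_bracket_def sum_subtractf left_diff_distrib)
  next
    case False
    then have "?E i p f = 0" for i by (simp add: coord_field_def chart_vec_def)
    then show ?thesis using False by (simp add: lie_bracket_def)
  qed
qed

lemma lie_bracket_vfields:
  assumes "open U" "X \<in> vfields U" "Y \<in> vfields U"
  shows "lie_bracket X Y \<in> vfields U"
proof (rule vfieldsI)
  fix p assume p: "p \<in> U"
  obtain C \<phi> where C: "(C, \<phi>) \<in> atlas" "p \<in> C" by (rule chart_at)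
  show "lie_bracket X Y p \<in> tangent_space p"
    unfolding lie_bracket_coord[OF assms(1) p assms(2,3) C]
    by (rule tangent_lincomb_sum) (rule vfields_tangent[OF coord_field_vfields[OF C(1)] C(2)])
next
  fix V f assume V: "open V" "V \<subseteq> U" "smooth_fun V f"
  have "smooth_fun V (\<lambda>p. X p (\<lambda>q. Y q f) - Y p (\<lambda>q. X q f))"
    by (intro smooth_fun_diff V(1) vfields_smooth[OF assms(2) V(1,2)] vfields_smooth[OF assms(3) V(1,2)] V(3))
  then show "smooth_fun V (\<lambda>p. lie_bracket X Y p f)"
    by (rule smooth_fun_cong[OF V(1), rotated]) (simp add: lie_bracket_def smooth_nearI[OF V(1) _ V(3)])
qed

lemma lie_bracket_swap: "lie_bracket Y X p f = - lie_bracket X Y p f"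
  by (simp add: lie_bracket_def)

text \<open>A single rule with function coefficients, from which additivity, signs and both Leibniz
  rules of the bracket are specialised.\<close>

lemma lie_bracket_lincomb:
  assumes U: "open U" "p \<in> U" and X: "X \<in> vfields U" "X' \<in> vfields U" "Y \<in> vfields U"
    and ab: "smooth_fun U a" "smooth_fun U b"
  shows "lie_bracket (\<lambda>p f. a p * X p f + b p * X' p f) Y p f =
    a p * lie_bracket X Y p f - Y p a * X p f + b p * lie_bracket X' Y p f - Y p b * X' p f"
proof (cases "smooth_near p f")
  case True
  from True U obtain W where W: "open W" "p \<in> W" "W \<subseteq> U" "smooth_fun W f"
    by (rule smooth_near_subset)
  have YT: "Y p \<in> tangent_space p" by (rule vfields_tangent[OF X(3) U(2)])
  have s: "smooth_near p a" "smooth_near p b" "smooth_near p (\<lambda>q. X q f)" "smooth_near p (\<lambda>q. X' q f)"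
    "smooth_near p (\<lambda>q. a q * X q f)" "smooth_near p (\<lambda>q. b q * X' q f)"
    by (intro smooth_nearI[OF W(1,2)] smooth_fun_mult W(1) smooth_fun_subset[OF _ W(3)] ab
        vfields_smooth[OF X(1) W(1,3,4)] vfields_smooth[OF X(2) W(1,3,4)])+
  show ?thesis
    using True by (simp add: lie_bracket_def tangent_add[OF YT s(5,6)] tangent_mult[OF YT s(1,3)]
        tangent_mult[OF YT s(2,4)] algebra_simps)
next
  case False
  then show ?thesis
    using tangent_not_smooth_near[OF vfields_tangent[OF X(1) U(2)]]
      tangent_not_smooth_near[OF vfields_tangent[OF X(2) U(2)]]
    by (simp add: lie_bracket_def)
qed

section \<open>Bump functions and extension to global fields\<close>

text \<open>\<open>K\<close> is the preimage of a closed coordinate ball. It is compact, hence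
  closed because the manifold is Hausdorff; so the chart domain and \<open>- K\<close> form an open
  cover, on each member of which the extension by 0 is smooth. \<open>N\<close> is kept so that one
  can divide by \<open>b\<close> near \<open>p\<close>.\<close>

lemma bump:
  assumes "open U" "p \<in> U"
  obtains b K N where "CM b" "b p = 1" "closed K" "K \<subseteq> U" "\<And>q. q \<notin> K \<Longrightarrow> b q = 0"
    "open N" "p \<in> N" "N \<subseteq> U" "\<And>q. q \<in> N \<Longrightarrow> b q \<noteq> 0"
proof -
  obtain C \<phi> where C: "(C, \<phi>) \<in> atlas" "p \<in> C" by (rule chart_at)
  have "open (\<phi> ` (C \<inter> U))" by (rule chart_image_open[OF C(1) assms(1)])
  moreover have "\<phi> p \<in> \<phi> ` (C \<inter> U)" using C assms by auto
  ultimately obtain r where r: "r > 0" "cball (\<phi> p) r \<subseteq> \<phi> ` (C \<inter> U)"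
    using open_contains_cball by metis
  define e where "e s = (if s > 0 then exp (- inverse s) else 0)" for s :: real
  \<comment> \<open>The flat function is applied to \<open>r\<^sup>2\<close> minus the squared
    distance from \<open>\<phi> p\<close>, which is positive exactly inside the ball; the first
    factor normalises the value at the centre to 1.\<close>
  define B where "B x = inverse (e (r\<^sup>2)) * e (r\<^sup>2 - (x - \<phi> p) \<bullet> (x - \<phi> p))" for x
  define b where "b q = (if q \<in> C then B (\<phi> q) else 0)" for q
  define K where "K = inv_into C \<phi> ` cball (\<phi> p) r"
  define N where "N = C \<inter> \<phi> -` ball (\<phi> p) r"
  have inv: "inv_into C \<phi> x \<in> C \<inter> U" "\<phi> (inv_into C \<phi> x) = x" if "x \<in> cball (\<phi> p) r" for x
    using that r(2) chart(4)[OF C(1)] by auto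
  have epos: "e s > 0 \<longleftrightarrow> s > 0" "e s = 0 \<longleftrightarrow> s \<le> 0" for s by (auto simp: e_def)
  have B0: "B x \<noteq> 0 \<longleftrightarrow> x \<in> ball (\<phi> p) r" for x
  proof -
    have "x \<in> ball (\<phi> p) r \<longleftrightarrow> (norm (x - \<phi> p))\<^sup>2 < r\<^sup>2"
      using r(1) power_strict_mono[of "norm (x - \<phi> p)" r 2] power_less_imp_less_base[of "norm (x - \<phi> p)" 2 r]
      by (auto simp: dist_norm norm_minus_commute)
    then show ?thesis using r(1) epos(2) by (simp add: B_def dot_square_norm not_le dist_norm norm_minus_commute)
  qed
  have sB: "smooth_on (\<phi> ` C) B"
  proof -
    note o = chart(2)[OF C(1)]
    have "smooth_on (\<phi> ` C) (\<lambda>x. x + - \<phi> p)"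
      by (intro smooth_on_add o smooth_on_id smooth_on_const)
    then have "smooth_on (\<phi> ` C) (\<lambda>x. (x + - \<phi> p) \<bullet> (x + - \<phi> p))"
      by (intro smooth_on_bilinear[OF bounded_bilinear_inner o])
    then have "smooth_on (\<phi> ` C) (\<lambda>x. r\<^sup>2 + (-1) * ((x + - \<phi> p) \<bullet> (x + - \<phi> p)))"
      by (intro smooth_on_add[OF o] smooth_on_mult[OF o] smooth_on_const)
    then have "smooth_on (\<phi> ` C) (\<lambda>x. e (r\<^sup>2 + (-1) * ((x + - \<phi> p) \<bullet> (x + - \<phi> p))))"
      by (rule smooth_on_compose[OF o open_UNIV subset_UNIV _ smooth_on_exp_inverse[folded e_def]])
    then have "smooth_on (\<phi> ` C) (\<lambda>x. inverse (e (r\<^sup>2)) * e (r\<^sup>2 + (-1) * ((x + - \<phi> p) \<bullet> (x + - \<phi> p))))"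
      by (intro smooth_on_mult[OF o] smooth_on_const)
    then show ?thesis by (simp add: B_def[abs_def])
  qed
  have bC: "smooth_fun C b"
    by (rule smooth_fun_chartI[OF C(1) chart(1)[OF C(1)] subset_refl])
      (rule smooth_on_cong[OF chart(2)[OF C(1)] _ sB], use chart(4)[OF C(1)] in \<open>auto simp: b_def\<close>)
  have "continuous_on (cball (\<phi> p) r) (inv_into C \<phi>)"
    using chart(3)[OF C(1)] r(2) unfolding homeomorphism_def by (auto intro: continuous_on_subset)
  then have K: "closed K" unfolding K_def by (intro compact_imp_closed compact_continuous_image compact_cball)
  have bK: "b q = 0" if "q \<notin> K" for q
  proof (rule ccontr)
    assume "b q \<noteq> 0"
    then have "q \<in> C" "\<phi> q \<in> cball (\<phi> p) r" using B0[of "\<phi> q"] by (auto simp: b_def split: if_splits)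
    then have "q \<in> K" unfolding K_def using chart(4)[OF C(1)] by (metis imageI)
    then show False using that by simp
  qed
  have b: "CM b"
  proof (rule smooth_fun_local)
    fix q
    show "\<exists>V. open V \<and> q \<in> V \<and> smooth_fun V b"
    proof (cases "q \<in> C")
      case True
      then show ?thesis using bC chart(1)[OF C(1)] by blast
    next
      case False
      have "K \<subseteq> C" using inv by (auto simp: K_def)
      then have "q \<in> - K" using False by auto
      moreover have "smooth_fun (- K) b"
        by (rule smooth_fun_cong[OF _ _ smooth_fun_const[of _ 0]]) (use K bK in auto)
      ultimately show ?thesis using K by blast
    qed
  qed
  have N: "open N" unfolding N_def
    using chart(1,3)[OF C(1)] by (intro continuous_open_preimage) (auto simp: homeomorphism_def)
  have NU: "N \<subseteq> U"
  proof
    fix q assume "q \<in> N"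
    then have "q \<in> C" "\<phi> q \<in> cball (\<phi> p) r" by (auto simp: N_def)
    then show "q \<in> U" using inv(1)[of "\<phi> q"] chart(4)[OF C(1)] by auto
  qed
  show ?thesis
  proof (rule that[OF b _ K _ bK N _ NU])
    show "b p = 1" using C(2) r(1) epos(2)[of "r\<^sup>2"] by (simp add: b_def B_def)
    show "K \<subseteq> U" using inv by (auto simp: K_def)
    show "p \<in> N" using C r by (simp add: N_def)
    show "b q \<noteq> 0" if "q \<in> N" for q using that B0 by (auto simp: N_def b_def)
  qed
qed

lemma smooth_fun_extend:
  assumes "open U" "CM b" "closed K" "K \<subseteq> U" "\<And>q. q \<notin> K \<Longrightarrow> b q = 0" "smooth_fun U f"
  shows "CM (\<lambda>q. if q \<in> U then b q * f q else 0)"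
proof (rule smooth_fun_local)
  fix p
  show "\<exists>V. open V \<and> p \<in> V \<and> smooth_fun V (\<lambda>q. if q \<in> U then b q * f q else 0)"
  proof (cases "p \<in> U")
    case True
    have "smooth_fun U (\<lambda>q. b q * f q)"
      by (intro smooth_fun_mult assms(1,6) smooth_fun_subset[OF assms(2)] subset_UNIV)
    then have "smooth_fun U (\<lambda>q. if q \<in> U then b q * f q else 0)"
      by (rule smooth_fun_cong[OF assms(1), rotated]) simp
    then show ?thesis using True assms(1) by blast
  next
    case False
    have "smooth_fun (- K) (\<lambda>q. if q \<in> U then b q * f q else 0)"
      by (rule smooth_fun_cong[OF _ _ smooth_fun_const[of _ 0]]) (use assms(3,5) in auto)
    then show ?thesis using False assms(3,4) by (intro exI[of _ "- K"]) auto
  qed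
qed

lemma vfields_extend:
  assumes "open U" "CM b" "closed K" "K \<subseteq> U" "\<And>q. q \<notin> K \<Longrightarrow> b q = 0" "X \<in> vfields U"
  shows "(\<lambda>q f. if q \<in> U then b q * X q f else 0) \<in> XM"
proof (rule vfields_local)
  fix p
  show "\<exists>V Y. open V \<and> p \<in> V \<and> Y \<in> vfields V \<and> (\<forall>q\<in>V. (\<lambda>f. if q \<in> U then b q * X q f else 0) = Y q)"
  proof (cases "p \<in> U")
    case True
    have "(\<lambda>p f. b p * X p f + 0 * X p f) \<in> vfields U"
      by (intro vfields_lincomb assms(1,6) smooth_fun_subset[OF assms(2)] subset_UNIV smooth_fun_const)
    then show ?thesis using True assms(1)
      by (intro exI[of _ U] exI[of _ "\<lambda>p f. b p * X p f + 0 * X p f"]) auto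
  next
    case False
    then show ?thesis using assms(3-5) vfields_zero[of "- K"]
      by (intro exI[of _ "- K"] exI[of _ "\<lambda>p f. 0"]) auto
  qed
qed

text \<open>The coordinate field with constant coefficients is cut off by a bump function with value
  1 at \<open>p\<close>. This lets identities at a point be tested on global fields.\<close>

lemma vfield_through:
  assumes "u \<in> tangent_space p"
  obtains X where "X \<in> XM" "X p = u"
proof -
  obtain C \<phi> where C: "(C, \<phi>) \<in> atlas" "p \<in> C" by (rule chart_at)
  let ?X = "\<lambda>q f. \<Sum>i\<in>UNIV. u (\<lambda>q. \<phi> q $ i) * coord_field C \<phi> i q f"
  have X: "?X \<in> vfields C"
    by (rule vfields_sum[OF chart(1)[OF C(1)] coord_field_vfields[OF C(1)] smooth_fun_const])
  obtain b K N where b: "CM b" "b p = 1" "closed K" "K \<subseteq> C" "\<And>q. q \<notin> K \<Longrightarrow> b q = 0"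
    "open N" "p \<in> N" "N \<subseteq> C" "\<And>q. q \<in> N \<Longrightarrow> b q \<noteq> 0"
    using bump[OF chart(1)[OF C(1)] C(2)] by blast
  show ?thesis
  proof (rule that[OF vfields_extend[OF chart(1)[OF C(1)] b(1,3-5) X]])
    show "(\<lambda>f. if p \<in> C then b p * ?X p f else 0) = u"
      using tangent_coord[OF C assms] C(2) b(2) by simp
  qed
qed

section \<open>Linear functionals and one-forms\<close>

definition lin_on :: "'a \<Rightarrow> ('a tvec \<Rightarrow> real) \<Rightarrow> bool" where
  "lin_on p l \<longleftrightarrow> (\<forall>u\<in>tangent_space p. \<forall>v\<in>tangent_space p. \<forall>a b.
     l (\<lambda>f. a * u f + b * v f) = a * l u + b * l v)"

lemma lin_onD: "lin_on p l \<Longrightarrow> u \<in> tangent_space p \<Longrightarrow> v \<in> tangent_space p \<Longrightarrow>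
    l (\<lambda>f. a * u f + b * v f) = a * l u + b * l v"
  by (simp add: lin_on_def)

lemma lin_on_zero: "lin_on p l \<Longrightarrow> l (\<lambda>f. 0) = 0"
  using lin_onD[OF _ tangent_zero tangent_zero, of p l 0 0] by simp

lemma lin_on_scale: "lin_on p l \<Longrightarrow> u \<in> tangent_space p \<Longrightarrow> l (\<lambda>f. a * u f) = a * l u"
  using lin_onD[of p l u u a 0] by simp

lemma lin_on_sum:
  assumes "lin_on p l" "\<And>i. i \<in> I \<Longrightarrow> u i \<in> tangent_space p"
  shows "l (\<lambda>f. \<Sum>i\<in>I. c i * u i f) = (\<Sum>i\<in>I. c i * l (u i))"
  using assms(2)
proof (induction I rule: infinite_finite_induct)
  case (insert i I)
  have "u i \<in> tangent_space p" "(\<lambda>f. \<Sum>i\<in>I. c i * u i f) \<in> tangent_space p"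
    using insert.prems tangent_lincomb_sum[of I u] by auto
  from lin_onD[OF assms(1) this, of "c i" 1] show ?case using insert by simp
qed (auto simp: lin_on_zero[OF assms(1)])

lemma one_form_lin_on: "one_form \<omega> \<Longrightarrow> lin_on p (\<omega> p)"
  by (simp add: one_form_def lin_on_def)

lemma one_form_smooth: "one_form \<omega> \<Longrightarrow> open U \<Longrightarrow> X \<in> vfields U \<Longrightarrow> smooth_fun U (\<lambda>p. \<omega> p (X p))"
  by (simp add: one_form_def)

lemma one_formI:
  "(\<And>p. lin_on p (\<omega> p)) \<Longrightarrow> (\<And>U X. open U \<Longrightarrow> X \<in> vfields U \<Longrightarrow> smooth_fun U (\<lambda>p. \<omega> p (X p))) \<Longrightarrow> one_form \<omega>"
  by (simp add: one_form_def lin_on_def)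


subsection \<open>Exterior derivative, frames and dual fields\<close>

text \<open>The formula for \<open>2 d\<omega>(X, Y)\<close> that \<^const>\<open>ext_deriv\<close> evaluates on arbitrary extensions.\<close>

definition dext :: "('a \<Rightarrow> 'a tvec \<Rightarrow> real) \<Rightarrow> 'a vfield \<Rightarrow> 'a vfield \<Rightarrow> 'a \<Rightarrow> real" where
  "dext \<omega> X Y p = X p (\<lambda>q. \<omega> q (Y q)) - Y p (\<lambda>q. \<omega> q (X q)) - \<omega> p (lie_bracket X Y p)"

text \<open>With \<open>X = \<Sum> a\<^sub>i E\<^sub>i\<close> and all \<open>a\<^sub>i\<close> zero
  at \<open>p\<close>, only derivatives of the coefficients survive. The sum
  \<open>\<Sum> Y(a\<^sub>i) \<omega>(E\<^sub>i)\<close> occurs once in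
  \<open>Y(\<omega>(X))\<close> and once, with opposite sign, in \<open>\<omega>([X, Y])\<close>,
  and the two cancel.\<close>

lemma dext_vanish:
  assumes \<omega>: "one_form \<omega>" and U: "open U" "p \<in> U" and X: "X \<in> vfields U" and Y: "Y \<in> vfields U"
    and X0: "X p = (\<lambda>f. 0)"
  shows "dext \<omega> X Y p = 0"
proof -
  obtain C \<phi> where C: "(C, \<phi>) \<in> atlas" "p \<in> C" by (rule chart_at)
  let ?E = "coord_field C \<phi>" and ?a = "\<lambda>i q. X q (\<lambda>r. \<phi> r $ i)"
  let ?t = "\<lambda>i q. \<omega> q (?E i q)"
  have W: "open (C \<inter> U)" "p \<in> C \<inter> U" using U C chart(1)[OF C(1)] by auto
  have YT: "Y p \<in> tangent_space p" by (rule vfields_tangent[OF Y U(2)])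
  have sa: "smooth_fun (C \<inter> U) (?a i)" for i
    by (rule vfields_smooth[OF X W(1)]) (auto intro: smooth_fun_subset[OF chart_component_smooth[OF C(1)]])
  have st: "smooth_fun (C \<inter> U) (?t i)" for i
    by (rule one_form_smooth[OF \<omega> W(1) vfields_subset[OF coord_field_vfields[OF C(1)]]]) simp
  have ET: "?E i q \<in> tangent_space q" if "q \<in> C" for i q
    by (rule vfields_tangent[OF coord_field_vfields[OF C(1)] that])
  have "\<omega> q (X q) = (\<Sum>i\<in>UNIV. ?a i q * ?t i q)" if "q \<in> C \<inter> U" for q
  proof -
    have q: "q \<in> C" "q \<in> U" using that by auto
    have "X q = (\<lambda>f. \<Sum>i\<in>UNIV. ?a i q * ?E i q f)"
      by (rule tangent_coord[OF C(1) q(1) vfields_tangent[OF X q(2)]])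
    then have "\<omega> q (X q) = \<omega> q (\<lambda>f. \<Sum>i\<in>UNIV. ?a i q * ?E i q f)" by metis
    also have "\<dots> = (\<Sum>i\<in>UNIV. ?a i q * ?t i q)"
      by (rule lin_on_sum[OF one_form_lin_on[OF \<omega>] ET[OF q(1)]])
    finally show ?thesis .
  qed
  then have "Y p (\<lambda>q. \<omega> q (X q)) = Y p (\<lambda>q. \<Sum>i\<in>UNIV. ?a i q * ?t i q)"
    by (rule tangent_cong[OF YT W])
  also have "\<dots> = (\<Sum>i\<in>UNIV. Y p (\<lambda>q. ?a i q * ?t i q))"
    by (rule tangent_sum[OF YT W]) (intro smooth_fun_mult W sa st)
  also have "\<dots> = (\<Sum>i\<in>UNIV. ?a i p * Y p (?t i) + ?t i p * Y p (?a i))"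
    by (intro sum.cong refl tangent_mult[OF YT] smooth_nearI[OF W] sa st)
  also have "\<dots> = (\<Sum>i\<in>UNIV. ?t i p * Y p (?a i))" by (simp add: X0)
  finally have 1: "Y p (\<lambda>q. \<omega> q (X q)) = (\<Sum>i\<in>UNIV. ?t i p * Y p (?a i))" .
  have br: "lie_bracket X Y p = (\<lambda>f. \<Sum>i\<in>UNIV. - Y p (?a i) * ?E i p f)"
    unfolding lie_bracket_coord[OF U X Y C] by (simp add: X0)
  have "\<omega> p (lie_bracket X Y p) = (\<Sum>i\<in>UNIV. - Y p (?a i) * ?t i p)"
    unfolding br
    by (rule lin_on_sum[OF one_form_lin_on[OF \<omega>]]) (rule ET[OF C(2)])
  then show ?thesis by (simp add: dext_def 1 X0 sum_negf mult.commute)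
qed

lemma dext_swap:
  assumes "one_form \<omega>" "open U" "p \<in> U" "X \<in> vfields U" "Y \<in> vfields U"
  shows "dext \<omega> Y X p = - dext \<omega> X Y p"
proof -
  have "lie_bracket Y X p = (\<lambda>f. (-1) * lie_bracket X Y p f)" using lie_bracket_swap[of Y X] by (simp add: fun_eq_iff)
  then have "\<omega> p (lie_bracket Y X p) = - \<omega> p (lie_bracket X Y p)"
    using lin_on_scale[OF one_form_lin_on[OF assms(1)] vfields_tangent[OF lie_bracket_vfields[OF assms(2,4,5)] assms(3)], of "-1"]
    by simp
  then show ?thesis by (simp add: dext_def)
qed

text \<open>Constant coefficients suffice: applied to the difference of two extensions, this and
  \<open>dext_vanish\<close> show that only values at \<open>p\<close> matter.\<close>

lemma dext_lincomb:
  assumes \<omega>: "one_form \<omega>" and U: "open U" "p \<in> U" and X: "X \<in> vfields U" "X' \<in> vfields U" "Y \<in> vfields U"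
  shows "dext \<omega> (\<lambda>p f. a * X p f + b * X' p f) Y p = a * dext \<omega> X Y p + b * dext \<omega> X' Y p"
proof -
  have YT: "Y p \<in> tangent_space p" by (rule vfields_tangent[OF X(3) U(2)])
  have T: "lie_bracket X Y p \<in> tangent_space p" "lie_bracket X' Y p \<in> tangent_space p"
    using vfields_tangent[OF lie_bracket_vfields[OF U(1)] U(2)] X by auto
  have "lie_bracket (\<lambda>p f. a * X p f + b * X' p f) Y p = (\<lambda>f. a * lie_bracket X Y p f + b * lie_bracket X' Y p f)"
    using lie_bracket_lincomb[OF U X smooth_fun_const smooth_fun_const, of a b] tangent_const[OF YT]
    by (simp add: fun_eq_iff)
  then have 1: "\<omega> p (lie_bracket (\<lambda>p f. a * X p f + b * X' p f) Y p) =
      a * \<omega> p (lie_bracket X Y p) + b * \<omega> p (lie_bracket X' Y p)"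
    using lin_onD[OF one_form_lin_on[OF \<omega>] T] by simp
  have s: "smooth_fun U (\<lambda>q. \<omega> q (X q))" "smooth_fun U (\<lambda>q. \<omega> q (X' q))"
    by (rule one_form_smooth[OF \<omega> U(1) X(1)], rule one_form_smooth[OF \<omega> U(1) X(2)])
  note n = smooth_nearI[OF U smooth_fun_const[of U]] smooth_nearI[OF U s(1)] smooth_nearI[OF U s(2)]
  have "Y p (\<lambda>q. \<omega> q (\<lambda>f. a * X q f + b * X' q f)) = Y p (\<lambda>q. a * \<omega> q (X q) + b * \<omega> q (X' q))"
    by (rule tangent_cong[OF YT U])
      (rule lin_onD[OF one_form_lin_on[OF \<omega>] vfields_tangent[OF X(1)] vfields_tangent[OF X(2)]])
  also have "\<dots> = Y p (\<lambda>q. a * \<omega> q (X q)) + Y p (\<lambda>q. b * \<omega> q (X' q))"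
    by (rule tangent_add[OF YT]) (intro smooth_nearI[OF U] smooth_fun_mult smooth_fun_const U s)+
  also have "\<dots> = a * Y p (\<lambda>q. \<omega> q (X q)) + b * Y p (\<lambda>q. \<omega> q (X' q))"
    using tangent_mult[OF YT n(1,2), of a] tangent_mult[OF YT n(1,3), of b] tangent_const[OF YT] by simp
  finally show ?thesis by (simp add: dext_def 1 algebra_simps)
qed

lemma dext_cong_left:
  assumes \<omega>: "one_form \<omega>" and U: "open U" "p \<in> U" and X: "X \<in> vfields U" "X' \<in> vfields U" "Y \<in> vfields U"
    and eq: "X p = X' p"
  shows "dext \<omega> X Y p = dext \<omega> X' Y p"
proof -
  have "(\<lambda>p f. 1 * X p f + (-1) * X' p f) \<in> vfields U"
    by (intro vfields_lincomb[OF U(1) X(1,2)] smooth_fun_const)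
  from dext_vanish[OF \<omega> U this X(3)] have "dext \<omega> (\<lambda>p f. 1 * X p f + (-1) * X' p f) Y p = 0"
    by (simp add: eq)
  then show ?thesis using dext_lincomb[OF \<omega> U X, of 1 "-1"] by simp
qed

lemma dext_cong:
  assumes \<omega>: "one_form \<omega>" and U: "open U" "p \<in> U" and V: "open V" "p \<in> V"
    and X: "X \<in> vfields U" "X' \<in> vfields V" and Y: "Y \<in> vfields U" "Y' \<in> vfields V"
    and eq: "X p = X' p" "Y p = Y' p"
  shows "dext \<omega> X Y p = dext \<omega> X' Y' p"
proof -
  have W: "open (U \<inter> V)" "p \<in> U \<inter> V" using U V by auto
  note v = vfields_subset[OF X(1) Int_lower1] vfields_subset[OF X(2) Int_lower2]
    vfields_subset[OF Y(1) Int_lower1] vfields_subset[OF Y(2) Int_lower2]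
  have "dext \<omega> X Y p = dext \<omega> X' Y p" by (rule dext_cong_left[OF \<omega> W v(1-3) eq(1)])
  also have "\<dots> = - dext \<omega> Y X' p" using dext_swap[OF \<omega> W v(2,3)] by simp
  also have "\<dots> = - dext \<omega> Y' X' p" using dext_cong_left[OF \<omega> W v(3,4,2) eq(2)] by simp
  also have "\<dots> = dext \<omega> X' Y' p" using dext_swap[OF \<omega> W v(2,4)] by simp
  finally show ?thesis .
qed

text \<open>All extensions give the same number by \<open>dext_cong\<close>, so the definite
  description in \<open>ext_deriv\<close> denotes it; the 2 comes from the convention for
  \<open>d\<close>.\<close>

lemma ext_deriv_eq:
  assumes \<omega>: "one_form \<omega>" and U: "open U" "p \<in> U" and X: "X \<in> vfields U" and Y: "Y \<in> vfields U"
  shows "ext_deriv \<omega> p (X p) (Y p) = dext \<omega> X Y p / 2"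
  unfolding ext_deriv_def dext_def[symmetric]
proof (rule the_equality, intro allI impI)
  fix V X' Y' assume "open V \<and> p \<in> V \<and> X' \<in> vfields V \<and> Y' \<in> vfields V \<and> X' p = X p \<and> Y' p = Y p"
  then show "2 * (dext \<omega> X Y p / 2) = dext \<omega> X' Y' p"
    using dext_cong[OF \<omega> U, of V X X' Y Y'] X Y by simp
next
  fix c assume "\<forall>V X' Y'. open V \<and> p \<in> V \<and> X' \<in> vfields V \<and> Y' \<in> vfields V \<and> X' p = X p \<and> Y' p = Y p \<longrightarrow>
    2 * c = dext \<omega> X' Y' p"
  then have "2 * c = dext \<omega> X Y p" using U X Y by blast
  then show "c = dext \<omega> X Y p / 2" by simp
qed

lemma ext_deriv_swap:
  assumes "one_form \<omega>" "u \<in> tangent_space p" "v \<in> tangent_space p"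
  shows "ext_deriv \<omega> p v u = - ext_deriv \<omega> p u v"
proof -
  obtain X Y where X: "X \<in> XM" "X p = u" and Y: "Y \<in> XM" "Y p = v"
    using vfield_through[OF assms(2)] vfield_through[OF assms(3)] by metis
  show ?thesis
    using ext_deriv_eq[OF assms(1) open_UNIV UNIV_I[of p] X(1) Y(1)] ext_deriv_eq[OF assms(1) open_UNIV UNIV_I[of p] Y(1) X(1)]
      dext_swap[OF assms(1) open_UNIV UNIV_I[of p] X(1) Y(1)] by (simp add: X Y)
qed

lemma ext_deriv_lincomb:
  assumes "one_form \<omega>" "u \<in> tangent_space p" "u' \<in> tangent_space p" "v \<in> tangent_space p"
  shows "ext_deriv \<omega> p (\<lambda>f. a * u f + b * u' f) v = a * ext_deriv \<omega> p u v + b * ext_deriv \<omega> p u' v"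
proof -
  obtain X X' Y where X: "X \<in> XM" "X p = u" "X' \<in> XM" "X' p = u'"
    and Y: "Y \<in> XM" "Y p = v"
    using vfield_through[OF assms(2)] vfield_through[OF assms(3)] vfield_through[OF assms(4)] by metis
  have Z: "(\<lambda>p f. a * X p f + b * X' p f) \<in> XM"
    by (intro vfields_lincomb open_UNIV X(1,3) smooth_fun_const)
  note e = ext_deriv_eq[OF assms(1) open_UNIV UNIV_I[of p] _ Y(1)]
  have "ext_deriv \<omega> p (\<lambda>f. a * X p f + b * X' p f) (Y p) = a * ext_deriv \<omega> p (X p) (Y p) + b * ext_deriv \<omega> p (X' p) (Y p)"
    unfolding e[OF X(1)] e[OF X(3)] e[OF Z] dext_lincomb[OF assms(1) open_UNIV UNIV_I[of p] X(1,3) Y(1)]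
    by (simp add: add_divide_distrib)
  then show ?thesis by (simp only: X Y)
qed

lemma ext_deriv_smooth:
  assumes \<omega>: "one_form \<omega>" and U: "open U" and X: "X \<in> vfields U" and Y: "Y \<in> vfields U"
  shows "smooth_fun U (\<lambda>p. ext_deriv \<omega> p (X p) (Y p))"
proof -
  have "smooth_fun U (\<lambda>p. (1 / 2) * dext \<omega> X Y p)"
    unfolding dext_def
    by (intro smooth_fun_mult smooth_fun_diff U smooth_fun_const one_form_smooth[OF \<omega> U] lie_bracket_vfields[OF U X Y]
        vfields_smooth[OF X U subset_refl one_form_smooth[OF \<omega> U Y]]
        vfields_smooth[OF Y U subset_refl one_form_smooth[OF \<omega> U X]])
  then show ?thesis
    by (rule smooth_fun_cong[OF U, rotated]) (simp add: ext_deriv_eq[OF \<omega> U _ X Y])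
qed

section \<open>Local frames and representation by Cramer's rule\<close>

text \<open>Indexing by the type \<open>'n\<close> makes the Gram matrix of a bilinear form a square
  matrix of type \<open>real^'n^'n\<close>, to which determinants and Cramer's rule apply.\<close>

definition frame :: "'a set \<Rightarrow> ('n \<Rightarrow> 'a vfield) \<Rightarrow> bool" where
  "frame U E \<longleftrightarrow> open U \<and> (\<forall>i. E i \<in> vfields U) \<and>
     (\<forall>q\<in>U. \<forall>u\<in>tangent_space q. \<exists>c. u = (\<lambda>f. \<Sum>i\<in>UNIV. c i * E i q f)) \<and>
     (\<forall>q\<in>U. \<forall>c. (\<lambda>f. \<Sum>i\<in>UNIV. c i * E i q f) = (\<lambda>f. 0) \<longrightarrow> (\<forall>i. c i = 0))"

lemma coord_frame:
  assumes C: "(C, \<phi>) \<in> atlas"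
  shows "frame C (coord_field C \<phi>)"
  unfolding frame_def
proof (intro conjI ballI allI impI)
  fix q c i assume q: "q \<in> C" and z: "(\<lambda>f. \<Sum>i\<in>UNIV. c i * coord_field C \<phi> i q f) = (\<lambda>f. 0)"
  have "0 = (\<Sum>j\<in>UNIV. c j * coord_field C \<phi> j q (\<lambda>q. \<phi> q $ i))" using fun_cong[OF z] by metis
  also have "\<dots> = (\<Sum>j\<in>UNIV. c j * (axis j 1 :: real^'n) $ i)"
    unfolding coord_field_def chart_vec_component[OF C q] ..
  also have "\<dots> = c i" by (simp add: axis_def if_distrib cong: if_cong)
  finally show "c i = 0" by simp
next
  fix q u assume "q \<in> C" "u \<in> tangent_space q"
  from tangent_coord[OF C this] show "\<exists>c. u = (\<lambda>f. \<Sum>i\<in>UNIV. c i * coord_field C \<phi> i q f)"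
    by (rule exI[where x = "\<lambda>i. u (\<lambda>q. \<phi> q $ i)"])
qed (rule chart(1)[OF C] coord_field_vfields[OF C])+

text \<open>Linearity is required in each argument separately and symmetry is not imposed, because
  the form that produces the Reeb field has a skew and a symmetric part.\<close>

definition smooth_bilinear :: "('a \<Rightarrow> 'a tvec \<Rightarrow> 'a tvec \<Rightarrow> real) \<Rightarrow> bool" where
  "smooth_bilinear B \<longleftrightarrow> (\<forall>p. \<forall>u\<in>tangent_space p. lin_on p (B p u) \<and> lin_on p (\<lambda>w. B p w u)) \<and>
     (\<forall>U. open U \<longrightarrow> (\<forall>X\<in>vfields U. \<forall>Y\<in>vfields U. smooth_fun U (\<lambda>p. B p (X p) (Y p))))"

definition nondegenerate_at :: "'a \<Rightarrow> ('a tvec \<Rightarrow> 'a tvec \<Rightarrow> real) \<Rightarrow> bool" where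
  "nondegenerate_at p b \<longleftrightarrow> (\<forall>u\<in>tangent_space p. (\<forall>v\<in>tangent_space p. b u v = 0) \<longrightarrow> u = (\<lambda>f. 0))"

text \<open>In the frame the equation becomes a linear system whose matrix is the Gram matrix of
  \<open>B\<close>. Nondegeneracy makes its determinant nonzero, and Cramer's rule writes the
  solution as a quotient of determinants with smooth entries, which yields existence and smoothness
  together.\<close>

lemma riesz_frame:
  assumes E: "frame U E" and B: "smooth_bilinear B" "\<And>p. nondegenerate_at p (B p)"
    and L: "\<And>q. q \<in> U \<Longrightarrow> lin_on q (L q)" "\<And>i. smooth_fun U (\<lambda>q. L q (E i q))"
  obtains c where "\<And>i. smooth_fun U (c i)"
    and "\<And>q v. q \<in> U \<Longrightarrow> v \<in> tangent_space q \<Longrightarrow> B q (\<lambda>f. \<Sum>i\<in>UNIV. c i q * E i q f) v = L q v"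
proof -
  define A :: "'a \<Rightarrow> real^'n^'n" where "A q = (\<chi> i j. B q (E j q) (E i q))" for q
  define c where "c k q = det (\<chi> i j. if j = k then L q (E i q) else A q $ i $ j) * inverse (det (A q))" for k q
  have U: "open U" and EU: "E i \<in> vfields U" for i using E by (auto simp: frame_def)
  have ET: "E i q \<in> tangent_space q" if "q \<in> U" for i q by (rule vfields_tangent[OF EU that])
  have Bl: "lin_on q (B q u)" "lin_on q (\<lambda>w. B q w u)" if "u \<in> tangent_space q" for q u
    using B(1) that by (auto simp: smooth_bilinear_def)
  have Ax: "(A q *v x) $ i = B q (\<lambda>f. \<Sum>j\<in>UNIV. x $ j * E j q f) (E i q)" if "q \<in> U" for q x i
  proof -
    have "B q (\<lambda>f. \<Sum>j\<in>UNIV. x $ j * E j q f) (E i q) = (\<Sum>j\<in>UNIV. x $ j * B q (E j q) (E i q))"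
      by (rule lin_on_sum[OF Bl(2)[OF ET[OF that]]]) (rule ET[OF that])
    then show ?thesis by (simp add: A_def matrix_vector_mult_def mult.commute)
  qed
  have ext: "B q u v = L' v" if "q \<in> U" "u \<in> tangent_space q" "v \<in> tangent_space q" "lin_on q L'"
    "\<And>i. B q u (E i q) = L' (E i q)" for q u v L'
  proof -
    have "\<exists>d. v = (\<lambda>f. \<Sum>i\<in>UNIV. d i * E i q f)" using E that(1,3) by (auto simp: frame_def)
    then obtain d where d: "v = (\<lambda>f. \<Sum>i\<in>UNIV. d i * E i q f)" by blast
    have "B q u v = (\<Sum>i\<in>UNIV. d i * B q u (E i q))"
      unfolding d by (rule lin_on_sum[OF Bl(1)[OF that(2)]]) (rule ET[OF that(1)])
    moreover have "L' v = (\<Sum>i\<in>UNIV. d i * L' (E i q))"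
      unfolding d by (rule lin_on_sum[OF that(4)]) (rule ET[OF that(1)])
    ultimately show ?thesis using that(5) by simp
  qed
  have T: "(\<lambda>f. \<Sum>j\<in>UNIV. x j * E j q f) \<in> tangent_space q" if "q \<in> U" for q x
    by (rule tangent_lincomb_sum) (rule ET[OF that])
  have det: "det (A q) \<noteq> 0" if q: "q \<in> U" for q
  proof -
    \<comment> \<open>A kernel vector of the Gram matrix would be the coefficient vector of a
      tangent vector on which \<open>B\<close> degenerates.\<close>
    have "x = 0" if "A q *v x = 0" for x
    proof -
      let ?u = "\<lambda>f. \<Sum>j\<in>UNIV. x $ j * E j q f"
      have "B q ?u (E i q) = 0" for i using Ax[OF q, of x i] that by simp
      then have "B q ?u v = 0" if "v \<in> tangent_space q" for v
        using ext[OF q T[OF q] that, of "\<lambda>_. 0"] by (simp add: lin_on_def)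
      then have "?u = (\<lambda>f. 0)" using B(2)[of q] T[OF q] unfolding nondegenerate_at_def by blast
      moreover have "\<forall>c. (\<lambda>f. \<Sum>i\<in>UNIV. c i * E i q f) = (\<lambda>f. 0) \<longrightarrow> (\<forall>i. c i = 0)"
        using E q by (simp add: frame_def)
      ultimately have "\<forall>i. x $ i = 0" by blast
      then show "x = 0" by (simp add: vec_eq_iff)
    qed
    then have "\<exists>A'. A' ** A q = mat 1" using matrix_left_invertible_ker by blast
    then show ?thesis by (metis det_I det_mul mult_zero_right zero_neq_one)
  qed
  have sA: "smooth_fun U (\<lambda>q. A q $ i $ j)" for i j
    using B(1) U EU by (simp add: A_def smooth_bilinear_def)
  have sdet: "smooth_fun U (\<lambda>q. det (M q))" if "\<And>i j. smooth_fun U (\<lambda>q. M q $ i $ j)" for M :: "'a \<Rightarrow> real^'n^'n"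
    unfolding det_def by (intro smooth_fun_sum smooth_fun_mult smooth_fun_prod U smooth_fun_const that)
  show ?thesis
  proof
    fix k
    have "smooth_fun U (\<lambda>q. (\<chi> i j. if j = k then L q (E i q) else A q $ i $ j) $ i $ j)" for i j
      using L(2) sA by (cases "j = k") auto
    then show "smooth_fun U (c k)"
      unfolding c_def[abs_def] by (intro smooth_fun_mult smooth_fun_inverse U sdet sA det) auto
  next
    fix q v assume q: "q \<in> U" and v: "v \<in> tangent_space q"
    have "A q *v (\<chi> k. c k q) = (\<chi> i. L q (E i q))"
      unfolding cramer[OF det[OF q]] by (simp add: c_def divide_inverse cong: if_cong)
    then have "B q (\<lambda>f. \<Sum>i\<in>UNIV. c i q * E i q f) (E i q) = L q (E i q)" for i
      using Ax[OF q, of "\<chi> k. c k q" i] by simp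
    then show "B q (\<lambda>f. \<Sum>i\<in>UNIV. c i q * E i q f) v = L q v"
      by (rule ext[OF q T[OF q] v L(1)[OF q]])
  qed
qed

lemma nondegenerate_eqI:
  assumes "smooth_bilinear B" "nondegenerate_at p (B p)" "u \<in> tangent_space p" "v \<in> tangent_space p"
    and "\<And>w. w \<in> tangent_space p \<Longrightarrow> B p u w = B p v w"
  shows "u = v"
proof -
  have "(\<lambda>f. 1 * u f + (-1) * v f) = (\<lambda>f. 0)"
  proof -
    have "B p (\<lambda>f. 1 * u f + (-1) * v f) w = 0" if "w \<in> tangent_space p" for w
    proof -
      have "lin_on p (\<lambda>u. B p u w)" using assms(1) that by (simp add: smooth_bilinear_def)
      from lin_onD[OF this assms(3,4), of 1 "-1"] show ?thesis using assms(5)[OF that] by simp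
    qed
    moreover have "(\<lambda>f. 1 * u f + (-1) * v f) \<in> tangent_space p" by (rule tangent_lincomb[OF assms(3,4)])
    ultimately show ?thesis using assms(2) unfolding nondegenerate_at_def by blast
  qed
  then show ?thesis by (simp add: fun_eq_iff)
qed

text \<open>The representing vector at each point is unique by nondegeneracy. A pointwise choice
  therefore agrees with the smooth local solutions, so it is itself smooth.\<close>

lemma riesz:
  assumes B: "smooth_bilinear B" "\<And>p. nondegenerate_at p (B p)" and L: "one_form L"
  obtains V where "V \<in> XM" "\<And>p v. v \<in> tangent_space p \<Longrightarrow> B p (V p) v = L p v"
proof -
  have loc: "\<exists>U Y. open U \<and> p \<in> U \<and> Y \<in> vfields U \<and> (\<forall>q\<in>U. \<forall>v\<in>tangent_space q. B q (Y q) v = L q v)" for p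
  proof -
    obtain C \<phi> where C: "(C, \<phi>) \<in> atlas" "p \<in> C" by (rule chart_at)
    note o = chart(1)[OF C(1)] and E = coord_field_vfields[OF C(1)]
    show ?thesis
    proof (rule riesz_frame[where U = C and E = "coord_field C \<phi>" and B = B and L = L,
          OF coord_frame[OF C(1)] B one_form_lin_on[OF L] one_form_smooth[OF L o E]])
      fix c assume c: "\<And>i. smooth_fun C (c i)" "\<And>q v. q \<in> C \<Longrightarrow> v \<in> tangent_space q \<Longrightarrow>
        B q (\<lambda>f. \<Sum>i\<in>UNIV. c i q * coord_field C \<phi> i q f) v = L q v"
      have "(\<lambda>q f. \<Sum>i\<in>UNIV. c i q * coord_field C \<phi> i q f) \<in> vfields C"
        by (rule vfields_sum[OF o E c(1)])
      with c(2) o C(2) show ?thesis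
        by (intro exI[of _ C] exI[of _ "\<lambda>q f. \<Sum>i\<in>UNIV. c i q * coord_field C \<phi> i q f"]) simp
    qed
  qed
  define V where "V p = (SOME u. u \<in> tangent_space p \<and> (\<forall>v\<in>tangent_space p. B p u v = L p v))" for p
  have V: "V p \<in> tangent_space p \<and> (\<forall>v\<in>tangent_space p. B p (V p) v = L p v)" for p
  proof -
    have "\<exists>u. u \<in> tangent_space p \<and> (\<forall>v\<in>tangent_space p. B p u v = L p v)"
      using loc[of p] vfields_tangent by meson
    then show ?thesis unfolding V_def by (rule someI_ex)
  qed
  show ?thesis
  proof
    show "V \<in> XM"
    proof (rule vfields_local)
      fix p
      obtain U Y where Y: "open U" "p \<in> U" "Y \<in> vfields U" "\<forall>q\<in>U. \<forall>v\<in>tangent_space q. B q (Y q) v = L q v"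
        using loc by blast
      have "V q = Y q" if "q \<in> U" for q
        by (rule nondegenerate_eqI[OF B]) (use V Y(4) that vfields_tangent[OF Y(3) that] in auto)
      then show "\<exists>U Y. open U \<and> p \<in> U \<and> Y \<in> vfields U \<and> (\<forall>q\<in>U. V q = Y q)" using Y by blast
    qed
  qed (use V in blast)
qed


section \<open>Function-linear maps depend on values only\<close>

lemma tensorial_sum:
  assumes lin: "\<And>X Y a b p. X \<in> XM \<Longrightarrow> Y \<in> XM \<Longrightarrow> CM a \<Longrightarrow> CM b \<Longrightarrow>
      \<Lambda> (\<lambda>p f. a p * X p f + b p * Y p f) p = a p * \<Lambda> X p + b p * \<Lambda> Y p"
    and E: "\<And>i. i \<in> I \<Longrightarrow> E i \<in> XM" "\<And>i. i \<in> I \<Longrightarrow> CM (c i)"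
  shows "\<Lambda> (\<lambda>p f. \<Sum>i\<in>I. c i p * E i p f) p = (\<Sum>i\<in>I. c i p * \<Lambda> (E i) p)"
  using E
proof (induction I rule: infinite_finite_induct)
  case (insert i I)
  have "E i \<in> XM" "CM (c i)" "(\<lambda>p f. \<Sum>i\<in>I. c i p * E i p f) \<in> XM"
    using insert.prems vfields_sum[of UNIV I E c] by auto
  from lin[OF this(1,3,2) smooth_fun_const, of 1 p] show ?case using insert by simp
qed (use lin[OF vfields_zero vfields_zero smooth_fun_const smooth_fun_const, of 0 0 p] in auto)

text \<open>Coordinate coefficients and coordinate fields are both local, so each is multiplied by a
  bump function \<open>b\<close>. This writes \<open>b\<^sup>2 Z\<close> as a combination of global
  fields with global coefficients that vanish at \<open>p\<close>, while
  \<open>b p = 1\<close>.\<close>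

lemma tensorial_vanish:
  assumes lin: "\<And>X Y a b p. X \<in> XM \<Longrightarrow> Y \<in> XM \<Longrightarrow> CM a \<Longrightarrow> CM b \<Longrightarrow>
      \<Lambda> (\<lambda>p f. a p * X p f + b p * Y p f) p = a p * \<Lambda> X p + b p * \<Lambda> Y p"
    and Z: "Z \<in> XM" "Z p = (\<lambda>f. 0)"
  shows "\<Lambda> Z p = 0"
proof -
  obtain C \<phi> where C: "(C, \<phi>) \<in> atlas" "p \<in> C" by (rule chart_at)
  let ?E = "coord_field C \<phi>"
  note o = chart(1)[OF C(1)]
  obtain b K N where b: "CM b" "b p = 1" "closed K" "K \<subseteq> C" "\<And>q. q \<notin> K \<Longrightarrow> b q = 0"
    "open N" "p \<in> N" "N \<subseteq> C" "\<And>q. q \<in> N \<Longrightarrow> b q \<noteq> 0"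
    using bump[OF o C(2)] by blast
  define a where "a i q = (if q \<in> C then b q * Z q (\<lambda>r. \<phi> r $ i) else 0)" for i q
  define F where "F i q f = (if q \<in> C then b q * ?E i q f else 0)" for i q f
  have "CM (a i)" for i
    unfolding a_def[abs_def]
    by (intro smooth_fun_extend[OF o b(1,3-5)] vfields_smooth[OF Z(1) o subset_UNIV] chart_component_smooth C)
  moreover have "F i \<in> XM" for i
    unfolding F_def[abs_def] by (rule vfields_extend[OF o b(1,3-5) coord_field_vfields[OF C(1)]])
  ultimately have "\<Lambda> (\<lambda>p f. \<Sum>i\<in>UNIV. a i p * F i p f) p = (\<Sum>i\<in>UNIV. a i p * \<Lambda> (F i) p)"
    by (intro tensorial_sum[where \<Lambda> = \<Lambda>, OF lin])
  also have "(\<lambda>p f. \<Sum>i\<in>UNIV. a i p * F i p f) = (\<lambda>q f. (b q * b q) * Z q f + 0 * Z q f)"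
  proof (intro ext)
    fix q f
    show "(\<Sum>i\<in>UNIV. a i q * F i q f) = (b q * b q) * Z q f + 0 * Z q f"
    proof (cases "q \<in> C")
      case True
      have "Z q f = (\<Sum>i\<in>UNIV. Z q (\<lambda>r. \<phi> r $ i) * ?E i q f)"
        by (rule fun_cong[OF tangent_coord[OF C(1) True vfields_tangent[OF Z(1) UNIV_I]]])
      then show ?thesis using True by (simp add: a_def F_def sum_distrib_left mult_ac)
    next
      case False
      then have "b q = 0" using b(4,5) by blast
      then show ?thesis using False by (simp add: a_def F_def)
    qed
  qed
  also have "\<Lambda> \<dots> p = (b p * b p) * \<Lambda> Z p + 0 * \<Lambda> Z p"
    by (intro lin Z(1) smooth_fun_mult open_UNIV b(1) smooth_fun_const)
  also have "(\<Sum>i\<in>UNIV. a i p * \<Lambda> (F i) p) = 0" by (simp add: a_def Z(2) C(2))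
  finally show ?thesis by (simp add: b(2))
qed

text \<open>By \<open>tensorial_vanish\<close> the value of \<open>\<Lambda> X\<close> at
  \<open>p\<close> depends on \<open>X p\<close> alone, so it may be computed from an arbitrary
  global extension of the given vector.\<close>

lemma tensorial_one_form:
  assumes smooth: "\<And>X. X \<in> XM \<Longrightarrow> CM (\<Lambda> X)"
    and lin: "\<And>X Y a b p. X \<in> XM \<Longrightarrow> Y \<in> XM \<Longrightarrow> CM a \<Longrightarrow> CM b \<Longrightarrow>
      \<Lambda> (\<lambda>p f. a p * X p f + b p * Y p f) p = a p * \<Lambda> X p + b p * \<Lambda> Y p"
  obtains L where "one_form L" "\<And>X p. X \<in> XM \<Longrightarrow> L p (X p) = \<Lambda> X p"
proof -
  define L where "L p v = \<Lambda> (SOME X. X \<in> XM \<and> X p = v) p" for p v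
  have cong: "\<Lambda> X p = \<Lambda> Y p" if "X \<in> XM" "Y \<in> XM" "X p = Y p" for X Y p
  proof -
    have Z: "(\<lambda>p f. 1 * X p f + (-1) * Y p f) \<in> XM"
      by (intro vfields_lincomb that open_UNIV smooth_fun_const)
    have "\<Lambda> (\<lambda>p f. 1 * X p f + (-1) * Y p f) p = 0"
      by (rule tensorial_vanish[where \<Lambda> = \<Lambda>, OF lin Z]) (simp_all add: that(3))
    then show ?thesis using lin[OF that(1,2) smooth_fun_const smooth_fun_const, of 1 "-1" p] by simp
  qed
  have L: "L p (X p) = \<Lambda> X p" if "X \<in> XM" for X p
  proof -
    have "(SOME Y. Y \<in> XM \<and> Y p = X p) \<in> XM \<and> (SOME Y. Y \<in> XM \<and> Y p = X p) p = X p"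
      by (rule someI[of _ X]) (simp add: that)
    then show ?thesis unfolding L_def using cong that by blast
  qed
  have "one_form L"
  proof (rule one_formI)
    fix p
    show "lin_on p (L p)"
      unfolding lin_on_def
    proof (intro ballI allI)
      fix u v a b assume "u \<in> tangent_space p" "v \<in> tangent_space p"
      then obtain X Y where X: "X \<in> XM" "X p = u" and Y: "Y \<in> XM" "Y p = v"
        using vfield_through by metis
      have Z: "(\<lambda>p f. a * X p f + b * Y p f) \<in> XM"
        by (intro vfields_lincomb X Y open_UNIV smooth_fun_const)
      have "L p (\<lambda>f. a * X p f + b * Y p f) = a * L p (X p) + b * L p (Y p)"
        unfolding L[OF X(1)] L[OF Y(1)] L[OF Z]
        by (rule lin[OF X(1) Y(1) smooth_fun_const smooth_fun_const])
      then show "L p (\<lambda>f. a * u f + b * v f) = a * L p u + b * L p v" by (simp only: X Y)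
    qed
  next
    fix U X assume U: "open U" and X: "X \<in> vfields U"
    show "smooth_fun U (\<lambda>p. L p (X p))"
    proof (rule smooth_fun_local)
      fix p assume "p \<in> U"
      then obtain b K N where b: "CM b" "b p = 1" "closed K" "K \<subseteq> U" "\<And>q. q \<notin> K \<Longrightarrow> b q = 0"
        "open N" "p \<in> N" "N \<subseteq> U" "\<And>q. q \<in> N \<Longrightarrow> b q \<noteq> 0"
        using bump[OF U] by blast
      let ?X = "\<lambda>q f. if q \<in> U then b q * X q f else 0"
      have X': "?X \<in> XM" by (rule vfields_extend[OF U b(1,3-5) X])
      \<comment> \<open>On \<open>N\<close> the cut-off factor is invertible, so the value on the
        local field \<open>X\<close> is recovered from the global field \<open>?X\<close> by
        division.\<close>
      have s: "smooth_fun N (\<lambda>q. inverse (b q) * \<Lambda> ?X q)"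
        by (intro smooth_fun_mult smooth_fun_inverse b(6,9) smooth_fun_subset[OF b(1)]
            smooth_fun_subset[OF smooth[OF X']] subset_UNIV)
      have "smooth_fun N (\<lambda>p. L p (X p))"
      proof (rule smooth_fun_cong[OF b(6) _ s])
        fix q assume q: "q \<in> N"
        then have qU: "q \<in> U" using b(8) by blast
        obtain Y where Y: "Y \<in> XM" "Y q = X q"
          using vfield_through[OF vfields_tangent[OF X qU]] by blast
        have "\<Lambda> ?X q = \<Lambda> (\<lambda>p f. b p * Y p f + 0 * Y p f) q"
          by (rule cong[OF X' vfields_lincomb[OF open_UNIV Y(1) Y(1) b(1) smooth_fun_const]]) (simp add: qU Y(2))
        also have "\<dots> = b q * \<Lambda> Y q" using lin[OF Y(1) Y(1) b(1) smooth_fun_const, of 0 q] by simp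
        finally show "inverse (b q) * \<Lambda> ?X q = L q (X q)"
          using b(9)[OF q] L[OF Y(1), of q] Y(2) by simp
      qed
      then show "\<exists>V. open V \<and> p \<in> V \<and> smooth_fun V (\<lambda>p. L p (X p))" using b(6,7) by blast
    qed
  qed
  then show ?thesis using that L by blast
qed

end

section \<open>The CR structure and the Reeb field\<close>

context cr_manifold
begin

lemma subbundle_frame:
  obtains U Z where "open U" "p \<in> U" "\<And>i. i < m \<Longrightarrow> Z i \<in> cvfields U"
    "\<And>q. q \<in> U \<Longrightarrow> H10 q = {(\<lambda>f. \<Sum>i<m. c i * Z i q f) | c. True}"
    "\<And>q c i. q \<in> U \<Longrightarrow> (\<lambda>f. \<Sum>i<m. c i * Z i q f) = (\<lambda>f. 0) \<Longrightarrow> i < m \<Longrightarrow> c i = 0"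
proof -
  have "\<exists>U Z. open U \<and> p \<in> U \<and> (\<forall>i<m. Z i \<in> cvfields U) \<and>
     (\<forall>q\<in>U. H10 q = {(\<lambda>f. \<Sum>i<m. c i * Z i q f) | c. True} \<and>
        (\<forall>c. (\<lambda>f. \<Sum>i<m. c i * Z i q f) = 0 \<longrightarrow> (\<forall>i<m. c i = 0)))"
    using subbundle unfolding complex_subbundle_def by (rule spec)
  then obtain U Z where UZ: "open U" "p \<in> U" "\<forall>i<m. Z i \<in> cvfields U"
    "\<forall>q\<in>U. H10 q = {(\<lambda>f. \<Sum>i<m. c i * Z i q f) | c. True} \<and>
        (\<forall>c. (\<lambda>f. \<Sum>i<m. c i * Z i q f) = 0 \<longrightarrow> (\<forall>i<m. c i = 0))"
    by (elim exE conjE)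
  show ?thesis
  proof (rule that[of U Z])
    show "c i = 0" if "q \<in> U" "(\<lambda>f. \<Sum>i<m. c i * Z i q f) = (\<lambda>f. 0)" "i < m" for q c i
      using UZ(4) that by (simp add: zero_fun_def)
  qed (use UZ in simp_all)
qed

lemma H10_lincomb:
  assumes "z \<in> H10 p" "w \<in> H10 p"
  shows "(\<lambda>f. a * z f + b * w f) \<in> H10 p"
proof (rule subbundle_frame[of p])
  fix U Z assume U: "p \<in> U" "\<And>q. q \<in> U \<Longrightarrow> H10 q = {(\<lambda>f. \<Sum>i<m. c i * Z i q f) | c. True}"
  note H = U(2)[OF U(1)]
  obtain c d where "z = (\<lambda>f. \<Sum>i<m. c i * Z i p f)" "w = (\<lambda>f. \<Sum>i<m. d i * Z i p f)"
    using assms H by auto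
  then have "(\<lambda>f. a * z f + b * w f) = (\<lambda>f. \<Sum>i<m. (a * c i + b * d i) * Z i p f)"
    by (simp add: sum_distrib_left sum.distrib algebra_simps)
  then show ?thesis unfolding H by (intro CollectI exI[of _ "\<lambda>i. a * c i + b * d i"] conjI TrueI)
qed

lemma H10_scale: "z \<in> H10 p \<Longrightarrow> (\<lambda>f. a * z f) \<in> H10 p"
  using H10_lincomb[of z p z a 0] by simp

lemma H10_tangent:
  assumes "z \<in> H10 p"
  shows "(\<lambda>f. Re (z f)) \<in> tangent_space p" "(\<lambda>f. Im (z f)) \<in> tangent_space p"
proof -
  have Re_tangent: "(\<lambda>f. Re (z f)) \<in> tangent_space p" if zH: "z \<in> H10 p" for z
  proof (rule subbundle_frame[of p])
    fix U Z assume U: "p \<in> U" "\<And>q. q \<in> U \<Longrightarrow> H10 q = {(\<lambda>f. \<Sum>i<m. c i * Z i q f) | c. True}"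
      and Z: "\<And>i. i < m \<Longrightarrow> Z i \<in> cvfields U"
    obtain c where z: "z = (\<lambda>f. \<Sum>i<m. c i * Z i p f)" using zH U(2)[OF U(1)] by auto
    have t: "Re_field (Z i) p \<in> tangent_space p" "Im_field (Z i) p \<in> tangent_space p" if "i \<in> {..<m}" for i
      using Z[of i] that vfields_tangent[OF _ U(1)] by (auto simp: cvfields_def)
    have "(\<lambda>f. 1 * (\<Sum>i<m. Re (c i) * Re_field (Z i) p f) + (-1) * (\<Sum>i<m. Im (c i) * Im_field (Z i) p f)) \<in> tangent_space p"
      by (intro tangent_lincomb tangent_lincomb_sum t)
    then show ?thesis by (simp add: z Re_field_def Im_field_def sum_subtractf)
  qed
  from this[OF assms] this[OF H10_scale[OF assms, of "-\<i>"]]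
  show "(\<lambda>f. Re (z f)) \<in> tangent_space p" "(\<lambda>f. Im (z f)) \<in> tangent_space p" by simp_all
qed

text \<open>A purely imaginary \<open>z\<close> is the conjugate of \<open>- z\<close>, so it lies
  in both subbundles. Hence a (1,0) vector is determined by its real part, which identifies
  \<open>H10\<close> with \<open>H\<close>.\<close>

lemma H10_Re_zero:
  assumes "z \<in> H10 p" "\<And>f. Re (z f) = 0"
  shows "z = (\<lambda>f. 0)"
proof -
  have "z = vec_cnj (\<lambda>f. -1 * z f)" using assms(2) by (auto simp: vec_cnj_def complex_eq_iff fun_eq_iff)
  then have "z \<in> vec_cnj ` H10 p" using H10_scale[OF assms(1), of "-1"] by blast
  then show ?thesis using assms(1) H10_Int_H01[of p] by (auto simp: zero_fun_def)
qed

text \<open>The real part of \<open>z + cnj w\<close> equals that of \<open>z + w\<close>, and the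
  latter is again a (1,0) vector.\<close>

lemma H_iff: "u \<in> H p \<longleftrightarrow> (\<exists>z\<in>H10 p. u = (\<lambda>f. Re (z f)))"
proof
  assume "u \<in> H p"
  then obtain z w where z: "z \<in> H10 p" "w \<in> H10 p" "u = (\<lambda>f. Re (z f + cnj (w f)))"
    by (auto simp: H_def H01_def vec_cnj_def)
  then show "\<exists>z\<in>H10 p. u = (\<lambda>f. Re (z f))"
    using H10_lincomb[OF z(1,2), of 1 1] by (intro bexI[of _ "\<lambda>f. z f + w f"]) auto
next
  assume "\<exists>z\<in>H10 p. u = (\<lambda>f. Re (z f))"
  then obtain z where z: "z \<in> H10 p" "u = (\<lambda>f. Re (z f))" by blast
  have "vec_cnj (\<lambda>f. 0 * z f) \<in> H01 p" using H10_scale[OF z(1), of 0] unfolding H01_def by blast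
  then show "u \<in> H p" unfolding H_def using z
    by (intro CollectI exI[of _ z] exI[of _ "vec_cnj (\<lambda>f. 0 * z f)"]) (simp add: vec_cnj_def)
qed

text \<open>The vector \<open>Re z\<close> decomposes as \<open>z/2\<close> plus its conjugate, and
  \<i> times their difference is \<open>- Im z\<close>. The decomposition is unique by
  \<open>H10_Re_zero\<close>, so the definite description in \<open>Jb\<close> is justified.\<close>

lemma Jb_Re:
  assumes z: "z \<in> H10 p"
  shows "Jb p (\<lambda>f. Re (z f)) = (\<lambda>f. - Im (z f))"
  unfolding Jb_def
proof (rule the_equality)
  show "\<exists>w\<in>H10 p. cplx (\<lambda>f. Re (z f)) = w + vec_cnj w \<and> cplx (\<lambda>f. - Im (z f)) = (\<lambda>f. \<i> * (w f - vec_cnj w f))"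
    by (intro bexI[OF _ H10_scale[OF z, of "1 / 2"]]) (auto simp: cplx_def vec_cnj_def fun_eq_iff complex_eq_iff)
next
  fix v assume "\<exists>w\<in>H10 p. cplx (\<lambda>f. Re (z f)) = w + vec_cnj w \<and> cplx v = (\<lambda>f. \<i> * (w f - vec_cnj w f))"
  then obtain w where w: "w \<in> H10 p" "\<And>f. Re (z f) = 2 * Re (w f)" "\<And>f. v f = - 2 * Im (w f)"
    by (auto simp: cplx_def vec_cnj_def fun_eq_iff complex_eq_iff)
  have "(\<lambda>f. 1 * z f + (-2) * w f) = (\<lambda>f. 0)"
    by (rule H10_Re_zero[OF H10_lincomb[OF z w(1)]]) (simp add: w(2))
  then have "Im (1 * z f + (-2) * w f) = 0" for f by (metis zero_complex.simps(2))
  then show "v = (\<lambda>f. - Im (z f))" using w(3) by (simp add: fun_eq_iff)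
qed

lemma H_tangent: "u \<in> H p \<Longrightarrow> u \<in> tangent_space p"
  using H10_tangent(1) H_iff by auto

lemma H_zero: "(\<lambda>f. 0) \<in> H p"
proof (rule subbundle_frame[of p])
  fix U Z assume U: "p \<in> U" "\<And>q. q \<in> U \<Longrightarrow> H10 q = {(\<lambda>f. \<Sum>i<m. c i * Z i q f) | c. True}"
  have "(\<lambda>f. \<Sum>i<m. 0 * Z i p f) \<in> H10 p" 
    unfolding U(2)[OF U(1)] by (intro CollectI exI[of _ "\<lambda>i. 0"] conjI TrueI refl)
  then show ?thesis unfolding H_iff by (intro bexI[of _ "\<lambda>f. 0"]) auto
qed

lemma H_lincomb:
  assumes "u \<in> H p" "v \<in> H p"
  shows "(\<lambda>f. a * u f + b * v f) \<in> H p"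
proof -
  obtain z w where z: "z \<in> H10 p" "u = (\<lambda>f. Re (z f))" and w: "w \<in> H10 p" "v = (\<lambda>f. Re (w f))"
    using assms H_iff by auto
  show ?thesis unfolding H_iff
    by (rule bexI[OF _ H10_lincomb[OF z(1) w(1), of "complex_of_real a" "complex_of_real b"]]) (simp add: z w)
qed

lemma Jb_lincomb:
  assumes "u \<in> H p" "v \<in> H p"
  shows "Jb p (\<lambda>f. a * u f + b * v f) = (\<lambda>f. a * Jb p u f + b * Jb p v f)"
proof -
  obtain z w where z: "z \<in> H10 p" "u = (\<lambda>f. Re (z f))" and w: "w \<in> H10 p" "v = (\<lambda>f. Re (w f))"
    using assms H_iff by auto
  from Jb_Re[OF H10_lincomb[OF z(1) w(1), of "complex_of_real a" "complex_of_real b"]]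
  show ?thesis by (simp add: z w Jb_Re)
qed

lemma Jb_H:
  assumes "u \<in> H p"
  shows "Jb p u \<in> H p" "Jb p (Jb p u) = (\<lambda>f. - u f)"
proof -
  obtain z where z: "z \<in> H10 p" "u = (\<lambda>f. Re (z f))" using assms H_iff by auto
  have J: "Jb p u = (\<lambda>f. Re (\<i> * z f))" by (simp add: z Jb_Re)
  then show "Jb p u \<in> H p" unfolding H_iff by (rule bexI[OF _ H10_scale[OF z(1), of \<i>]])
  show "Jb p (Jb p u) = (\<lambda>f. - u f)"
    unfolding J Jb_Re[OF H10_scale[OF z(1), of \<i>]] by (simp add: z)
qed

text \<open>The imaginary part of a (1,0) vector is minus \<open>Jb\<close> of its real part. This
  is the dictionary by which complex conditions become statements about real fields and
  \<open>J\<close>.\<close>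

lemma H10_iff: "z \<in> H10 p \<longleftrightarrow> (\<exists>u\<in>H p. z = (\<lambda>f. Complex (u f) (- Jb p u f)))"
proof
  assume z: "z \<in> H10 p"
  then show "\<exists>u\<in>H p. z = (\<lambda>f. Complex (u f) (- Jb p u f))"
    using Jb_Re[OF z] H_iff by (intro bexI[of _ "\<lambda>f. Re (z f)"]) auto
next
  assume "\<exists>u\<in>H p. z = (\<lambda>f. Complex (u f) (- Jb p u f))"
  then obtain u w where u: "z = (\<lambda>f. Complex (u f) (- Jb p u f))" "w \<in> H10 p" "u = (\<lambda>f. Re (w f))"
    using H_iff by auto
  then have "z = w" by (simp add: Jb_Re fun_eq_iff complex_eq_iff)
  then show "z \<in> H10 p" using u by simp
qed

lemma H01_iff: "z \<in> H01 p \<longleftrightarrow> (\<exists>u\<in>H p. z = (\<lambda>f. Complex (u f) (Jb p u f)))"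
proof -
  have "z \<in> H01 p \<longleftrightarrow> vec_cnj z \<in> H10 p"
  proof
    assume "vec_cnj z \<in> H10 p"
    then have "vec_cnj (vec_cnj z) \<in> H01 p" unfolding H01_def by (rule imageI)
    then show "z \<in> H01 p" by (simp add: vec_cnj_def)
  qed (auto simp: H01_def vec_cnj_def)
  also have "\<dots> \<longleftrightarrow> (\<exists>u\<in>H p. z = (\<lambda>f. Complex (u f) (Jb p u f)))"
    unfolding H10_iff by (simp add: vec_cnj_def fun_eq_iff complex_eq_iff)
  finally show ?thesis .
qed

end

context pseudo_hermitian_manifold
begin

section \<open>The Reeb field and the horizontal projection\<close>

lemma theta_one_form: "one_form \<theta>"
  using form by (simp add: pseudo_hermitian_form_def)

lemma theta_lin: "lin_on p (\<theta> p)"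
  by (rule one_form_lin_on[OF theta_one_form])

lemma H_eq_ker: "u \<in> H p \<longleftrightarrow> u \<in> tangent_space p \<and> \<theta> p u = 0"
proof -
  have "{u \<in> tangent_space p. \<theta> p u = 0} = H p" using form by (simp add: pseudo_hermitian_form_def)
  then show ?thesis by blast
qed

lemma dtheta_nondegenerate:
  assumes "u \<in> H p" "\<And>w. w \<in> H p \<Longrightarrow> ext_deriv \<theta> p u w = 0"
  shows "u = (\<lambda>f. 0)"
  using nondegenerate[OF assms(1)] assms(2) Jb_H(1) by (simp add: levi_form_def zero_fun_def)

text \<open>The Reeb field is dual to \<open>\<theta>\<close> with respect to this nondegenerate form, which gives its
  existence, uniqueness and smoothness at once.\<close>

definition reeb_form :: "'a \<Rightarrow> 'a tvec \<Rightarrow> 'a tvec \<Rightarrow> real" where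
  "reeb_form p u v = ext_deriv \<theta> p u v + \<theta> p u * \<theta> p v"

lemma reeb_form_bilinear: "smooth_bilinear reeb_form"
  unfolding smooth_bilinear_def
proof (intro conjI allI ballI impI)
  fix p u assume u: "u \<in> tangent_space p"
  show r: "lin_on p (\<lambda>w. reeb_form p w u)"
    unfolding lin_on_def
  proof (intro ballI allI)
    fix v w a b assume vw: "v \<in> tangent_space p" "w \<in> tangent_space p"
    show "reeb_form p (\<lambda>f. a * v f + b * w f) u = a * reeb_form p v u + b * reeb_form p w u"
      unfolding reeb_form_def ext_deriv_lincomb[OF theta_one_form vw u] lin_onD[OF theta_lin vw]
      by (simp add: algebra_simps)
  qed
  show "lin_on p (reeb_form p u)"
    unfolding lin_on_def
  proof (intro ballI allI)
    fix v w a b assume vw: "v \<in> tangent_space p" "w \<in> tangent_space p"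
    note sw = ext_deriv_swap[OF theta_one_form _ u]
    show "reeb_form p u (\<lambda>f. a * v f + b * w f) = a * reeb_form p u v + b * reeb_form p u w"
      unfolding reeb_form_def lin_onD[OF theta_lin vw] sw[OF tangent_lincomb[OF vw]] sw[OF vw(1)] sw[OF vw(2)]
        ext_deriv_lincomb[OF theta_one_form vw u]
      by (simp add: algebra_simps)
  qed
next
  fix U X Y assume U: "open U" and X: "X \<in> vfields U" and Y: "Y \<in> vfields U"
  show "smooth_fun U (\<lambda>p. reeb_form p (X p) (Y p))"
    unfolding reeb_form_def
    by (intro smooth_fun_add smooth_fun_mult ext_deriv_smooth[OF theta_one_form U X Y]
        one_form_smooth[OF theta_one_form U] X Y U)
qed

text \<open>Testing \<open>u\<close> against itself kills the skew part and gives
  \<open>\<theta>(u) = 0\<close>. Then \<open>u\<close> is horizontal and the nondegeneracy of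
  \<open>d\<theta>\<close> on \<open>H\<close> finishes.\<close>

lemma reeb_form_nondegenerate: "nondegenerate_at p (reeb_form p)"
  unfolding nondegenerate_at_def
proof (intro ballI impI)
  fix u assume u: "u \<in> tangent_space p" "\<forall>v\<in>tangent_space p. reeb_form p u v = 0"
  have "ext_deriv \<theta> p u u = 0" using ext_deriv_swap[OF theta_one_form u(1) u(1)] by simp
  then have "\<theta> p u = 0" using bspec[OF u(2) u(1)] by (simp add: reeb_form_def)
  then show "u = (\<lambda>f. 0)"
    using u H_tangent by (intro dtheta_nondegenerate) (auto simp: H_eq_ker reeb_form_def)
qed

text \<open>For the dual field \<open>V\<close>, testing with \<open>V\<close> itself gives
  \<open>\<theta>(V)\<^sup>2 = \<theta>(V)\<close>. The value 0 would put \<open>V\<close> in the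
  kernel of \<open>d\<theta>\<close> on \<open>H\<close>, hence \<open>V = 0\<close> and
  \<open>\<theta> = 0\<close> at that point. So \<open>\<theta>(V) = 1\<close>, and the defining
  equation reduces to \<open>i\<^sub>V d\<theta> = 0\<close>.\<close>

lemma reeb: "reeb \<in> XM" "\<theta> p (reeb p) = 1"
proof -
  obtain V where V: "V \<in> XM" "\<And>p v. v \<in> tangent_space p \<Longrightarrow> reeb_form p (V p) v = \<theta> p v"
    using riesz[OF reeb_form_bilinear reeb_form_nondegenerate theta_one_form] by blast
  have VT: "V p \<in> tangent_space p" for p by (rule vfields_tangent[OF V(1) UNIV_I])
  have one: "\<theta> p (V p) = 1" for p
  proof -
    have "ext_deriv \<theta> p (V p) (V p) = 0" using ext_deriv_swap[OF theta_one_form VT VT, of p] by simp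
    then have "\<theta> p (V p) * \<theta> p (V p) = \<theta> p (V p)" using V(2)[OF VT, of p] by (simp add: reeb_form_def)
    moreover have "\<theta> p (V p) \<noteq> 0"
    proof
      assume 0: "\<theta> p (V p) = 0"
      have "V p = (\<lambda>f. 0)"
      proof (rule dtheta_nondegenerate)
        show "V p \<in> H p" using 0 VT by (simp add: H_eq_ker)
        show "ext_deriv \<theta> p (V p) w = 0" if "w \<in> H p" for w
          using V(2)[of w p] that 0 by (simp add: H_eq_ker reeb_form_def)
      qed
      have "\<theta> p v = 0" if v: "v \<in> tangent_space p" for v
      proof -
        have "lin_on p (\<lambda>w. reeb_form p w v)" using reeb_form_bilinear v by (simp add: smooth_bilinear_def)
        from lin_on_zero[OF this] show ?thesis using V(2)[OF v] \<open>V p = (\<lambda>f. 0)\<close> by simp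
      qed
      then show False using form by (auto simp: pseudo_hermitian_form_def)
    qed
    ultimately show ?thesis by simp
  qed
  have "reeb = V"
    unfolding reeb_def
  proof (rule the_equality)
    show "V \<in> XM \<and> (\<forall>p. \<theta> p (V p) = 1 \<and> (\<forall>v\<in>tangent_space p. ext_deriv \<theta> p (V p) v = 0))"
      using V one by (force simp: reeb_form_def)
    fix W assume W: "W \<in> XM \<and> (\<forall>p. \<theta> p (W p) = 1 \<and> (\<forall>v\<in>tangent_space p. ext_deriv \<theta> p (W p) v = 0))"
    have "W p = V p" for p
      by (rule nondegenerate_eqI[OF reeb_form_bilinear reeb_form_nondegenerate vfields_tangent[OF conjunct1[OF W] UNIV_I] VT])
        (use W V(2) in \<open>simp add: reeb_form_def\<close>)
    then show "W = V" by (simp add: fun_eq_iff)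
  qed
  then show "reeb \<in> XM" "\<theta> p (reeb p) = 1" using V(1) one by simp_all
qed

lemma reeb_tangent: "reeb p \<in> tangent_space p"
  by (rule vfields_tangent[OF reeb(1) UNIV_I])

lemma pi_H_in_H:
  assumes "u \<in> tangent_space p"
  shows "pi_H p u \<in> H p"
  using tangent_lincomb[OF assms reeb_tangent, of 1 "- \<theta> p u"] lin_onD[OF theta_lin assms reeb_tangent, of 1 "- \<theta> p u"]
  by (simp add: H_eq_ker pi_H_def reeb(2))

lemma pi_H_lincomb:
  assumes "u \<in> tangent_space p" "v \<in> tangent_space p"
  shows "pi_H p (\<lambda>f. a * u f + b * v f) = (\<lambda>f. a * pi_H p u f + b * pi_H p v f)"
  using lin_onD[OF theta_lin assms] by (simp add: pi_H_def algebra_simps)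

lemma pi_H_id: "u \<in> H p \<Longrightarrow> pi_H p u = u"
  by (simp add: H_eq_ker pi_H_def)

lemma pi_H_reeb: "pi_H p (reeb p) = (\<lambda>f. 0)"
  by (simp add: pi_H_def reeb(2))

lemma pi_H_vfields:
  assumes "open U" "X \<in> vfields U"
  shows "(\<lambda>p. pi_H p (X p)) \<in> vfields U"
proof -
  have "(\<lambda>p f. 1 * X p f + - \<theta> p (X p) * reeb p f) \<in> vfields U"
    by (intro vfields_lincomb assms vfields_subset[OF reeb(1)] subset_UNIV smooth_fun_const smooth_fun_minus
        one_form_smooth[OF theta_one_form])
  then show ?thesis by (simp add: pi_H_def)
qed

section \<open>The endomorphism J and the metrics, pointwise\<close>

definition Jt :: "'a \<Rightarrow> 'a tvec \<Rightarrow> 'a tvec" where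
  "Jt p u = Jb p (pi_H p u)"

lemma J_eq: "J X = (\<lambda>p. Jt p (X p))"
  by (simp add: J_def Jt_def)

lemma Jt_in_H: "u \<in> tangent_space p \<Longrightarrow> Jt p u \<in> H p"
  by (simp add: Jt_def Jb_H(1) pi_H_in_H)

lemma Jt_lincomb:
  assumes "u \<in> tangent_space p" "v \<in> tangent_space p"
  shows "Jt p (\<lambda>f. a * u f + b * v f) = (\<lambda>f. a * Jt p u f + b * Jt p v f)"
  unfolding Jt_def pi_H_lincomb[OF assms] by (rule Jb_lincomb[OF pi_H_in_H[OF assms(1)] pi_H_in_H[OF assms(2)]])

lemma Jb_zero: "Jb p (\<lambda>f. 0) = (\<lambda>f. 0)"
  using Jb_lincomb[OF H_zero H_zero, of p 0 0] by simp

lemma Jt_reeb: "Jt p (reeb p) = (\<lambda>f. 0)"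
  by (simp add: Jt_def pi_H_reeb Jb_zero)

lemma Jt_zero: "Jt p (\<lambda>f. 0) = (\<lambda>f. 0)"
  using Jt_lincomb[OF tangent_zero tangent_zero, of p 0 0] by simp

lemma Jt_sum:
  assumes "\<And>i. i \<in> I \<Longrightarrow> u i \<in> tangent_space p"
  shows "Jt p (\<lambda>f. \<Sum>i\<in>I. c i * u i f) = (\<lambda>f. \<Sum>i\<in>I. c i * Jt p (u i) f)"
  using assms
proof (induction I rule: infinite_finite_induct)
  case (insert i I)
  have "u i \<in> tangent_space p" "(\<lambda>f. \<Sum>i\<in>I. c i * u i f) \<in> tangent_space p"
    using insert.prems tangent_lincomb_sum[of I u] by auto
  from Jt_lincomb[OF this, of "c i" 1] show ?case using insert by simp
qed (simp_all add: Jt_zero)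

lemma Jt_H: "u \<in> H p \<Longrightarrow> Jt p u = Jb p u"
  by (simp add: Jt_def pi_H_id)

lemma Jt_Jt: "u \<in> tangent_space p \<Longrightarrow> Jt p (Jt p u) = (\<lambda>f. - pi_H p u f)"
  using Jt_H[OF Jt_in_H] Jb_H(2)[OF pi_H_in_H] by (simp add: Jt_def)

lemma h_sym: "u \<in> H p \<Longrightarrow> v \<in> H p \<Longrightarrow> h p u v = h p v u"
  using metric by (simp add: fiber_metric_def)

lemma h_lincomb: "u \<in> H p \<Longrightarrow> v \<in> H p \<Longrightarrow> w \<in> H p \<Longrightarrow>
    h p (\<lambda>f. a * u f + b * v f) w = a * h p u w + b * h p v w"
  using metric by (simp add: fiber_metric_def)

lemma h_pos: "u \<in> H p \<Longrightarrow> u \<noteq> (\<lambda>f. 0) \<Longrightarrow> h p u u > 0"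
  using metric by (simp add: fiber_metric_def zero_fun_def)

lemma h_smooth:
  assumes "open U" "X \<in> vfields U" "Y \<in> vfields U" "\<And>p. p \<in> U \<Longrightarrow> X p \<in> H p" "\<And>p. p \<in> U \<Longrightarrow> Y p \<in> H p"
  shows "smooth_fun U (\<lambda>p. h p (X p) (Y p))"
proof -
  have "\<forall>U. open U \<longrightarrow> (\<forall>X\<in>vfields U. \<forall>Y\<in>vfields U.
        (\<forall>p\<in>U. X p \<in> H p \<and> Y p \<in> H p) \<longrightarrow> smooth_fun U (\<lambda>p. h p (X p) (Y p)))"
    using metric unfolding fiber_metric_def by (elim conjE)
  then show ?thesis using assms by simp
qed

definition g :: "'a \<Rightarrow> 'a tvec \<Rightarrow> 'a tvec \<Rightarrow> real" where
  "g p u v = h p (pi_H p u) (pi_H p v) + \<theta> p u * \<theta> p v"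

lemma g_sym: "u \<in> tangent_space p \<Longrightarrow> v \<in> tangent_space p \<Longrightarrow> g p u v = g p v u"
  using h_sym[OF pi_H_in_H pi_H_in_H] by (simp add: g_def)

lemma g_lincomb:
  assumes "u \<in> tangent_space p" "v \<in> tangent_space p" "w \<in> tangent_space p"
  shows "g p (\<lambda>f. a * u f + b * v f) w = a * g p u w + b * g p v w"
  unfolding g_def pi_H_lincomb[OF assms(1,2)] lin_onD[OF theta_lin assms(1,2)]
    h_lincomb[OF pi_H_in_H[OF assms(1)] pi_H_in_H[OF assms(2)] pi_H_in_H[OF assms(3)]]
  by (simp add: algebra_simps)

lemma g_bilinear: "smooth_bilinear g"
  unfolding smooth_bilinear_def
proof (intro conjI allI ballI impI)
  fix p u assume u: "u \<in> tangent_space p"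
  show "lin_on p (\<lambda>w. g p w u)" unfolding lin_on_def using g_lincomb u by blast
  show "lin_on p (g p u)" unfolding lin_on_def
  proof (intro ballI allI)
    fix v w a b assume vw: "v \<in> tangent_space p" "w \<in> tangent_space p"
    show "g p u (\<lambda>f. a * v f + b * w f) = a * g p u v + b * g p u w"
      unfolding g_sym[OF u tangent_lincomb[OF vw]] g_sym[OF u vw(1)] g_sym[OF u vw(2)] by (rule g_lincomb[OF vw u])
  qed
next
  fix U X Y assume U: "open U" and X: "X \<in> vfields U" and Y: "Y \<in> vfields U"
  show "smooth_fun U (\<lambda>p. g p (X p) (Y p))"
    unfolding g_def
    by (intro smooth_fun_add smooth_fun_mult U one_form_smooth[OF theta_one_form U] X Y h_smooth pi_H_vfields
        pi_H_in_H vfields_tangent[OF X] vfields_tangent[OF Y])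
qed

lemma g_nondegenerate: "nondegenerate_at p (g p)"
  unfolding nondegenerate_at_def
proof (intro ballI impI)
  fix u assume u: "u \<in> tangent_space p" "\<forall>v\<in>tangent_space p. g p u v = 0"
  have "g p u u = 0" using u by blast
  moreover have "h p (pi_H p u) (pi_H p u) \<ge> 0"
    using h_pos[OF pi_H_in_H[OF u(1)]] h_lincomb[OF H_zero H_zero H_zero, of p 0 0]
    by (cases "pi_H p u = (\<lambda>f. 0)") auto
  moreover have "\<theta> p u * \<theta> p u \<ge> 0" by simp
  ultimately have 0: "\<theta> p u * \<theta> p u = 0" "h p (pi_H p u) (pi_H p u) = 0" unfolding g_def by linarith+
  then have "pi_H p u = (\<lambda>f. 0)" using h_pos[OF pi_H_in_H[OF u(1)]] by force
  then show "u = (\<lambda>f. 0)" using 0(1) by (simp add: pi_H_def)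
qed

section \<open>Smoothness of J\<close>

lemma sum_three_blocks:
  assumes "bij_betw e (UNIV :: 'n set) {..<2 * m + 1}"
  shows "(\<Sum>i\<in>UNIV. F (e i)) = (\<Sum>k<m. F k) + (\<Sum>k<m. F (m + k)) + (F (2 * m) :: 'b::comm_monoid_add)"
proof -
  have split: "(\<Sum>k<m + j. F k) = (\<Sum>k<m. F k) + (\<Sum>k<j. F (m + k))" for j
    by (induction j) (simp_all add: add.assoc)
  have "(\<Sum>i\<in>UNIV. F (e i)) = (\<Sum>k<2 * m + 1. F k)" by (rule sum.reindex_bij_betw[OF assms])
  also have "\<dots> = (\<Sum>k<m + m. F k) + F (2 * m)" by (simp add: mult_2)
  finally show ?thesis by (simp only: split)
qed

text \<open>In the frame of all \<open>Re Z\<^sub>k\<close>, all \<open>Im Z\<^sub>k\<close> and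
  \<xi> the action of \<open>J\<close> is explicit: it sends \<open>Re Z\<^sub>k\<close> to
  \<open>- Im Z\<^sub>k\<close>, \<open>Im Z\<^sub>k\<close> to \<open>Re Z\<^sub>k\<close>, and
  \<xi> to 0. The images are again smooth fields.\<close>

lemma adapted_frame:
  obtains U E where "frame U E" "p \<in> U" "\<And>i. (\<lambda>q. Jt q (E i q)) \<in> vfields U"
proof (rule subbundle_frame[of p])
  fix U Z assume U: "open U" "p \<in> U" and Z: "\<And>i. i < m \<Longrightarrow> Z i \<in> cvfields U"
    and H10: "\<And>q. q \<in> U \<Longrightarrow> H10 q = {(\<lambda>f. \<Sum>i<m. c i * Z i q f) | c. True}"
    and indep: "\<And>q c i. q \<in> U \<Longrightarrow> (\<lambda>f. \<Sum>i<m. c i * Z i q f) = (\<lambda>f. 0) \<Longrightarrow> i < m \<Longrightarrow> c i = 0"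
  have "card (UNIV :: 'n set) = card {..<2 * m + 1}" using dimension by simp
  then obtain e where e: "bij_betw e (UNIV :: 'n set) {..<2 * m + 1}"
    using finite_same_card_bij[OF finite_class.finite_UNIV finite_lessThan] by blast
  define F where "F k = (if k < m then Re_field (Z k) else if k < 2 * m then Im_field (Z (k - m)) else reeb)" for k
  have sumF: "(\<Sum>i\<in>UNIV. c (e i) * F (e i) q f) =
      (\<Sum>k<m. c k * Re (Z k q f)) + (\<Sum>k<m. c (m + k) * Im (Z k q f)) + c (2 * m) * reeb q f" for c q f
    using sum_three_blocks[OF e, of "\<lambda>k. c k * F k q f"] by (simp add: F_def Re_field_def Im_field_def)
  have inH10: "(\<lambda>f. \<Sum>i<m. c i * Z i q f) \<in> H10 q" if "q \<in> U" for q c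
    unfolding H10[OF that] by blast
  have ZH: "Z k q \<in> H10 q" if "k < m" "q \<in> U" for k q
  proof -
    have "(\<Sum>i<m. (if i = k then 1 else 0) * Z i q f) = Z k q f" for f
      using that(1) by (simp add: if_distrib[of "\<lambda>x. x * _"] cong: if_cong)
    then show ?thesis using inH10[OF that(2), of "\<lambda>i. if i = k then 1 else 0"] by (simp add: fun_eq_iff)
  qed
  have Fv: "F k \<in> vfields U" for k
    using Z[of k] Z[of "k - m"] vfields_subset[OF reeb(1) subset_UNIV] by (auto simp: F_def cvfields_def)
  have reebU: "reeb \<in> vfields U" by (rule vfields_subset[OF reeb(1) subset_UNIV])
  have JF: "(\<lambda>q. Jt q (F k q)) \<in> vfields U" for k
  proof -
    have ReH: "(\<lambda>f. Re (z f)) \<in> H q" if "z \<in> H10 q" for z q using that H_iff by blast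
    consider "k < m" | "\<not> k < m" "k < 2 * m" | "\<not> k < m" "\<not> k < 2 * m" by blast
    then show ?thesis
    proof cases
      case 1
      have "(\<lambda>q f. 0 * Im_field (Z k) q f + (-1) * Im_field (Z k) q f) \<in> vfields U"
        using Z[OF 1] by (intro vfields_lincomb U smooth_fun_const) (auto simp: cvfields_def)
      then show ?thesis
      proof (rule vfields_cong[OF U(1), rotated])
        fix q assume q: "q \<in> U"
        have "F k q = (\<lambda>f. Re (Z k q f))" using 1 by (simp add: F_def Re_field_def)
        then show "Jt q (F k q) = (\<lambda>f. 0 * Im_field (Z k) q f + (-1) * Im_field (Z k) q f)"
          using Jt_H[OF ReH[OF ZH[OF 1 q]]] Jb_Re[OF ZH[OF 1 q]] by (simp add: Im_field_def)
      qed
    next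
      case 2
      then have k: "k - m < m" by simp
      have "Re_field (Z (k - m)) \<in> vfields U" using Z[OF k] by (simp add: cvfields_def)
      then show ?thesis
      proof (rule vfields_cong[OF U(1), rotated])
        fix q assume q: "q \<in> U"
        \<comment> \<open>\<open>Im Z\<close> is the real part of the (1,0) vector
          \<open>- \<i> Z\<close>, to which \<open>Jb_Re\<close> applies.\<close>
        note z = H10_scale[OF ZH[OF k q], of "-\<i>"]
        have "F k q = (\<lambda>f. Re (- \<i> * Z (k - m) q f))" using 2 by (simp add: F_def Im_field_def)
        then show "Jt q (F k q) = Re_field (Z (k - m)) q"
          using Jt_H[OF ReH[OF z]] Jb_Re[OF z] by (simp add: Re_field_def)
      qed
    next
      case 3
      then have "(\<lambda>q. Jt q (F k q)) = (\<lambda>q f. 0)" by (simp add: F_def Jt_reeb)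
      then show ?thesis using vfields_zero by simp
    qed
  qed
  have "frame U (\<lambda>i. F (e i))"
    unfolding frame_def
  proof (intro conjI ballI allI impI)
    fix q u assume q: "q \<in> U" and u: "u \<in> tangent_space q"
    obtain z where z: "z \<in> H10 q" "pi_H q u = (\<lambda>f. Re (z f))" using pi_H_in_H[OF u] H_iff by auto
    then obtain c where c: "z = (\<lambda>f. \<Sum>i<m. c i * Z i q f)" using H10[OF q] by auto
    \<comment> \<open>The real part of \<open>c Z\<close> is \<open>Re c Re Z - Im c Im Z\<close>,
      hence the minus sign in the second block.\<close>
    define d where "d k = (if k < m then Re (c k) else if k < 2 * m then - Im (c (k - m)) else \<theta> q u)" for k
    have "u f = (\<Sum>i\<in>UNIV. d (e i) * F (e i) q f)" for f
    proof -
      have "u f = pi_H q u f + \<theta> q u * reeb q f" by (simp add: pi_H_def)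
      also have "\<dots> = (\<Sum>k<m. Re (c k) * Re (Z k q f)) - (\<Sum>k<m. Im (c k) * Im (Z k q f)) + \<theta> q u * reeb q f"
        by (simp add: z(2) c sum_subtractf)
      finally show ?thesis unfolding sumF by (simp add: d_def sum_negf)
    qed
    then show "\<exists>c. u = (\<lambda>f. \<Sum>i\<in>UNIV. c i * F (e i) q f)"
      by (intro exI[of _ "\<lambda>i. d (e i)"]) (simp add: fun_eq_iff)
  next
    fix q c i assume q: "q \<in> U" and 0: "(\<lambda>f. \<Sum>i\<in>UNIV. c i * F (e i) q f) = (\<lambda>f. 0)"
    define d where "d k = c (inv_into UNIV e k)" for k
    have cd: "c j = d (e j)" for j using e by (simp add: d_def bij_betw_def)
    \<comment> \<open>The two horizontal blocks are repacked as the real part of a (1,0) vector.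
      Applying \<theta> isolates the coefficient of \<xi>; the rest follows from
      \<open>H10_Re_zero\<close> and complex independence of the \<open>Z k\<close>.\<close>
    define z where "z f = (\<Sum>k<m. Complex (d k) (- d (m + k)) * Z k q f)" for f
    have z: "z \<in> H10 q" unfolding z_def[abs_def] by (rule inH10[OF q])
    have eq: "Re (z f) + d (2 * m) * reeb q f = 0" for f
      using fun_cong[OF 0, of f] sumF[of d q f] by (simp add: z_def cd sum.distrib)
    have zT: "(\<lambda>f. Re (z f)) \<in> tangent_space q" "\<theta> q (\<lambda>f. Re (z f)) = 0"
      using z H_iff H_eq_ker by auto
    have "\<theta> q (\<lambda>f. 1 * Re (z f) + d (2 * m) * reeb q f) = d (2 * m)"
      unfolding lin_onD[OF theta_lin zT(1) reeb_tangent] by (simp add: zT reeb(2))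
    then have d2: "d (2 * m) = 0" using lin_on_zero[OF theta_lin, of q] by (simp add: eq)
    then have "z = (\<lambda>f. 0)" using eq by (intro H10_Re_zero[OF z]) simp
    then have "Complex (d k) (- d (m + k)) = 0" if "k < m" for k
      using indep[OF q _ that, of "\<lambda>k. Complex (d k) (- d (m + k))"] unfolding z_def[abs_def] by simp
    then have dk: "d k = 0 \<and> d (m + k) = 0" if "k < m" for k using that by (simp add: complex_eq_iff)
    have "e i < 2 * m + 1" using e bij_betwE by blast
    then consider "e i < m" | "e i - m < m" "e i = m + (e i - m)" | "e i = 2 * m" by linarith
    then show "c i = 0" unfolding cd using dk d2 by cases metis+
  qed (use U Fv in auto)
  then show ?thesis using that U(2) JF by blast
qed

text \<open>Representing \<open>g(X, _)\<close> in an adapted frame gives smooth coefficients of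
  \<open>X\<close>. Since \<open>J\<close> is linear, the same coefficients express
  \<open>J X\<close> through the smooth images of the frame.\<close>

lemma J_vfields:
  assumes W: "open W" and X: "X \<in> vfields W"
  shows "J X \<in> vfields W"
  unfolding J_eq
proof (rule vfields_local)
  fix p assume p: "p \<in> W"
  show "\<exists>V Y. open V \<and> p \<in> V \<and> Y \<in> vfields V \<and> (\<forall>q\<in>V. Jt q (X q) = Y q)"
  proof (rule adapted_frame[of p])
    fix U E assume E: "frame U E" and pU: "p \<in> U" and JE: "\<And>i. (\<lambda>q. Jt q (E i q)) \<in> vfields U"
    have U: "open U" and EU: "E i \<in> vfields U" for i using E by (auto simp: frame_def)
    let ?V = "U \<inter> W"
    have V: "open ?V" using U W by blast
    have EV: "frame ?V E" using E V vfields_subset[of _ U ?V] by (auto simp: frame_def)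
    have XV: "X \<in> vfields ?V" and EV': "E i \<in> vfields ?V" for i
      using vfields_subset[OF X Int_lower2] vfields_subset[OF EU Int_lower1] by auto
    have lin: "lin_on q (g q (X q))" if "q \<in> ?V" for q
      using g_bilinear vfields_tangent[OF XV that] by (simp add: smooth_bilinear_def)
    have sm: "smooth_fun ?V (\<lambda>q. g q (X q) (E i q))" for i
      using g_bilinear V XV EV' by (simp add: smooth_bilinear_def)
    show ?thesis
    proof (rule riesz_frame[where L = "\<lambda>q. g q (X q)", OF EV g_bilinear g_nondegenerate lin sm])
      fix c assume c: "\<And>i. smooth_fun ?V (c i)" "\<And>q v. q \<in> ?V \<Longrightarrow> v \<in> tangent_space q \<Longrightarrow>
          g q (\<lambda>f. \<Sum>i\<in>UNIV. c i q * E i q f) v = g q (X q) v"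
      have Xc: "X q = (\<lambda>f. \<Sum>i\<in>UNIV. c i q * E i q f)" if "q \<in> ?V" for q
        by (rule sym, rule nondegenerate_eqI[OF g_bilinear g_nondegenerate])
          (use c(2)[OF that] vfields_tangent[OF XV that] tangent_lincomb_sum[OF vfields_tangent[OF EV' that]] in auto)
      have "Jt q (X q) = (\<lambda>f. \<Sum>i\<in>UNIV. c i q * Jt q (E i q) f)" if "q \<in> ?V" for q
        unfolding Xc[OF that] by (rule Jt_sum) (rule vfields_tangent[OF EV' that])
      moreover have "(\<lambda>q f. \<Sum>i\<in>UNIV. c i q * Jt q (E i q) f) \<in> vfields ?V"
        by (rule vfields_sum[OF V vfields_subset[OF JE Int_lower1] c(1)])
      ultimately show ?thesis using V p pU
        by (intro exI[of _ ?V] exI[of _ "\<lambda>q f. \<Sum>i\<in>UNIV. c i q * Jt q (E i q) f"]) auto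
    qed
  qed
qed

end

section \<open>The canonical connection\<close>

context smooth_manifold
begin

section \<open>Algebra of global fields\<close>

text \<open>All field operations are instances of one combination with function coefficients, so
  each linearity property has to be proved only in that form.\<close>

lemma field_as_lincomb:
  "X + Y = (\<lambda>p f. 1 * X p f + 1 * Y p f)" "X - Y = (\<lambda>p f. 1 * X p f + (-1) * Y p f)"
  "- X = (\<lambda>p f. (-1) * X p f + 0 * X p f)" "fscale u X = (\<lambda>p f. u p * X p f + 0 * X p f)"
  "(0 :: 'a vfield) = (\<lambda>p f. 0)"
  for X Y :: "'a vfield"
  by (simp_all add: fun_eq_iff fscale_def)

lemma XM_tangent: "X \<in> XM \<Longrightarrow> X p \<in> tangent_space p"
  by (rule vfields_tangent) auto

lemma XM_smooth: "X \<in> XM \<Longrightarrow> CM u \<Longrightarrow> CM (\<lambda>p. X p u)"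
  by (rule vfields_smooth) auto

lemma CM_near: "CM u \<Longrightarrow> smooth_near p u"
  by (rule smooth_nearI) auto

lemma XM_closed:
  shows XM_add: "X \<in> XM \<Longrightarrow> Y \<in> XM \<Longrightarrow> X + Y \<in> XM"
    and XM_diff: "X \<in> XM \<Longrightarrow> Y \<in> XM \<Longrightarrow> X - Y \<in> XM"
    and XM_minus: "X \<in> XM \<Longrightarrow> - X \<in> XM"
    and XM_fscale: "CM u \<Longrightarrow> X \<in> XM \<Longrightarrow> fscale u X \<in> XM"
    and XM_zero: "0 \<in> XM"
    and XM_bracket: "X \<in> XM \<Longrightarrow> Y \<in> XM \<Longrightarrow> lie_bracket X Y \<in> XM"
  unfolding field_as_lincomb
  by (intro vfields_lincomb vfields_zero lie_bracket_vfields open_UNIV smooth_fun_const; assumption)+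

lemma XM_const: "X \<in> XM \<Longrightarrow> X p (\<lambda>q. c) = 0"
  by (rule tangent_const[OF XM_tangent])

lemma
  assumes "X \<in> XM" "CM u" "CM v"
  shows XM_der_add: "X p (\<lambda>q. u q + v q) = X p u + X p v"
    and XM_der_mult: "X p (\<lambda>q. u q * v q) = u p * X p v + v p * X p u"
  using tangent_derivation[OF XM_tangent[OF assms(1)] CM_near[OF assms(2)] CM_near[OF assms(3)]] .

lemma XM_der_minus: "X \<in> XM \<Longrightarrow> CM u \<Longrightarrow> X p (\<lambda>q. - u q) = - X p u"
  by (rule tangent_minus[OF XM_tangent CM_near])

lemma bracket_add_left:
  "X \<in> XM \<Longrightarrow> X' \<in> XM \<Longrightarrow> Y \<in> XM \<Longrightarrow> lie_bracket (X + X') Y = lie_bracket X Y + lie_bracket X' Y"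
  unfolding field_as_lincomb(1)
  by (intro ext, subst lie_bracket_lincomb[OF open_UNIV UNIV_I]) (simp_all add: XM_const)

lemma bracket_fscale_left:
  "CM u \<Longrightarrow> X \<in> XM \<Longrightarrow> Y \<in> XM \<Longrightarrow>
    lie_bracket (fscale u X) Y = fscale u (lie_bracket X Y) - fscale (\<lambda>p. Y p u) X"
  unfolding field_as_lincomb(4)[of u X]
  by (intro ext, subst lie_bracket_lincomb[OF open_UNIV UNIV_I]) (simp_all add: XM_const fscale_def)

lemma bracket_swap: "lie_bracket Y X = - lie_bracket X Y"
  by (intro ext) (simp add: lie_bracket_swap[of X Y])

lemma bracket_minus_left:
  assumes "X \<in> XM" "Y \<in> XM"
  shows "lie_bracket (- X) Y = - lie_bracket X Y"
proof -
  have e: "- X = fscale (\<lambda>p. -1) X" by (simp add: fscale_def fun_eq_iff)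
  have "lie_bracket (fscale (\<lambda>p. -1) X) Y = - lie_bracket X Y"
    unfolding bracket_fscale_left[OF smooth_fun_const assms]
    by (simp add: XM_const[OF assms(2)] fscale_def fun_eq_iff)
  then show ?thesis unfolding e .
qed

lemma bracket_zero [simp]: "Y \<in> XM \<Longrightarrow> lie_bracket 0 Y = 0" "Y \<in> XM \<Longrightarrow> lie_bracket Y 0 = 0"
  by (auto simp: lie_bracket_def fun_eq_iff XM_const)

lemma bracket_add_right:
  "X \<in> XM \<Longrightarrow> Y \<in> XM \<Longrightarrow> Y' \<in> XM \<Longrightarrow> lie_bracket X (Y + Y') = lie_bracket X Y + lie_bracket X Y'"
  using bracket_add_left[of Y Y' X] bracket_swap[of X "Y + Y'"] bracket_swap[of X Y] bracket_swap[of X Y'] by simp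

lemma bracket_minus_right: "X \<in> XM \<Longrightarrow> Y \<in> XM \<Longrightarrow> lie_bracket X (- Y) = - lie_bracket X Y"
  using bracket_minus_left[of Y X] bracket_swap[of X "- Y"] bracket_swap[of X Y] by simp

lemma bracket_fscale_right:
  assumes "CM u" "X \<in> XM" "Y \<in> XM"
  shows "lie_bracket X (fscale u Y) = fscale u (lie_bracket X Y) + fscale (\<lambda>p. X p u) Y"
proof -
  have "lie_bracket X (fscale u Y) = - lie_bracket (fscale u Y) X" by (rule bracket_swap)
  also have "\<dots> = fscale u (- lie_bracket Y X) + fscale (\<lambda>p. X p u) Y"
    using bracket_fscale_left[OF assms(1,3,2)] by (simp add: fscale_def fun_eq_iff)
  finally show ?thesis by (simp only: bracket_swap[of X Y])
qed

lemma pointwise_linear: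
  fixes t :: "'a \<Rightarrow> 'a tvec \<Rightarrow> 'a tvec"
  assumes t: "\<And>p u v a b. u \<in> tangent_space p \<Longrightarrow> v \<in> tangent_space p \<Longrightarrow>
    t p (\<lambda>f. a * u f + b * v f) = (\<lambda>f. a * t p u f + b * t p v f)"
  shows "X \<in> XM \<Longrightarrow> Y \<in> XM \<Longrightarrow> (\<lambda>p. t p ((X + Y) p)) = (\<lambda>p. t p (X p)) + (\<lambda>p. t p (Y p))"
    and "X \<in> XM \<Longrightarrow> Y \<in> XM \<Longrightarrow> (\<lambda>p. t p ((X - Y) p)) = (\<lambda>p. t p (X p)) - (\<lambda>p. t p (Y p))"
    and "X \<in> XM \<Longrightarrow> (\<lambda>p. t p ((- X) p)) = - (\<lambda>p. t p (X p))"
    and "X \<in> XM \<Longrightarrow> (\<lambda>p. t p (fscale u X p)) = fscale u (\<lambda>p. t p (X p))"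
    and "(\<lambda>p. t p ((0 :: 'a vfield) p)) = 0"
proof -
  have "(\<lambda>p. t p (\<lambda>f. a p * X p f + b p * Y p f)) = (\<lambda>p f. a p * t p (X p) f + b p * t p (Y p) f)"
    if "X \<in> XM" "Y \<in> XM" for X Y a b
    using t[OF XM_tangent[OF that(1)] XM_tangent[OF that(2)]] by (simp add: fun_eq_iff)
  note * = this[of _ _ "\<lambda>_. 1" "\<lambda>_. 1"] this[of _ _ "\<lambda>_. 1" "\<lambda>_. -1"] this[of X X "\<lambda>_. -1" "\<lambda>_. 0"]
    this[of X X u "\<lambda>_. 0"] this[OF XM_zero XM_zero, of "\<lambda>_. 0" "\<lambda>_. 0"]
  show "X \<in> XM \<Longrightarrow> Y \<in> XM \<Longrightarrow> (\<lambda>p. t p ((X + Y) p)) = (\<lambda>p. t p (X p)) + (\<lambda>p. t p (Y p))"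
    "X \<in> XM \<Longrightarrow> Y \<in> XM \<Longrightarrow> (\<lambda>p. t p ((X - Y) p)) = (\<lambda>p. t p (X p)) - (\<lambda>p. t p (Y p))"
    "X \<in> XM \<Longrightarrow> (\<lambda>p. t p ((- X) p)) = - (\<lambda>p. t p (X p))"
    "X \<in> XM \<Longrightarrow> (\<lambda>p. t p (fscale u X p)) = fscale u (\<lambda>p. t p (X p))"
    "(\<lambda>p. t p ((0 :: 'a vfield) p)) = 0"
    unfolding field_as_lincomb using * by simp_all
qed

lemma fscale_add: "fscale u (X + Y) = fscale u X + fscale u Y"
  and fscale_diff: "fscale u (X - Y) = fscale u X - fscale u Y"
  and fscale_minus: "fscale u (- X) = - fscale u X"
  and fscale_zero [simp]: "fscale u 0 = 0"
  by (simp_all add: fscale_def fun_eq_iff algebra_simps)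

end

context pseudo_hermitian_manifold
begin

definition PH :: "'a vfield \<Rightarrow> 'a vfield" where
  "PH X = (\<lambda>p. pi_H p (X p))"

abbreviation th :: "'a vfield \<Rightarrow> 'a \<Rightarrow> real" where
  "th X \<equiv> \<lambda>p. \<theta> p (X p)"

lemma PH_split: "X = PH X + fscale (th X) reeb"
  by (simp add: PH_def pi_H_def fscale_def fun_eq_iff)

lemma XM_PH: "X \<in> XM \<Longrightarrow> PH X \<in> XM"
  unfolding PH_def by (rule pi_H_vfields) auto

lemma XM_J: "X \<in> XM \<Longrightarrow> J X \<in> XM"
  by (rule J_vfields) auto

lemma CM_th: "X \<in> XM \<Longrightarrow> CM (th X)"
  by (rule one_form_smooth[OF theta_one_form]) auto

lemmas XM_rules = XM_closed XM_PH XM_J reeb(1) XM_smooth CM_th smooth_fun_const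

lemma
  shows J_add: "X \<in> XM \<Longrightarrow> Y \<in> XM \<Longrightarrow> J (X + Y) = J X + J Y"
    and J_diff: "X \<in> XM \<Longrightarrow> Y \<in> XM \<Longrightarrow> J (X - Y) = J X - J Y"
    and J_minus: "X \<in> XM \<Longrightarrow> J (- X) = - J X"
    and J_fscale: "X \<in> XM \<Longrightarrow> J (fscale u X) = fscale u (J X)"
    and J_zero: "J 0 = 0"
  unfolding J_eq by (rule pointwise_linear[where t = Jt, OF Jt_lincomb]; assumption?)+

lemma
  shows PH_add: "X \<in> XM \<Longrightarrow> Y \<in> XM \<Longrightarrow> PH (X + Y) = PH X + PH Y"
    and PH_diff: "X \<in> XM \<Longrightarrow> Y \<in> XM \<Longrightarrow> PH (X - Y) = PH X - PH Y"
    and PH_minus: "X \<in> XM \<Longrightarrow> PH (- X) = - PH X"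
    and PH_fscale: "X \<in> XM \<Longrightarrow> PH (fscale u X) = fscale u (PH X)"
    and PH_zero: "PH 0 = 0"
  unfolding PH_def by (rule pointwise_linear[where t = pi_H, OF pi_H_lincomb]; assumption?)+

lemma
  shows th_add: "X \<in> XM \<Longrightarrow> Y \<in> XM \<Longrightarrow> \<theta> p ((X + Y) p) = \<theta> p (X p) + \<theta> p (Y p)"
    and th_fscale: "X \<in> XM \<Longrightarrow> \<theta> p (fscale u X p) = u p * \<theta> p (X p)"
    and th_zero: "\<theta> p ((0 :: 'a vfield) p) = 0"
  unfolding field_as_lincomb
  using lin_onD[OF theta_lin XM_tangent XM_tangent, of X Y p 1 1] lin_on_scale[OF theta_lin XM_tangent, of X p "u p"]
    lin_on_zero[OF theta_lin]
  by simp_all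

lemma XM_H: "X \<in> XM \<Longrightarrow> PH X p \<in> H p" "X \<in> XM \<Longrightarrow> J X p \<in> H p"
  by (simp_all add: PH_def J_eq pi_H_in_H Jt_in_H XM_tangent)

lemma th_PH: "X \<in> XM \<Longrightarrow> \<theta> p (PH X p) = 0" and th_J: "X \<in> XM \<Longrightarrow> \<theta> p (J X p) = 0"
  using XM_H H_eq_ker by blast+

lemma PH_idI: "(\<And>p. X p \<in> H p) \<Longrightarrow> PH X = X"
  by (simp add: PH_def pi_H_id)

lemma PH_PH: "X \<in> XM \<Longrightarrow> PH (PH X) = PH X" and PH_J: "X \<in> XM \<Longrightarrow> PH (J X) = J X"
  by (rule PH_idI, rule XM_H, assumption)+

lemma J_PH: "X \<in> XM \<Longrightarrow> J (PH X) = J X"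
  by (simp add: J_eq Jt_def PH_def pi_H_id[OF pi_H_in_H] XM_tangent)

lemma J_J: "X \<in> XM \<Longrightarrow> J (J X) = - PH X"
  by (simp add: J_eq Jt_Jt XM_tangent PH_def fun_eq_iff)

lemma J_reeb: "J reeb = 0" and PH_reeb: "PH reeb = 0"
  by (simp_all add: J_eq PH_def Jt_reeb pi_H_reeb fun_eq_iff)

lemmas JP = PH_PH PH_J J_PH J_J J_reeb PH_reeb J_add J_diff J_minus J_fscale J_zero
  PH_add PH_diff PH_minus PH_fscale PH_zero

lemma hh_sym: "X \<in> XM \<Longrightarrow> Y \<in> XM \<Longrightarrow> h_tensor X Y p = h_tensor Y X p"
  using h_sym[OF pi_H_in_H[OF XM_tangent] pi_H_in_H[OF XM_tangent]] by (simp add: h_tensor_def)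

lemma hh_lincomb:
  assumes "X \<in> XM" "X' \<in> XM" "Y \<in> XM"
  shows "h_tensor (\<lambda>p f. a p * X p f + b p * X' p f) Y p = a p * h_tensor X Y p + b p * h_tensor X' Y p"
  unfolding h_tensor_def pi_H_lincomb[OF XM_tangent[OF assms(1)] XM_tangent[OF assms(2)]]
  by (intro h_lincomb pi_H_in_H XM_tangent assms)

lemma hh_lin:
  shows hh_add: "X \<in> XM \<Longrightarrow> X' \<in> XM \<Longrightarrow> Y \<in> XM \<Longrightarrow> h_tensor (X + X') Y p = h_tensor X Y p + h_tensor X' Y p"
    and hh_diff: "X \<in> XM \<Longrightarrow> X' \<in> XM \<Longrightarrow> Y \<in> XM \<Longrightarrow> h_tensor (X - X') Y p = h_tensor X Y p - h_tensor X' Y p"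
    and hh_minus: "X \<in> XM \<Longrightarrow> Y \<in> XM \<Longrightarrow> h_tensor (- X) Y p = - h_tensor X Y p"
    and hh_fscale: "X \<in> XM \<Longrightarrow> Y \<in> XM \<Longrightarrow> h_tensor (fscale u X) Y p = u p * h_tensor X Y p"
    and hh_zero: "Y \<in> XM \<Longrightarrow> h_tensor 0 Y p = 0"
  using hh_lincomb[of X X' Y "\<lambda>p. 1" "\<lambda>p. 1" p] hh_lincomb[of X X' Y "\<lambda>p. 1" "\<lambda>p. -1" p]
    hh_lincomb[of X X Y "\<lambda>p. -1" "\<lambda>p. 0" p] hh_lincomb[of X X Y u "\<lambda>p. 0" p]
    hh_lincomb[OF XM_zero XM_zero, of Y "\<lambda>p. 0" "\<lambda>p. 0" p]
  unfolding field_as_lincomb by simp_all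

lemma hh_right:
  shows hh_add2: "X \<in> XM \<Longrightarrow> X' \<in> XM \<Longrightarrow> Y \<in> XM \<Longrightarrow> h_tensor Y (X + X') p = h_tensor Y X p + h_tensor Y X' p"
    and hh_diff2: "X \<in> XM \<Longrightarrow> X' \<in> XM \<Longrightarrow> Y \<in> XM \<Longrightarrow> h_tensor Y (X - X') p = h_tensor Y X p - h_tensor Y X' p"
    and hh_minus2: "X \<in> XM \<Longrightarrow> Y \<in> XM \<Longrightarrow> h_tensor Y (- X) p = - h_tensor Y X p"
    and hh_fscale2: "X \<in> XM \<Longrightarrow> Y \<in> XM \<Longrightarrow> CM u \<Longrightarrow> h_tensor Y (fscale u X) p = u p * h_tensor Y X p"
    and hh_zero2: "Y \<in> XM \<Longrightarrow> h_tensor Y 0 p = 0"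
  by (simp_all add: hh_sym[of Y] XM_rules hh_lin)

lemma hh_PH: "X \<in> XM \<Longrightarrow> h_tensor (PH X) Y p = h_tensor X Y p" "Y \<in> XM \<Longrightarrow> h_tensor X (PH Y) p = h_tensor X Y p"
  by (simp_all add: h_tensor_def PH_def pi_H_id[OF pi_H_in_H] XM_tangent)

lemma hh_JJ: "X \<in> XM \<Longrightarrow> Y \<in> XM \<Longrightarrow> h_tensor (J X) (J Y) p = h_tensor X Y p"
  using metric_Jb[OF pi_H_in_H[OF XM_tangent] pi_H_in_H[OF XM_tangent]]
  by (simp add: h_tensor_def J_eq Jt_H[OF Jt_in_H] pi_H_id[OF Jt_in_H] XM_tangent) (simp add: Jt_def)

text \<open>An isometry with square -1 is skew: \<open>hh_JJ\<close> is applied to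
  \<open>J X\<close> and \<open>Y\<close>.\<close>

lemma hh_J: "X \<in> XM \<Longrightarrow> Y \<in> XM \<Longrightarrow> h_tensor (J X) Y p = - h_tensor X (J Y) p"
  using hh_JJ[of "J X" Y p] by (simp add: JP XM_rules hh_minus hh_PH)

lemma hh_reeb: "X \<in> XM \<Longrightarrow> h_tensor reeb X p = 0" "X \<in> XM \<Longrightarrow> h_tensor X reeb p = 0"
  using hh_PH(1)[OF reeb(1), of X p] hh_PH(2)[OF reeb(1), of X p] by (simp_all add: PH_reeb hh_zero hh_zero2)

lemma CM_hh: "X \<in> XM \<Longrightarrow> Y \<in> XM \<Longrightarrow> CM (h_tensor X Y)"
  unfolding h_tensor_def[abs_def]
  by (intro h_smooth open_UNIV pi_H_vfields pi_H_in_H XM_tangent)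

lemma g_metric_eq: "g_metric X Y p = g p (X p) (Y p)"
  by (simp add: g_metric_def h_tensor_def g_def)

text \<open>Every tangent vector extends to a global test field, so these data determine all
  products with respect to the nondegenerate \<open>g\<close>.\<close>

lemma field_eqI:
  assumes "X \<in> XM" "Y \<in> XM" and th: "\<And>p. \<theta> p (X p) = \<theta> p (Y p)"
    and hh: "\<And>Z p. Z \<in> XM \<Longrightarrow> h_tensor X Z p = h_tensor Y Z p"
  shows "X = Y"
proof
  fix p
  show "X p = Y p"
  proof (rule nondegenerate_eqI[OF g_bilinear g_nondegenerate XM_tangent[OF assms(1)] XM_tangent[OF assms(2)]])
    fix w assume "w \<in> tangent_space p"
    then obtain Z where Z: "Z \<in> XM" "Z p = w" by (rule vfield_through)
    have "g_metric X Z p = g_metric Y Z p" by (simp add: g_metric_def th hh[OF Z(1)])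
    then show "g p (X p) w = g p (Y p) w" by (simp add: g_metric_eq Z(2))
  qed
qed

text \<open>This is \<open>2 P\<^sub>X Y\<close> in the notation of the introduction; the factor avoids halves.\<close>

definition dbar2 :: "'a vfield \<Rightarrow> 'a vfield \<Rightarrow> 'a vfield" where
  "dbar2 X Y = PH (lie_bracket X (PH Y) + lie_bracket (J X) (J Y) + J (lie_bracket (J X) (PH Y)) - J (lie_bracket X (J Y)))"

lemma XM_dbar2: "X \<in> XM \<Longrightarrow> Y \<in> XM \<Longrightarrow> dbar2 X Y \<in> XM"
  by (simp add: dbar2_def XM_rules)

lemmas br = bracket_add_left bracket_add_right bracket_minus_left bracket_minus_right bracket_fscale_left bracket_fscale_right

lemma dbar2_add_left: "X \<in> XM \<Longrightarrow> X' \<in> XM \<Longrightarrow> Y \<in> XM \<Longrightarrow> dbar2 (X + X') Y = dbar2 X Y + dbar2 X' Y"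
  by (simp add: dbar2_def JP XM_rules br)

lemma dbar2_add_right: "X \<in> XM \<Longrightarrow> Y \<in> XM \<Longrightarrow> Y' \<in> XM \<Longrightarrow> dbar2 X (Y + Y') = dbar2 X Y + dbar2 X Y'"
  by (simp add: dbar2_def JP XM_rules br)

text \<open>After projection the terms containing derivatives of \<open>u\<close> cancel in pairs,
  because \<open>J (J X) = - PH X\<close>. The four brackets are combined so that this
  happens.\<close>

lemma dbar2_fscale_left: "X \<in> XM \<Longrightarrow> Y \<in> XM \<Longrightarrow> CM u \<Longrightarrow> dbar2 (fscale u X) Y = fscale u (dbar2 X Y)"
  by (simp add: dbar2_def JP XM_rules br fscale_add fscale_diff fscale_minus)

text \<open>On horizontal fields the derivative terms are those that the Leibniz rule gives for
  twice \<open>D X Y + J (D (J X) Y)\<close>, as a comparison of the two operators requires.\<close>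

lemma dbar2_fscale_right: "X \<in> XM \<Longrightarrow> Y \<in> XM \<Longrightarrow> CM u \<Longrightarrow> dbar2 X (fscale u Y) =
    fscale u (dbar2 X Y) + fscale (\<lambda>p. 2 * X p u) (PH Y) + fscale (\<lambda>p. 2 * J X p u) (J Y)"
  unfolding dbar2_def
  by (simp only: JP XM_rules br fscale_add fscale_diff fscale_minus) (simp add: fun_eq_iff fscale_def)

lemma dbar2_J: "X \<in> XM \<Longrightarrow> Y \<in> XM \<Longrightarrow> dbar2 X (J Y) = J (dbar2 X Y)"
  by (simp add: dbar2_def JP XM_rules br)

lemma dbar2_J_left: "X \<in> XM \<Longrightarrow> Y \<in> XM \<Longrightarrow> PH X = X \<Longrightarrow> dbar2 (J X) Y = - J (dbar2 X Y)"
  by (simp add: dbar2_def JP XM_rules br)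

lemma PH_dbar2: "X \<in> XM \<Longrightarrow> Y \<in> XM \<Longrightarrow> PH (dbar2 X Y) = dbar2 X Y"
  by (simp add: dbar2_def JP XM_rules)

lemma dbar2_PH: "X \<in> XM \<Longrightarrow> Y \<in> XM \<Longrightarrow> dbar2 X (PH Y) = dbar2 X Y"
  by (simp add: dbar2_def JP XM_rules)

lemma dbar2_reeb: "X \<in> XM \<Longrightarrow> dbar2 X reeb = 0"
  by (simp add: dbar2_def JP XM_rules)


text \<open>Equations between functions rather than values, because a tangent vector is applied to
  the whole function \<open>h_tensor Y Z\<close>.\<close>

lemma hh_fun:
  shows "X \<in> XM \<Longrightarrow> X' \<in> XM \<Longrightarrow> Y \<in> XM \<Longrightarrow> h_tensor (X + X') Y = (\<lambda>p. h_tensor X Y p + h_tensor X' Y p)"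
    and "X \<in> XM \<Longrightarrow> X' \<in> XM \<Longrightarrow> Y \<in> XM \<Longrightarrow> h_tensor Y (X + X') = (\<lambda>p. h_tensor Y X p + h_tensor Y X' p)"
    and "X \<in> XM \<Longrightarrow> Y \<in> XM \<Longrightarrow> h_tensor (fscale u X) Y = (\<lambda>p. u p * h_tensor X Y p)"
    and "X \<in> XM \<Longrightarrow> Y \<in> XM \<Longrightarrow> CM u \<Longrightarrow> h_tensor Y (fscale u X) = (\<lambda>p. u p * h_tensor Y X p)"
    and "X \<in> XM \<Longrightarrow> Y \<in> XM \<Longrightarrow> h_tensor (- X) Y = (\<lambda>p. - h_tensor X Y p)"
    and "X \<in> XM \<Longrightarrow> Y \<in> XM \<Longrightarrow> h_tensor Y (- X) = (\<lambda>p. - h_tensor Y X p)"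
    and "Y \<in> XM \<Longrightarrow> h_tensor 0 Y = (\<lambda>p. 0)" "Y \<in> XM \<Longrightarrow> h_tensor Y 0 = (\<lambda>p. 0)"
    and "X \<in> XM \<Longrightarrow> h_tensor (PH X) Y = h_tensor X Y" "Y \<in> XM \<Longrightarrow> h_tensor X (PH Y) = h_tensor X Y"
    and "X \<in> XM \<Longrightarrow> Y \<in> XM \<Longrightarrow> h_tensor (J X) (J Y) = h_tensor X Y"
  by (rule ext, rule hh_lin hh_right hh_PH hh_JJ; assumption)+

lemma hh_J_fun: "X \<in> XM \<Longrightarrow> Y \<in> XM \<Longrightarrow> h_tensor (J X) Y = (\<lambda>p. - h_tensor X (J Y) p)"
  by (rule ext, rule hh_J)

section \<open>The Koszul-type formula and the connection it defines\<close>

text \<open>The value intended for \<open>h(\<nabla>\<^sub>X Y, Z)\<close>. The inner halves undo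
  the factor in \<open>dbar2\<close>; the outer half divides by the 2 on the left of the
  formula.\<close>

definition koszul :: "'a vfield \<Rightarrow> 'a vfield \<Rightarrow> 'a vfield \<Rightarrow> 'a \<Rightarrow> real" where
  "koszul X Y Z p = (X p (h_tensor Y Z) - J X p (h_tensor (J Y) Z)
     + h_tensor (dbar2 X Y) Z p / 2 - h_tensor Y (dbar2 X Z) p / 2) / 2"

lemmas XM_all = XM_rules XM_dbar2 CM_hh XM_der_add XM_der_mult XM_der_minus XM_const

lemma CM_koszul:
  assumes "X \<in> XM" "Y \<in> XM" "Z \<in> XM"
  shows "CM (koszul X Y Z)"
proof -
  have "CM (\<lambda>p. (1 / 2) * (X p (h_tensor Y Z) - J X p (h_tensor (J Y) Z)
     + (1 / 2) * h_tensor (dbar2 X Y) Z p - (1 / 2) * h_tensor Y (dbar2 X Z) p))"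
    by (intro smooth_fun_mult smooth_fun_diff smooth_fun_add open_UNIV smooth_fun_const XM_smooth[OF assms(1)]
        XM_smooth[OF XM_J[OF assms(1)]] CM_hh XM_J XM_dbar2 assms)
  then show ?thesis by (simp add: koszul_def[abs_def])
qed

lemma koszul_add:
  assumes "X \<in> XM" "X' \<in> XM" "Y \<in> XM" "Y' \<in> XM" "Z \<in> XM" "Z' \<in> XM"
  shows "koszul (X + X') Y Z p = koszul X Y Z p + koszul X' Y Z p"
    and "koszul X (Y + Y') Z p = koszul X Y Z p + koszul X Y' Z p"
    and "koszul X Y (Z + Z') p = koszul X Y Z p + koszul X Y Z' p"
  using assms
  by (simp_all add: koszul_def JP hh_fun dbar2_add_left dbar2_add_right XM_all add_divide_distrib diff_divide_distrib)

text \<open>The derivative terms of \<open>dbar2\<close> meet those of the two differentiated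
  products. In the second slot they add up to the Leibniz term of a connection; in the third slot
  they cancel, by skewness of \<open>J\<close>.\<close>

lemma koszul_fscale:
  assumes "X \<in> XM" "Y \<in> XM" "Z \<in> XM" "CM u"
  shows "koszul (fscale u X) Y Z p = u p * koszul X Y Z p"
    and "koszul X (fscale u Y) Z p = u p * koszul X Y Z p + X p u * h_tensor Y Z p"
    and "koszul X Y (fscale u Z) p = u p * koszul X Y Z p"
proof -
  have c: "CM (\<lambda>p. 2 * X p u)" "CM (\<lambda>p. 2 * J X p u)"
    by (intro smooth_fun_mult open_UNIV smooth_fun_const XM_smooth[OF assms(1,4)] XM_smooth[OF XM_J[OF assms(1)] assms(4)])+
  have [simp]: "h_tensor (J Y) Z p = - h_tensor Y (J Z) p" by (rule hh_J[OF assms(2,3)])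
  show "koszul (fscale u X) Y Z p = u p * koszul X Y Z p"
    using assms by (simp add: koszul_def JP hh_fun dbar2_fscale_left XM_all) (simp add: fscale_def algebra_simps)
  show "koszul X (fscale u Y) Z p = u p * koszul X Y Z p + X p u * h_tensor Y Z p"
    using assms c by (simp add: koszul_def JP hh_fun dbar2_fscale_right XM_all) (simp add: field_simps)
  show "koszul X Y (fscale u Z) p = u p * koszul X Y Z p"
    using assms c by (simp add: koszul_def JP hh_fun dbar2_fscale_right XM_all) (simp add: field_simps)
qed

lemma koszul_reeb: "X \<in> XM \<Longrightarrow> Y \<in> XM \<Longrightarrow> koszul X Y reeb p = 0"
proof -
  assume "X \<in> XM" "Y \<in> XM"
  moreover have "h_tensor Z reeb = (\<lambda>p. 0)" if "Z \<in> XM" for Z using that by (simp add: fun_eq_iff hh_reeb)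
  ultimately show ?thesis by (simp add: koszul_def dbar2_reeb hh_zero2 XM_all)
qed

lemma koszul_reeb2: "X \<in> XM \<Longrightarrow> Z \<in> XM \<Longrightarrow> koszul X reeb Z p = 0"
proof -
  assume "X \<in> XM" "Z \<in> XM"
  moreover have "h_tensor reeb Z = (\<lambda>p. 0)" if "Z \<in> XM" for Z using that by (simp add: fun_eq_iff hh_reeb)
  ultimately show ?thesis by (simp add: koszul_def dbar2_reeb J_reeb hh_fun XM_all)
qed

lemma koszul_J:
  assumes "X \<in> XM" "Y \<in> XM" "Z \<in> XM"
  shows "koszul X (J Y) Z p = - koszul X Y (J Z) p"
  using assms by (simp add: koszul_def JP hh_fun hh_J_fun dbar2_J XM_all) (simp add: hh_fun hh_J_fun XM_all field_simps)

text \<open>Under exchange of \<open>Y\<close> and \<open>Z\<close> the first term is symmetric. The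
  term with \<open>J X\<close> is skew because \<open>J\<close> is, and the two \<open>dbar2\<close>
  terms are interchanged with opposite signs.\<close>

lemma koszul_metric:
  assumes "X \<in> XM" "Y \<in> XM" "Z \<in> XM"
  shows "koszul X Y Z p + koszul X Z Y p = X p (h_tensor Y Z)"
proof -
  have s: "h_tensor Z Y = h_tensor Y Z" "h_tensor Z (J Y) = h_tensor (J Y) Z"
    "h_tensor (dbar2 X Z) Y p = h_tensor Y (dbar2 X Z) p" "h_tensor (dbar2 X Y) Z p = h_tensor Z (dbar2 X Y) p"
    using assms by (auto simp: fun_eq_iff XM_all intro: hh_sym)
  show ?thesis using assms by (simp add: koszul_def hh_J_fun[of Z Y] s XM_all) (simp add: field_simps)
qed

lemma koszul_representative:
  assumes "X \<in> XM" "Y \<in> XM"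
  shows "\<exists>V\<in>XM. (\<forall>p. \<theta> p (V p) = 0) \<and> (\<forall>Z\<in>XM. \<forall>p. h_tensor V Z p = koszul X Y Z p)"
proof -
  have lin: "koszul X Y (\<lambda>p f. a p * Z p f + b p * Z' p f) p = a p * koszul X Y Z p + b p * koszul X Y Z' p"
    if "Z \<in> XM" "Z' \<in> XM" "CM a" "CM b" for Z Z' a b p
  proof -
    have "(\<lambda>p f. a p * Z p f + b p * Z' p f) = fscale a Z + fscale b Z'" by (simp add: fscale_def fun_eq_iff)
    then show ?thesis
      using koszul_add(3)[OF assms(1,1,2,2) XM_fscale[OF that(3,1)] XM_fscale[OF that(4,2)]]
        koszul_fscale(3)[OF assms that(1,3)] koszul_fscale(3)[OF assms that(2,4)] by simp
  qed
  obtain L where L: "one_form L" "\<And>Z p. Z \<in> XM \<Longrightarrow> L p (Z p) = koszul X Y Z p"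
    using tensorial_one_form[where \<Lambda> = "koszul X Y", OF CM_koszul[OF assms] lin] by blast
  obtain V where V: "V \<in> XM" "\<And>p v. v \<in> tangent_space p \<Longrightarrow> g p (V p) v = L p v"
    using riesz[OF g_bilinear g_nondegenerate L(1)] by blast
  have gV: "g_metric V Z p = koszul X Y Z p" if "Z \<in> XM" for Z p
    using V(2)[OF XM_tangent[OF that]] L(2)[OF that] by (simp add: g_metric_eq)
  \<comment> \<open>The functional vanishes on the Reeb field, so the representing field is
    horizontal and its products under \<open>g\<close> and \<open>h\<close> coincide.\<close>
  have "\<theta> p (V p) = 0" for p
    using gV[OF reeb(1), of p] koszul_reeb[OF assms] V(1) by (simp add: g_metric_def hh_reeb reeb(2))
  with gV V(1) show ?thesis by (intro bexI[of _ V]) (auto simp: g_metric_def)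
qed

text \<open>The vertical term is forced by preserving \<open>H\<close> and annihilating \<xi>. The
  restricted abstractions make the map extensional, as the function space in
  \<open>linear_connection\<close> demands.\<close>

definition canonical :: "'a vfield \<Rightarrow> 'a vfield \<Rightarrow> 'a vfield" where
  "canonical = (\<lambda>X\<in>XM. \<lambda>Y\<in>XM.
     (SOME V. V \<in> XM \<and> (\<forall>p. \<theta> p (V p) = 0) \<and> (\<forall>Z\<in>XM. \<forall>p. h_tensor V Z p = koszul X Y Z p))
     + fscale (\<lambda>p. X p (th Y)) reeb)"

lemma canonical_props:
  assumes "X \<in> XM" "Y \<in> XM"
  shows "canonical X Y \<in> XM"
    and "\<theta> p (canonical X Y p) = X p (th Y)"
    and "\<And>Z. Z \<in> XM \<Longrightarrow> h_tensor (canonical X Y) Z p = koszul X Y Z p"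
proof -
  define V where "V = (SOME V. V \<in> XM \<and> (\<forall>p. \<theta> p (V p) = 0) \<and> (\<forall>Z\<in>XM. \<forall>p. h_tensor V Z p = koszul X Y Z p))"
  have "\<exists>V. V \<in> XM \<and> (\<forall>p. \<theta> p (V p) = 0) \<and> (\<forall>Z\<in>XM. \<forall>p. h_tensor V Z p = koszul X Y Z p)"
    using koszul_representative[OF assms] by auto
  then have V: "V \<in> XM \<and> (\<forall>p. \<theta> p (V p) = 0) \<and> (\<forall>Z\<in>XM. \<forall>p. h_tensor V Z p = koszul X Y Z p)"
    unfolding V_def by (rule someI_ex)
  have D: "canonical X Y = V + fscale (\<lambda>p. X p (th Y)) reeb"
    using assms by (simp add: canonical_def V_def)
  have u: "CM (\<lambda>p. X p (th Y))" using assms by (simp add: XM_all)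
  show "canonical X Y \<in> XM" using V u by (simp add: D XM_rules)
  show "\<theta> p (canonical X Y p) = X p (th Y)"
    unfolding D using V u th_add[of V "fscale (\<lambda>p. X p (th Y)) reeb" p] th_fscale[OF reeb(1), of p "\<lambda>p. X p (th Y)"]
    by (simp add: XM_rules reeb(2))
  show "h_tensor (canonical X Y) Z p = koszul X Y Z p" if "Z \<in> XM" for Z
    unfolding D using V u that by (simp add: hh_add hh_fscale hh_reeb XM_rules)
qed

section \<open>Unitary connections and their torsion in real terms\<close>

text \<open>The real form of a pseudo-Hermitian connection: preservation of \<open>H10\<close> and
  \<open>H01\<close> becomes commutation with \<open>J\<close>, and the clause on \<theta> separates
  the vertical part, so that only the metric condition for \<open>h\<close> remains.\<close>

definition unitary_connection :: "('a vfield \<Rightarrow> 'a vfield \<Rightarrow> 'a vfield) \<Rightarrow> bool" where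
  "unitary_connection D \<longleftrightarrow> linear_connection D \<and>
     (\<forall>X\<in>XM. \<forall>Y\<in>XM. D X (J Y) = J (D X Y) \<and> (\<forall>p. \<theta> p (D X Y p) = X p (th Y))) \<and>
     (\<forall>X\<in>XM. D X reeb = 0) \<and>
     (\<forall>X\<in>XM. \<forall>Y\<in>XM. \<forall>Z\<in>XM. \<forall>p. X p (h_tensor Y Z) = h_tensor (D X Y) Z p + h_tensor Y (D X Z) p)"

lemma
  assumes "linear_connection D" "X \<in> XM" "Y \<in> XM"
  shows lc_XM: "D X Y \<in> XM"
    and lc_add: "\<And>X'. X' \<in> XM \<Longrightarrow> D (X + X') Y = D X Y + D X' Y" "\<And>Y'. Y' \<in> XM \<Longrightarrow> D X (Y + Y') = D X Y + D X Y'"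
    and lc_fscale: "\<And>u. CM u \<Longrightarrow> D (fscale u X) Y = fscale u (D X Y)"
      "\<And>u. CM u \<Longrightarrow> D X (fscale u Y) = fscale (\<lambda>p. X p u) Y + fscale u (D X Y)"
  using assms unfolding linear_connection_def by (auto simp: PiE_iff)

lemma lc_minus:
  assumes D: "linear_connection D" and X: "X \<in> XM" "Y \<in> XM"
  shows "D (- X) Y = - D X Y" "D X (- Y) = - D X Y" "D 0 Y = 0" "D X 0 = 0"
proof -
  have e: "- Z = fscale (\<lambda>p. -1) Z" "0 = fscale (\<lambda>p. 0) Z" for Z :: "'a vfield" by (simp_all add: fscale_def fun_eq_iff)
  show "D (- X) Y = - D X Y" using lc_fscale(1)[OF D X smooth_fun_const, of "-1"] by (simp only: e(1)[symmetric])
  have "fscale (\<lambda>p. X p (\<lambda>p. c)) Y = 0" for c using X by (simp add: XM_const fscale_def fun_eq_iff)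
  then have r: "D X (fscale (\<lambda>p. c) Y) = fscale (\<lambda>p. c) (D X Y)" for c
    using lc_fscale(2)[OF D X smooth_fun_const, of c] by simp
  from r[of "-1"] show "D X (- Y) = - D X Y" by (simp only: e(1)[symmetric])
  from r[of 0] show "D X 0 = 0" by (simp only: e(2)[symmetric])
  show "D 0 Y = 0" using lc_fscale(1)[OF D X smooth_fun_const, of 0] by (simp only: e(2)[symmetric])
qed

lemma canonical_linear: "linear_connection canonical"
  unfolding linear_connection_def
proof (intro conjI ballI allI impI)
  show "canonical \<in> XM \<rightarrow>\<^sub>E XM \<rightarrow>\<^sub>E XM"
  proof (rule PiE_I)
    fix X assume X: "X \<in> XM"
    show "canonical X \<in> XM \<rightarrow>\<^sub>E XM"
      by (rule PiE_I) (use canonical_props(1)[OF X] X in \<open>auto simp: canonical_def\<close>)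
  qed (simp add: canonical_def)
next
  fix X Y Z assume v: "X \<in> XM" "Y \<in> XM" "Z \<in> XM"
  note c = v XM_add[OF v(1,2)] XM_add[OF v(2,3)]
  show "canonical (X + Y) Z = canonical X Z + canonical Y Z"
    by (rule field_eqI) (use v in \<open>simp_all only: canonical_props XM_closed th_add hh_add koszul_add(1)[where Y' = Z and Z' = Z]\<close>, simp)
  have thf: "th (Y + Z) = (\<lambda>p. th Y p + th Z p)" using v by (simp add: fun_eq_iff th_add del: plus_fun_apply)
  show "canonical X (Y + Z) = canonical X Y + canonical X Z"
    by (rule field_eqI)
      (use v in \<open>simp_all only: canonical_props XM_closed th_add hh_add thf XM_der_add[OF v(1) CM_th[OF v(2)] CM_th[OF v(3)]] koszul_add(2)[where X' = X and Z' = X]\<close>)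
next
  fix X Y u assume v: "X \<in> XM" "Y \<in> XM" and u: "CM u"
  show "canonical (fscale u X) Y = fscale u (canonical X Y)"
    by (rule field_eqI)
      (use v u in \<open>simp_all add: canonical_props XM_closed th_fscale hh_fscale koszul_fscale\<close>, simp add: fscale_def)
  have thf: "th (fscale u Y) = (\<lambda>p. u p * th Y p)" using v by (simp add: fun_eq_iff th_fscale)
  note w = canonical_props(1)[OF v] XM_fscale[OF u v(2)] XM_fscale[OF XM_smooth[OF v(1) u] v(2)] XM_fscale[OF u canonical_props(1)[OF v]]
  show "canonical X (fscale u Y) = fscale (\<lambda>p. X p u) Y + fscale u (canonical X Y)"
  proof (rule field_eqI)
    show "\<theta> p (canonical X (fscale u Y) p) =
        \<theta> p ((fscale (\<lambda>p. X p u) Y + fscale u (canonical X Y)) p)" for p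
      unfolding canonical_props(2)[OF v(1) w(2)] thf XM_der_mult[OF v(1) u CM_th[OF v(2)]] th_add[OF w(3,4)]
        th_fscale[OF v(2)] th_fscale[OF w(1)] canonical_props(2)[OF v] by simp
    show "h_tensor (canonical X (fscale u Y)) Z p =
        h_tensor (fscale (\<lambda>p. X p u) Y + fscale u (canonical X Y)) Z p" if "Z \<in> XM" for Z p
      unfolding canonical_props(3)[OF v(1) w(2) that] hh_add[OF w(3,4) that] hh_fscale[OF v(2) that] hh_fscale[OF w(1) that]
        canonical_props(3)[OF v that] koszul_fscale(2)[OF v that u] by simp
  qed (rule canonical_props(1)[OF v(1) w(2)] XM_add[OF w(3,4)])+
qed

lemma canonical_unitary: "unitary_connection canonical"
  unfolding unitary_connection_def
proof (intro conjI ballI allI canonical_linear)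
  fix X Y assume v: "X \<in> XM" "Y \<in> XM"
  have thf: "th (J Y) = (\<lambda>p. 0)" using v by (simp add: fun_eq_iff th_J)
  show "canonical X (J Y) = J (canonical X Y)"
    by (rule field_eqI) (use v in \<open>simp_all add: canonical_props XM_J th_J thf XM_const hh_J koszul_J\<close>)
  show "\<theta> p (canonical X Y p) = X p (th Y)" for p by (rule canonical_props(2)[OF v])
next
  fix X assume v: "X \<in> XM"
  have thf: "th reeb = (\<lambda>p. 1)" by (simp add: fun_eq_iff reeb)
  show "canonical X reeb = 0"
    by (rule field_eqI)
      (use v in \<open>simp_all only: canonical_props XM_zero reeb(1) thf XM_const koszul_reeb2 hh_zero th_zero\<close>)
next
  fix X Y Z p assume v: "X \<in> XM" "Y \<in> XM" "Z \<in> XM"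
  show "X p (h_tensor Y Z) = h_tensor (canonical X Y) Z p + h_tensor Y (canonical X Z) p"
    using v koszul_metric[OF v, of p] by (simp add: hh_sym[of Y "canonical X Z"] canonical_props)
qed


lemma
  assumes "unitary_connection D"
  shows uc_linear: "linear_connection D"
    and uc_J: "X \<in> XM \<Longrightarrow> Y \<in> XM \<Longrightarrow> D X (J Y) = J (D X Y)"
    and uc_th: "X \<in> XM \<Longrightarrow> Y \<in> XM \<Longrightarrow> \<theta> p (D X Y p) = X p (th Y)"
    and uc_reeb: "X \<in> XM \<Longrightarrow> D X reeb = 0"
    and uc_metric: "X \<in> XM \<Longrightarrow> Y \<in> XM \<Longrightarrow> Z \<in> XM \<Longrightarrow>
      X p (h_tensor Y Z) = h_tensor (D X Y) Z p + h_tensor Y (D X Z) p"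
  using assms unfolding unitary_connection_def by blast+

text \<open>\<open>PH\<close> is minus the square of \<open>J\<close>, so commuting with
  \<open>J\<close> is enough.\<close>

lemma uc_PH:
  assumes D: "unitary_connection D" and v: "X \<in> XM" "Y \<in> XM"
  shows "D X (PH Y) = PH (D X Y)"
proof -
  note l = uc_linear[OF D]
  have "D X (J (J Y)) = J (J (D X Y))" using v by (simp add: uc_J[OF D] XM_J)
  then have "- D X (PH Y) = - PH (D X Y)" using v by (simp add: J_J lc_minus[OF l] lc_XM[OF l] XM_PH)
  then show ?thesis by simp
qed

text \<open>The operator \<open>2 Q\<^sub>X Y\<close>, to be compared with \<^const>\<open>dbar2\<close>.\<close>

definition conn2 :: "('a vfield \<Rightarrow> 'a vfield \<Rightarrow> 'a vfield) \<Rightarrow> 'a vfield \<Rightarrow> 'a vfield \<Rightarrow> 'a vfield" where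
  "conn2 D X Y = fscale (\<lambda>_. 2) (D X Y + J (D (J X) Y))"

lemma XM_conn2: "linear_connection D \<Longrightarrow> X \<in> XM \<Longrightarrow> Y \<in> XM \<Longrightarrow> conn2 D X Y \<in> XM"
  by (simp add: conn2_def XM_rules lc_XM)

text \<open>The bracket of \<xi> with a multiple of \<xi> is again a multiple of \<xi>, which
  \<open>J\<close> annihilates.\<close>

lemma bracket_reeb_PH:
  assumes "X \<in> XM"
  shows "J (lie_bracket reeb (PH X)) = J (lie_bracket reeb X)"
proof -
  have r: "lie_bracket reeb reeb = 0" by (simp add: lie_bracket_def fun_eq_iff)
  have "J (lie_bracket reeb (PH X + fscale (th X) reeb)) = J (lie_bracket reeb (PH X))"
    using assms by (simp add: br JP XM_rules r)
  then show ?thesis using PH_split[of X] by simp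
qed

text \<open>The left side is twice the real part of the (1,0) part of the torsion of
  \<open>A - \<i> J A\<close> and \<open>B + \<i> J B\<close>. Since \<open>D\<close> commutes with
  \<open>J\<close>, the derivatives along \<open>A\<close> and \<open>J A\<close> cancel; those
  along \<open>B\<close> and \<open>J B\<close> form \<open>conn2\<close>, and the brackets form
  \<open>dbar2\<close>.\<close>

lemma torsion11:
  assumes D: "unitary_connection D" and v: "A \<in> XM" "B \<in> XM" "PH A = A" "PH B = B"
  shows "PH (torsion D A B + torsion D (J A) (J B)) + J (torsion D A (J B) - torsion D (J A) B) = dbar2 B A - conn2 D B A"
proof -
  note l = uc_linear[OF D]
  have s: "lie_bracket A B = - lie_bracket B A" "lie_bracket (J A) (J B) = - lie_bracket (J B) (J A)"
    "lie_bracket A (J B) = - lie_bracket (J B) A" "lie_bracket (J A) B = - lie_bracket B (J A)"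
    by (rule bracket_swap)+
  have p: "PH (D X A) = D X A" "PH (D X B) = D X B" if "X \<in> XM" for X
    using uc_PH[OF D that v(1)] uc_PH[OF D that v(2)] v by simp_all
  show ?thesis
    using v unfolding torsion_def s dbar2_def conn2_def
    by (simp only: uc_J[OF D] JP XM_rules lc_XM[OF l] p fscale_add) (simp add: fun_eq_iff fscale_def)
qed

text \<open>Because \<open>D X reeb = 0\<close>, the torsion with \<xi> is \<open>D reeb X\<close>
  minus a bracket, and \<open>J reeb = 0\<close> leaves just the brackets with \<xi> in
  \<open>dbar2\<close>. So \<sigma> is, up to projection, \<open>J\<close> applied to the difference
  of \<open>conn2\<close> and \<open>dbar2\<close> along \<xi>.\<close>

lemma sigma_eq:
  assumes D: "unitary_connection D" and X: "X \<in> XM"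
  shows "PH (\<sigma> D X) = J (fscale (\<lambda>_. 2) (D reeb X) - dbar2 reeb X)" "\<sigma> D X \<in> XM"
proof -
  note l = uc_linear[OF D]
  show "\<sigma> D X \<in> XM" using X by (simp add: \<sigma>_def \<tau>_def torsion_def XM_rules lc_XM[OF l])
  show "PH (\<sigma> D X) = J (fscale (\<lambda>_. 2) (D reeb X) - dbar2 reeb X)"
    using X unfolding \<sigma>_def \<tau>_def torsion_def dbar2_def
    by (simp only: uc_J[OF D] uc_reeb[OF D] JP XM_rules lc_XM[OF l] bracket_zero add_0_right bracket_reeb_PH)
      (simp add: fun_eq_iff fscale_def)
qed

text \<open>\<open>J\<close> is moved to the other argument. As \<sigma> is \<open>J\<close> times
  an operator commuting with \<open>J\<close>, its skewness is thereby turned into self-adjointness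
  of that operator.\<close>

lemma hh_sigma:
  assumes D: "unitary_connection D" and v: "X \<in> XM" "Y \<in> XM"
  shows "h_tensor (\<sigma> D X) Y p = - (2 * h_tensor (D reeb X) (J Y) p - h_tensor (dbar2 reeb X) (J Y) p)"
    and "h_tensor Y (\<sigma> D X) p = - (2 * h_tensor (J Y) (D reeb X) p - h_tensor (J Y) (dbar2 reeb X) p)"
proof -
  note l = uc_linear[OF D] and s = sigma_eq[OF D v(1)]
  have m: "D reeb X \<in> XM" "dbar2 reeb X \<in> XM" using v by (simp_all add: lc_XM[OF l] XM_rules XM_dbar2)
  have "h_tensor (\<sigma> D X) Y p = h_tensor (PH (\<sigma> D X)) Y p" by (simp add: hh_PH s(2))
  then show 1: "h_tensor (\<sigma> D X) Y p = - (2 * h_tensor (D reeb X) (J Y) p - h_tensor (dbar2 reeb X) (J Y) p)"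
    using v m by (simp add: s(1) hh_J hh_fscale hh_diff XM_rules)
  show "h_tensor Y (\<sigma> D X) p = - (2 * h_tensor (J Y) (D reeb X) p - h_tensor (J Y) (dbar2 reeb X) p)"
    using 1 v m s(2) by (simp add: hh_sym[of Y] hh_sym[of "J Y"] XM_rules)
qed

text \<open>Compatibility along \<open>J X\<close> for \<open>J Y, Z\<close>, subtracted from that
  along \<open>X\<close> for \<open>Y, Z\<close>, gives the Koszul formula with \<open>conn2\<close>
  in place of \<open>dbar2\<close>. Hence the deviation from \<open>koszul\<close> measures the skew
  part of \<open>conn2 - dbar2\<close>. Both existence and uniqueness use this identity, in opposite
  directions.\<close>

lemma unitary_koszul:
  assumes D: "unitary_connection D" and v: "X \<in> XM" "Y \<in> XM" "Z \<in> XM"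
  shows "4 * (h_tensor (D X Y) Z p - koszul X Y Z p) =
    (h_tensor (conn2 D X Y) Z p - h_tensor (dbar2 X Y) Z p) - (h_tensor Y (conn2 D X Z) p - h_tensor Y (dbar2 X Z) p)"
proof -
  note l = uc_linear[OF D]
  have m: "D X Y \<in> XM" "D X Z \<in> XM" "J (D (J X) Y) \<in> XM" "J (D (J X) Z) \<in> XM" "D (J X) Z \<in> XM"
    using v by (simp_all add: lc_XM[OF l] XM_rules)
  have q: "h_tensor (conn2 D X Y) Z p = 2 * h_tensor (D X Y) Z p + 2 * h_tensor (J (D (J X) Y)) Z p"
    "h_tensor Y (conn2 D X Z) p = 2 * h_tensor Y (D X Z) p + 2 * h_tensor Y (J (D (J X) Z)) p"
    unfolding conn2_def using v m by (simp_all add: hh_add hh_add2 hh_fscale hh_fscale2 XM_add)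
  have "J X p (h_tensor (J Y) Z) = h_tensor (J (D (J X) Y)) Z p + h_tensor (J Y) (D (J X) Z) p"
    using uc_metric[OF D, of "J X" "J Y" Z p] v by (simp add: XM_J uc_J[OF D])
  moreover have "h_tensor (J Y) (D (J X) Z) p = - h_tensor Y (J (D (J X) Z)) p"
    by (rule hh_J[OF v(2) m(5)])
  ultimately show ?thesis
    using uc_metric[OF D v, of p] by (simp add: q koszul_def field_simps)
qed

section \<open>Uniqueness, and the two conditions for the canonical connection\<close>

text \<open>In both directions the right side of \<open>unitary_koszul\<close> vanishes: along
  \<open>H\<close> because \<open>conn2\<close> equals \<open>dbar2\<close>, along \<xi> because
  their difference is self-adjoint.\<close>

lemma characterization:
  assumes D: "unitary_connection D"
    and T: "\<And>A B. A \<in> XM \<Longrightarrow> B \<in> XM \<Longrightarrow> PH A = A \<Longrightarrow> PH B = B \<Longrightarrow> conn2 D A B = dbar2 A B"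
    and S: "\<And>X Y p. X \<in> XM \<Longrightarrow> Y \<in> XM \<Longrightarrow> h_tensor (\<sigma> D X) Y p = - h_tensor X (\<sigma> D Y) p"
    and v: "X \<in> XM" "Y \<in> XM"
  shows "D X Y = canonical X Y"
proof -
  let ?C = canonical
  note l = uc_linear[OF D] and lC = canonical_linear
  \<comment> \<open>The vertical parts agree in any case and \<open>D\<close> commutes with
    \<open>PH\<close>, so only horizontal second and third arguments need to be compared.\<close>
  have eq: "D X Y = ?C X Y" if X: "X \<in> XM" and Y: "Y \<in> XM"
    and h: "\<And>Z p. Z \<in> XM \<Longrightarrow> h_tensor (D X (PH Y)) (PH Z) p = koszul X (PH Y) (PH Z) p" for X Y
  proof (rule field_eqI[OF lc_XM[OF l X Y] lc_XM[OF lC X Y]])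
    show "\<theta> p (D X Y p) = \<theta> p (?C X Y p)" for p using X Y by (simp add: uc_th[OF D] canonical_props(2))
    fix Z p assume Z: "Z \<in> XM"
    have "koszul X (PH Y) (PH Z) p = koszul X Y Z p"
      using X Y Z by (simp add: koszul_def dbar2_PH hh_fun JP XM_rules)
    then show "h_tensor (D X Y) Z p = h_tensor (?C X Y) Z p"
      using h[OF Z, of p] X Y Z by (simp add: uc_PH[OF D] hh_PH lc_XM[OF l] canonical_props(3))
  qed
  have horizontal: "D A Y = ?C A Y" if A: "A \<in> XM" "PH A = A" for A
  proof (rule eq[OF A(1) v(2)])
    fix Z p assume Z: "Z \<in> XM"
    show "h_tensor (D A (PH Y)) (PH Z) p = koszul A (PH Y) (PH Z) p"
      using unitary_koszul[OF D A(1) XM_PH[OF v(2)] XM_PH[OF Z], of p] T[OF A(1) XM_PH[OF v(2)] A(2) PH_PH[OF v(2)]]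
        T[OF A(1) XM_PH[OF Z] A(2) PH_PH[OF Z]] by simp
  qed
  have vertical: "D reeb Y = ?C reeb Y"
  proof (rule eq[OF reeb(1) v(2)])
    fix Z p assume Z: "Z \<in> XM"
    have Q: "conn2 D reeb W = fscale (\<lambda>_. 2) (D reeb W)" if "W \<in> XM" for W
      using that by (simp add: conn2_def J_reeb J_zero lc_minus[OF l] reeb(1))
    \<comment> \<open>\<open>hh_sigma\<close> places a \<open>J\<close> on the test field, so
      \<sigma> is tested against \<open>- J Z\<close> in order to reach \<open>PH Z\<close>.\<close>
    have JJ: "J (- J Z) = PH Z" "- J Z \<in> XM" using Z by (simp_all add: JP XM_rules)
    have m: "D reeb (PH Y) \<in> XM" "D reeb (PH Z) \<in> XM" "D reeb (- J Z) \<in> XM" "dbar2 reeb (- J Z) \<in> XM"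
      using v Z by (simp_all add: lc_XM[OF l] XM_rules XM_dbar2)
    have "D reeb (PH Z) = J (D reeb (- J Z))" "dbar2 reeb (PH Z) = J (dbar2 reeb (- J Z))"
      using uc_J[OF D reeb(1) JJ(2)] dbar2_J[OF reeb(1) JJ(2)] by (simp_all add: JJ)
    then have c: "h_tensor (PH Y) (D reeb (PH Z)) p = - h_tensor (J (PH Y)) (D reeb (- J Z)) p"
      "h_tensor (PH Y) (dbar2 reeb (PH Z)) p = - h_tensor (J (PH Y)) (dbar2 reeb (- J Z)) p"
      using hh_J[OF XM_PH[OF v(2)] m(3), of p] hh_J[OF XM_PH[OF v(2)] m(4), of p] by simp_all
    have "2 * h_tensor (D reeb (PH Y)) (PH Z) p - h_tensor (dbar2 reeb (PH Y)) (PH Z) p =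
        2 * h_tensor (PH Y) (D reeb (PH Z)) p - h_tensor (PH Y) (dbar2 reeb (PH Z)) p"
      using S[OF XM_PH[OF v(2)] JJ(2), of p] hh_sigma(1)[OF D XM_PH[OF v(2)] JJ(2), of p]
        hh_sigma(2)[OF D JJ(2) XM_PH[OF v(2)], of p] unfolding JJ(1) c by linarith
    then show "h_tensor (D reeb (PH Y)) (PH Z) p = koszul reeb (PH Y) (PH Z) p"
      using unitary_koszul[OF D reeb(1) XM_PH[OF v(2)] XM_PH[OF Z], of p] v Z m
      by (simp add: Q XM_PH hh_fscale hh_fscale2)
  qed
  \<comment> \<open>Function-linearity in the first argument combines the horizontal and the
    vertical case.\<close>
  have X: "X = PH X + fscale (th X) reeb" by (rule PH_split)
  have split: "E X Y = E (PH X) Y + fscale (th X) (E reeb Y)" if "linear_connection E" for E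
    using lc_add(1)[OF that XM_PH[OF v(1)] v(2) XM_fscale[OF CM_th[OF v(1)] reeb(1)]]
      lc_fscale(1)[OF that reeb(1) v(2) CM_th[OF v(1)]] X by simp
  show ?thesis
    unfolding split[OF l] split[OF lC] vertical horizontal[OF XM_PH[OF v(1)] PH_PH[OF v(1)]] ..
qed

text \<open>For the canonical connection the left side of \<open>unitary_koszul\<close> is 0, which
  gives the self-adjointness along \<xi>; evaluating it at \<open>J Y\<close> returns to
  \<sigma>.\<close>

lemma canonical_sigma:
  assumes v: "X \<in> XM" "Y \<in> XM"
  shows "h_tensor (\<sigma> canonical X) Y p = - h_tensor X (\<sigma> canonical Y) p"
proof -
  let ?D = canonical
  note D = canonical_unitary and l = canonical_linear
  have sym: "2 * h_tensor (?D reeb X) W p - h_tensor (dbar2 reeb X) W p = 2 * h_tensor X (?D reeb W) p - h_tensor X (dbar2 reeb W) p"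
    if W: "W \<in> XM" for W
  proof -
    have Q: "conn2 ?D reeb V = fscale (\<lambda>_. 2) (?D reeb V)" if "V \<in> XM" for V
      using that by (simp add: conn2_def J_reeb J_zero lc_minus[OF l] reeb(1))
    show ?thesis
      using unitary_koszul[OF D reeb(1) v(1) W, of p] canonical_props(3)[OF reeb(1) v(1) W, of p] v W
      by (simp add: Q hh_fscale hh_fscale2 lc_XM[OF l] reeb(1))
  qed
  have "h_tensor X (J (?D reeb Y)) p = - h_tensor (J X) (?D reeb Y) p" "h_tensor X (J (dbar2 reeb Y)) p = - h_tensor (J X) (dbar2 reeb Y) p"
    using v by (simp_all add: hh_J lc_XM[OF l] reeb(1) XM_dbar2)
  then show ?thesis
    using sym[OF XM_J[OF v(2)]] hh_sigma(1)[OF D v, of p] hh_sigma(2)[OF D v(2,1), of p] v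
    by (simp add: uc_J[OF D] dbar2_J reeb(1))
qed

lemma canonical_conn2:
  assumes v: "X \<in> XM" "Y \<in> XM" and H: "PH X = X" "PH Y = Y"
  shows "conn2 canonical X Y = dbar2 X Y"
proof -
  let ?D = canonical
  note D = canonical_unitary and l = canonical_linear
  define N where "N X Y = conn2 ?D X Y - dbar2 X Y" for X Y
  have NX: "N X Y \<in> XM" if "X \<in> XM" "Y \<in> XM" for X Y
    using that by (simp add: N_def XM_diff XM_conn2[OF l] XM_dbar2)
  have sym: "h_tensor (N A B) C p = h_tensor B (N A C) p" if "A \<in> XM" "B \<in> XM" "C \<in> XM" for A B C p
    using unitary_koszul[OF D that, of p] canonical_props(3)[OF that, of p] that
    by (simp add: N_def hh_diff hh_diff2 XM_conn2[OF l] XM_dbar2)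
  have NJ: "N X (J Z) = J (N X Z)" if "Z \<in> XM" for Z
    using v that by (simp add: N_def conn2_def uc_J[OF D] JP dbar2_J XM_rules lc_XM[OF l] XM_dbar2)
  have JN: "N (J X) Z = - J (N X Z)" if "Z \<in> XM" "PH Z = Z" for Z
  proof -
    have "PH (?D (J X) Z) = ?D (J X) Z" using uc_PH[OF D XM_J[OF v(1)] that(1)] that(2) by simp
    then show ?thesis
      using v H that by (simp add: N_def conn2_def JP dbar2_J_left XM_rules lc_XM[OF l] lc_minus[OF l] XM_dbar2)
        (simp add: fun_eq_iff fscale_def)
  qed
  \<comment> \<open>The chain equates the pairing with its own negative, using the symmetry once for
    \<open>J X\<close> and once for \<open>X\<close>.\<close>
  have z: "h_tensor (J (N X Y)) Z p = 0" if Z: "Z \<in> XM" "PH Z = Z" for Z p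
  proof -
    note JX = XM_J[OF v(1)]
    have "- h_tensor (J (N X Y)) Z p = h_tensor (N (J X) Y) Z p"
      using JN[OF v(2) H(2)] NX[OF v] Z by (simp add: hh_minus XM_J)
    also have "\<dots> = h_tensor Y (N (J X) Z) p" by (rule sym[OF JX v(2) Z(1)])
    also have "\<dots> = - h_tensor Y (N X (J Z)) p"
      using JN[OF Z] NJ[OF Z(1)] NX[OF v(1) Z(1)] v by (simp add: hh_minus2 XM_J)
    also have "\<dots> = - h_tensor (N X Y) (J Z) p" using sym[OF v XM_J[OF Z(1)]] by simp
    also have "\<dots> = h_tensor (J (N X Y)) Z p" using hh_J[OF NX[OF v] Z(1)] by simp
    finally show ?thesis by simp
  qed
  have "N X Y = 0"
  proof (rule field_eqI[OF NX[OF v] XM_zero])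
    have "PH (N X Y) = N X Y"
      using uc_PH[OF D v] uc_PH[OF D XM_J[OF v(1)] v(2)] v H
      by (simp add: N_def conn2_def PH_dbar2 JP XM_rules lc_XM[OF l] XM_dbar2)
    then show "\<theta> p (N X Y p) = \<theta> p ((0 :: 'a vfield) p)" for p
      using th_PH[OF NX[OF v], of p] by (simp only: th_zero)
    fix Z p assume Z: "Z \<in> XM"
    have "h_tensor (N X Y) Z p = h_tensor (J (N X Y)) (J Z) p" using hh_JJ[OF NX[OF v] Z] by simp
    also have "\<dots> = 0" by (rule z[OF XM_J[OF Z] PH_J[OF Z]])
    finally show "h_tensor (N X Y) Z p = h_tensor 0 Z p" using Z by (simp add: hh_zero)
  qed
  then show ?thesis by (simp add: N_def)
qed

section \<open>Translation between complex and real fields\<close>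

definition cf :: "'a vfield \<Rightarrow> 'a vfield \<Rightarrow> 'a cvfield" where
  "cf A B = (\<lambda>p f. Complex (A p f) (B p f))"

lemma cf_simps [simp]: "Re_field (cf A B) = A" "Im_field (cf A B) = B" "cf 0 0 = 0"
  by (simp_all add: cf_def Re_field_def Im_field_def fun_eq_iff zero_complex.code)

lemma cf_Re_Im: "cf (Re_field Z) (Im_field Z) = Z"
  by (simp add: cf_def Re_field_def Im_field_def)

lemma cf_inject: "cf A B = cf A' B' \<longleftrightarrow> A = A' \<and> B = B'"
  by (metis cf_simps(1,2))

lemma cf_in_cvfields: "cf A B \<in> cvfields UNIV \<longleftrightarrow> A \<in> XM \<and> B \<in> XM"
  by (simp add: cvfields_def)

lemma sections_H10: "Z \<in> sections UNIV H10 \<longleftrightarrow> (\<exists>C\<in>XM. PH C = C \<and> Z = cf C (- J C))"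
proof
  assume "Z \<in> sections UNIV H10"
  then have Z: "Re_field Z \<in> XM" "\<And>p. Z p \<in> H10 p" by (auto simp: sections_def cvfields_def)
  have "Re_field Z p \<in> H p \<and> Im_field Z p = (\<lambda>f. - Jb p (Re_field Z p) f)" for p
    using Z(2)[of p] by (auto simp: H10_iff Re_field_def Im_field_def)
  then have "PH (Re_field Z) = Re_field Z" "Im_field Z = - J (Re_field Z)"
    by (auto simp: PH_idI J_eq Jt_H fun_eq_iff)
  then show "\<exists>C\<in>XM. PH C = C \<and> Z = cf C (- J C)" using Z(1) cf_Re_Im[of Z] by metis
next
  assume "\<exists>C\<in>XM. PH C = C \<and> Z = cf C (- J C)"
  then obtain C where C: "C \<in> XM" "PH C = C" "Z = cf C (- J C)" by blast
  have "C p \<in> H p" for p using XM_H(1)[OF C(1), of p] C(2) by simp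
  then have "Z p \<in> H10 p" for p
    unfolding H10_iff by (intro bexI[of _ "C p"]) (simp_all add: C(3) cf_def J_eq Jt_H)
  moreover have "Z \<in> cvfields UNIV" using C by (simp add: cf_in_cvfields XM_rules)
  ultimately show "Z \<in> sections UNIV H10" by (simp add: sections_def)
qed

lemma sections_H01: "Z \<in> sections UNIV H01 \<longleftrightarrow> (\<exists>C\<in>XM. PH C = C \<and> Z = cf C (J C))"
proof
  assume "Z \<in> sections UNIV H01"
  then have Z: "Re_field Z \<in> XM" "\<And>p. Z p \<in> H01 p" by (auto simp: sections_def cvfields_def)
  have "Re_field Z p \<in> H p \<and> Im_field Z p = (\<lambda>f. Jb p (Re_field Z p) f)" for p
    using Z(2)[of p] by (auto simp: H01_iff Re_field_def Im_field_def)
  then have "PH (Re_field Z) = Re_field Z" "Im_field Z = J (Re_field Z)"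
    by (auto simp: PH_idI J_eq Jt_H fun_eq_iff)
  then show "\<exists>C\<in>XM. PH C = C \<and> Z = cf C (J C)" using Z(1) cf_Re_Im[of Z] by metis
next
  assume "\<exists>C\<in>XM. PH C = C \<and> Z = cf C (J C)"
  then obtain C where C: "C \<in> XM" "PH C = C" "Z = cf C (J C)" by blast
  have "C p \<in> H p" for p using XM_H(1)[OF C(1), of p] C(2) by simp
  then have "Z p \<in> H01 p" for p
    unfolding H01_iff by (intro bexI[of _ "C p"]) (simp_all add: C(3) cf_def J_eq Jt_H)
  moreover have "Z \<in> cvfields UNIV" using C by (simp add: cf_in_cvfields XM_rules)
  ultimately show "Z \<in> sections UNIV H01" by (simp add: sections_def)
qed

text \<open>Membership in the line gives coefficients point by point; applying \<theta> to the real
  and imaginary parts recovers them as smooth functions.\<close>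

lemma sections_reeb:
  "Z \<in> sections UNIV reeb_line \<longleftrightarrow> (\<exists>a b. CM a \<and> CM b \<and> Z = cf (fscale a reeb) (fscale b reeb))"
proof
  assume "Z \<in> sections UNIV reeb_line"
  then have Z: "Re_field Z \<in> XM" "Im_field Z \<in> XM" "\<And>p. Z p \<in> reeb_line p"
    by (auto simp: sections_def cvfields_def)
  have "\<exists>c. Re_field Z p = (\<lambda>f. Re c * reeb p f) \<and> Im_field Z p = (\<lambda>f. Im c * reeb p f)" for p
    using Z(3)[of p] by (auto simp: reeb_line_def cplx_def Re_field_def Im_field_def)
  then obtain c where c: "\<And>p. Re_field Z p = (\<lambda>f. Re (c p) * reeb p f)" "\<And>p. Im_field Z p = (\<lambda>f. Im (c p) * reeb p f)"
    by metis
  have t: "\<theta> p (Re_field Z p) = Re (c p)" "\<theta> p (Im_field Z p) = Im (c p)" for p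
    using lin_on_scale[OF theta_lin reeb_tangent, of p] by (simp_all add: c reeb(2))
  have "Re_field Z = fscale (th (Re_field Z)) reeb" "Im_field Z = fscale (th (Im_field Z)) reeb"
    unfolding fscale_def t by (simp_all add: c fun_eq_iff)
  then show "\<exists>a b. CM a \<and> CM b \<and> Z = cf (fscale a reeb) (fscale b reeb)"
    using CM_th[OF Z(1)] CM_th[OF Z(2)] cf_Re_Im[of Z] by metis
next
  assume "\<exists>a b. CM a \<and> CM b \<and> Z = cf (fscale a reeb) (fscale b reeb)"
  then obtain a b where ab: "CM a" "CM b" "Z = cf (fscale a reeb) (fscale b reeb)" by blast
  have "Z p \<in> reeb_line p" for p
    unfolding reeb_line_def
    by (intro CollectI exI[of _ "Complex (a p) (b p)"]) (simp add: ab cf_def fscale_def cplx_def fun_eq_iff complex_eq_iff)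
  then show "Z \<in> sections UNIV reeb_line" using ab by (simp add: sections_def cf_in_cvfields XM_rules)
qed

lemma cbilinear_cf: "cbilinear T (cf A B) (cf A' B') = cf (T A A' - T B B') (T A B' + T B A')"
  by (simp add: cbilinear_def) (simp add: cf_def)

lemma cbilinear_connection:
  assumes "linear_connection D" "A \<in> XM" "B \<in> XM"
  shows "cbilinear D (\<lambda>p. cplx (X p)) (cf A B) = cf (D X A) (D X B)"
proof -
  have "(\<lambda>p. cplx (X p)) = cf X 0" by (simp add: cf_def cplx_def complex_of_real_def fun_eq_iff)
  then show ?thesis
    using lc_minus(3)[OF assms(1) assms(2) assms(2)] lc_minus(3)[OF assms(1) assms(3) assms(3)]
    by (simp add: cbilinear_cf)
qed

lemma unitary_imp_pseudo_hermitian: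
  assumes D: "unitary_connection D"
  shows "pseudo_hermitian_connection D"
  unfolding pseudo_hermitian_connection_def preserves_def
proof (intro conjI ballI allI)
  note l = uc_linear[OF D]
  show "linear_connection D" by (rule l)
  fix X assume X: "X \<in> XM"
  {
    fix Z assume "Z \<in> sections UNIV H10"
    then obtain C where C: "C \<in> XM" "PH C = C" "Z = cf C (- J C)" by (auto simp: sections_H10)
    have "cbilinear D (\<lambda>p. cplx (X p)) Z = cf (D X C) (- J (D X C))"
      using X C by (simp add: cbilinear_connection[OF l] XM_rules lc_minus[OF l] uc_J[OF D])
    moreover have "PH (D X C) = D X C" using uc_PH[OF D X C(1)] C(2) by simp
    ultimately show "cbilinear D (\<lambda>p. cplx (X p)) Z \<in> sections UNIV H10"
      using lc_XM[OF l X C(1)] by (auto simp: sections_H10)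
  next
    fix Z assume "Z \<in> sections UNIV H01"
    then obtain C where C: "C \<in> XM" "PH C = C" "Z = cf C (J C)" by (auto simp: sections_H01)
    have "cbilinear D (\<lambda>p. cplx (X p)) Z = cf (D X C) (J (D X C))"
      using X C by (simp add: cbilinear_connection[OF l] XM_rules uc_J[OF D])
    moreover have "PH (D X C) = D X C" using uc_PH[OF D X C(1)] C(2) by simp
    ultimately show "cbilinear D (\<lambda>p. cplx (X p)) Z \<in> sections UNIV H01"
      using lc_XM[OF l X C(1)] by (auto simp: sections_H01)
  next
    fix Z assume "Z \<in> sections UNIV reeb_line"
    then obtain a b where ab: "CM a" "CM b" "Z = cf (fscale a reeb) (fscale b reeb)" by (auto simp: sections_reeb)
    have "cbilinear D (\<lambda>p. cplx (X p)) Z = cf (fscale (\<lambda>p. X p a) reeb) (fscale (\<lambda>p. X p b) reeb)"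
      using X ab by (simp add: cbilinear_connection[OF l] XM_rules lc_fscale[OF l] uc_reeb[OF D])
    then show "cbilinear D (\<lambda>p. cplx (X p)) Z \<in> sections UNIV reeb_line"
      using XM_smooth[OF X ab(1)] XM_smooth[OF X ab(2)] unfolding sections_reeb by blast
  next
    fix Y Z p assume v: "Y \<in> XM" "Z \<in> XM"
    have "X p (g_metric Y Z) = X p (\<lambda>p. h_tensor Y Z p + th Y p * th Z p)" by (simp add: g_metric_def[abs_def])
    also have "\<dots> = X p (h_tensor Y Z) + X p (\<lambda>p. th Y p * th Z p)"
      by (rule XM_der_add[OF X CM_hh[OF v]]) (intro smooth_fun_mult open_UNIV CM_th v)
    also have "X p (\<lambda>p. th Y p * th Z p) = th Y p * X p (th Z) + th Z p * X p (th Y)"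
      by (rule XM_der_mult[OF X CM_th[OF v(1)] CM_th[OF v(2)]])
    finally show "X p (g_metric Y Z) = g_metric (D X Y) Z p + g_metric Y (D X Z) p"
      using X v by (simp add: g_metric_def uc_metric[OF D] uc_th[OF D])
  }
qed

text \<open>Applied to sections \<open>C - \<i> J C\<close>, preservation of \<open>H10\<close> says
  that \<open>D X C\<close> is horizontal and that \<open>D\<close> commutes with \<open>J\<close>
  there. Splitting off the \<xi> component extends this to all fields.\<close>

lemma pseudo_hermitian_imp_unitary:
  assumes "pseudo_hermitian_connection D"
  shows "unitary_connection D"
proof -
  have l: "linear_connection D" and p10: "preserves D H10" and pr: "preserves D reeb_line"
    and met: "\<And>X Y Z p. X \<in> XM \<Longrightarrow> Y \<in> XM \<Longrightarrow> Z \<in> XM \<Longrightarrow>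
       X p (g_metric Y Z) = g_metric (D X Y) Z p + g_metric Y (D X Z) p"
    using assms unfolding pseudo_hermitian_connection_def by blast+
  have reeb0: "D X reeb = 0" if X: "X \<in> XM" for X
  proof -
    have "cf (fscale (\<lambda>p. 1) reeb) (fscale (\<lambda>p. 0) reeb) \<in> sections UNIV reeb_line"
      unfolding sections_reeb using smooth_fun_const by blast
    moreover have "fscale (\<lambda>p. 1) reeb = reeb" "fscale (\<lambda>p. 0) reeb = 0" by (simp_all add: fscale_def fun_eq_iff)
    ultimately have "cf reeb 0 \<in> sections UNIV reeb_line" by simp
    then have "cbilinear D (\<lambda>p. cplx (X p)) (cf reeb 0) \<in> sections UNIV reeb_line"
      using pr X unfolding preserves_def by blast
    then obtain a where a: "CM a" "D X reeb = fscale a reeb"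
      by (auto simp: cbilinear_connection[OF l reeb(1) XM_zero] sections_reeb cf_inject)
    \<comment> \<open>Preservation of the line gives only a multiple of \<xi>; constancy of its
      length makes the factor vanish.\<close>
    have "g_metric reeb reeb = (\<lambda>p. 1)" by (simp add: fun_eq_iff g_metric_def reeb hh_reeb)
    then have "a p = 0" for p
      using met[OF X reeb(1) reeb(1), of p] X a(1)
      by (simp add: a XM_const g_metric_def hh_reeb hh_fscale hh_fscale2 reeb th_fscale XM_fscale)
    then show ?thesis by (simp add: a fscale_def fun_eq_iff)
  qed
  have hor: "PH (D X C) = D X C" "D X (J C) = J (D X C)" if X: "X \<in> XM" and C: "C \<in> XM" "PH C = C" for X C
  proof -
    have "cf C (- J C) \<in> sections UNIV H10" using C by (auto simp: sections_H10)
    then have "cbilinear D (\<lambda>p. cplx (X p)) (cf C (- J C)) \<in> sections UNIV H10"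
      using p10 X unfolding preserves_def by blast
    then have "cf (D X C) (- D X (J C)) \<in> sections UNIV H10"
      using X C by (simp add: cbilinear_connection[OF l] XM_rules lc_minus[OF l])
    then show "PH (D X C) = D X C" "D X (J C) = J (D X C)" by (auto simp: sections_H10 cf_inject)
  qed
  have split: "D X Y = D X (PH Y) + fscale (\<lambda>p. X p (th Y)) reeb" if v: "X \<in> XM" "Y \<in> XM" for X Y
  proof -
    have "D X (PH Y + fscale (th Y) reeb) = D X (PH Y) + fscale (\<lambda>p. X p (th Y)) reeb"
      using v by (simp add: lc_add[OF l] lc_fscale[OF l] XM_rules reeb0)
    then show ?thesis using PH_split[of Y] by simp
  qed
  show ?thesis
    unfolding unitary_connection_def
  proof (intro conjI ballI allI l)
    show "D X reeb = 0" if "X \<in> XM" for X by (rule reeb0[OF that])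
    fix X Y assume v: "X \<in> XM" "Y \<in> XM"
    have m: "D X (PH Y) \<in> XM" "fscale (\<lambda>p. X p (th Y)) reeb \<in> XM" using v by (simp_all add: lc_XM[OF l] XM_rules)
    have "D X (J Y) = J (D X (PH Y))" using hor(2)[OF v(1) XM_PH[OF v(2)] PH_PH[OF v(2)]] v by (simp add: J_PH)
    also have "\<dots> = J (D X Y)" unfolding split[OF v] using m by (simp add: J_add J_fscale J_reeb reeb(1))
    finally show "D X (J Y) = J (D X Y)" .
    have thp: "\<theta> p (D X (PH Y) p) = 0" for p
      using th_PH[OF m(1), of p] hor(1)[OF v(1) XM_PH[OF v(2)] PH_PH[OF v(2)]] by simp
    show "\<theta> p (D X Y p) = X p (th Y)" for p
      unfolding split[OF v] th_add[OF m] th_fscale[OF reeb(1)] thp by (simp add: reeb(2))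
    fix Z p assume Z: "Z \<in> XM"
    have h: "h_tensor (D X (PH V)) W p = h_tensor (D X V) W p" "h_tensor W (D X (PH V)) p = h_tensor W (D X V) p"
      if "V \<in> XM" "W \<in> XM" for V W
      using split[OF v(1) that(1)] v that
      by (simp_all add: hh_add hh_add2 hh_fscale hh_fscale2 hh_reeb XM_rules lc_XM[OF l])
    have gh: "g_metric (PH Y) (PH Z) = h_tensor Y Z"
      using v Z by (simp add: fun_eq_iff g_metric_def hh_PH th_PH)
    have tz: "\<theta> p (D X (PH Z) p) = 0"
      using th_PH[OF lc_XM[OF l v(1) XM_PH[OF Z]], of p] hor(1)[OF v(1) XM_PH[OF Z] PH_PH[OF Z]] by simp
    show "X p (h_tensor Y Z) = h_tensor (D X Y) Z p + h_tensor Y (D X Z) p"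
      using met[OF v(1) XM_PH[OF v(2)] XM_PH[OF Z], of p, unfolded gh] v Z
      by (simp add: g_metric_def thp tz hh_PH h lc_XM[OF l] XM_PH)
  qed
qed

section \<open>The projections and the mixed part of the torsion\<close>

text \<open>For \<open>Z = C + \<i> E\<close> this is
  \<open>(\<pi>\<^sub>H Z - \<i> J Z) / 2\<close>, written through its real part;
  \<open>part01\<close> has the opposite sign.\<close>

definition part10 :: "'a vfield \<Rightarrow> 'a vfield \<Rightarrow> 'a cvfield" where
  "part10 C E = cf (fscale (\<lambda>_. 1/2) (PH C + J E)) (- J (fscale (\<lambda>_. 1/2) (PH C + J E)))"

definition part01 :: "'a vfield \<Rightarrow> 'a vfield \<Rightarrow> 'a cvfield" where
  "part01 C E = cf (fscale (\<lambda>_. 1/2) (PH C - J E)) (J (fscale (\<lambda>_. 1/2) (PH C - J E)))"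

text \<open>If \<open>u\<close> and \<open>v\<close> are the real parts of the two components, then
  \<open>PH C\<close> has the value \<open>u + v\<close> and \<open>J E\<close> the value
  \<open>u - v\<close>, which can be solved for both.\<close>

lemma decomposition_unique:
  assumes "C \<in> XM" "E \<in> XM" and z: "z \<in> H10 p" and w: "w \<in> H01 p" and r: "r \<in> reeb_line p"
    and eq: "cf C E p = z + w + r"
  shows "z = part10 C E p" and "w = part01 C E p"
proof -
  obtain u where u: "u \<in> H p" "z = (\<lambda>f. Complex (u f) (- Jb p u f))" using z H10_iff by auto
  obtain v where v: "v \<in> H p" "w = (\<lambda>f. Complex (v f) (Jb p v f))" using w H01_iff by auto
  obtain c where c: "r = (\<lambda>f. c * cplx (reeb p) f)" using r by (auto simp: reeb_line_def)
  have uT: "u \<in> tangent_space p" and vT: "v \<in> tangent_space p" using u v H_tangent by auto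
  have Ju: "Jb p u \<in> H p" "Jb p v \<in> H p" using u v Jb_H by auto
  have C: "C p f = u f + v f + Re c * reeb p f" and E: "E p f = - Jb p u f + Jb p v f + Im c * reeb p f" for f
    using fun_cong[OF eq, of f] by (simp_all add: cf_def u v c cplx_def complex_eq_iff)
  have "pi_H p (C p) = (\<lambda>f. u f + v f)"
  proof -
    have "C p = (\<lambda>f. 1 * (1 * u f + 1 * v f) + Re c * reeb p f)" using C by auto
    then show ?thesis
      using pi_H_lincomb[OF tangent_lincomb[OF uT vT, of 1 1] reeb_tangent, of 1 "Re c"]
        pi_H_id[OF H_lincomb[OF u(1) v(1), of 1 1]] pi_H_reeb[of p] by simp
  qed
  moreover have "Jt p (E p) = (\<lambda>f. u f - v f)"
  proof -
    have "E p = (\<lambda>f. 1 * ((-1) * Jb p u f + 1 * Jb p v f) + Im c * reeb p f)" using E by auto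
    then show ?thesis
      using Jt_lincomb[OF H_tangent[OF H_lincomb[OF Ju, of "-1" 1]] reeb_tangent, of 1 "Im c"]
        Jt_H[OF H_lincomb[OF Ju, of "-1" 1]] Jb_lincomb[OF Ju, of "-1" 1] Jt_reeb[of p] Jb_H(2)[OF u(1)] Jb_H(2)[OF v(1)]
      by simp
  qed
  ultimately have "fscale (\<lambda>_. 1/2) (PH C + J E) p = u" "fscale (\<lambda>_. 1/2) (PH C - J E) p = v"
    by (simp_all add: fscale_def PH_def J_eq fun_eq_iff)
  then show "z = part10 C E p" "w = part01 C E p"
    using u v by (simp_all add: part10_def part01_def cf_def J_eq Jt_H)
qed

lemma decomposition_exists:
  assumes "C \<in> XM" "E \<in> XM"
  shows "part10 C E p \<in> H10 p" and "part01 C E p \<in> H01 p"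
    and "cf (fscale (th C) reeb) (fscale (th E) reeb) p \<in> reeb_line p"
    and "cf C E p = part10 C E p + part01 C E p + cf (fscale (th C) reeb) (fscale (th E) reeb) p"
proof -
  let ?F = "fscale (\<lambda>_. 1/2) (PH C + J E)" and ?G = "fscale (\<lambda>_. 1/2) (PH C - J E)"
  have F: "?F \<in> XM" "PH ?F = ?F" and G: "?G \<in> XM" "PH ?G = ?G"
    using assms by (simp_all add: XM_rules JP)
  have "part10 C E \<in> sections UNIV H10" "part01 C E \<in> sections UNIV H01"
    "cf (fscale (th C) reeb) (fscale (th E) reeb) \<in> sections UNIV reeb_line"
    unfolding part10_def part01_def sections_H10 sections_H01 sections_reeb using F G CM_th assms by blast+
  then show "part10 C E p \<in> H10 p" "part01 C E p \<in> H01 p"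
    "cf (fscale (th C) reeb) (fscale (th E) reeb) p \<in> reeb_line p"
    by (simp_all add: sections_def)
  have C: "C p f = PH C p f + th C p * reeb p f" and E: "E p f = PH E p f + th E p * reeb p f" for f
    by (simp_all add: PH_def pi_H_def)
  have J: "J ?F p f = (J C p f - PH E p f) / 2" "J ?G p f = (J C p f + PH E p f) / 2" for f
    using assms by (simp_all add: JP XM_rules) (simp_all add: fscale_def)
  show "cf C E p = part10 C E p + part01 C E p + cf (fscale (th C) reeb) (fscale (th E) reeb) p"
  proof
    fix f
    show "cf C E p f = (part10 C E p + part01 C E p + cf (fscale (th C) reeb) (fscale (th E) reeb) p) f"
      by (simp add: part10_def part01_def cf_def complex_eq_iff J) (simp add: fscale_def C[of f] E[of f] field_simps)
  qed
qed

lemma pi_plus_cf: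
  assumes "C \<in> XM" "E \<in> XM"
  shows "pi_plus (cf C E) = part10 C E"
  unfolding pi_plus_def
proof (rule ext, rule the_equality)
  fix p
  show "part10 C E p \<in> H10 p \<and>
    (\<exists>w\<in>H01 p. \<exists>r\<in>reeb_line p. cf C E p = part10 C E p + w + r)"
    using decomposition_exists[OF assms, of p] by blast
  show "z = part10 C E p"
    if "z \<in> H10 p \<and> (\<exists>w\<in>H01 p. \<exists>r\<in>reeb_line p. cf C E p = z + w + r)" for z
    using that decomposition_unique(1)[OF assms] by blast
qed

lemma pi_minus_cf:
  assumes "C \<in> XM" "E \<in> XM"
  shows "pi_minus (cf C E) = part01 C E"
  unfolding pi_minus_def
proof (rule ext, rule the_equality)
  fix p
  show "part01 C E p \<in> H01 p \<and>
    (\<exists>z\<in>H10 p. \<exists>r\<in>reeb_line p. cf C E p = z + part01 C E p + r)"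
    using decomposition_exists[OF assms, of p] by blast
  show "w = part01 C E p"
    if "w \<in> H01 p \<and> (\<exists>z\<in>H10 p. \<exists>r\<in>reeb_line p. cf C E p = z + w + r)" for w
    using that decomposition_unique(2)[OF assms] by blast
qed

lemma pi_plus_eq_0:
  assumes "C \<in> XM" "E \<in> XM"
  shows "pi_plus (cf C E) = 0 \<longleftrightarrow> PH C + J E = 0"
proof
  assume "PH C + J E = 0"
  then show "pi_plus (cf C E) = 0" by (simp add: pi_plus_cf[OF assms] part10_def J_zero)
next
  assume "pi_plus (cf C E) = 0"
  then have "part10 C E = cf 0 0" by (simp add: pi_plus_cf[OF assms])
  then have "fscale (\<lambda>_. 1/2) (PH C + J E) = 0" by (simp only: part10_def cf_inject)
  then show "PH C + J E = 0" by (simp add: fscale_def fun_eq_iff)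
qed

lemma torsion_rules:
  assumes "linear_connection D" "A \<in> XM" "B \<in> XM"
  shows "torsion D A B \<in> XM" "torsion D (- A) B = - torsion D A B" "torsion D A (- B) = - torsion D A B"
    "torsion D B A = - torsion D A B"
  using assms bracket_swap[of A B]
  by (simp_all add: torsion_def lc_minus[OF assms(1)] lc_XM[OF assms(1)] XM_rules br)

text \<open>The complex bilinear extension turns the torsion into the pair of fields to which
  \<open>torsion11\<close> applies. Both orders lead to the same equation because torsion is
  skew.\<close>

lemma Theta_10_01:
  assumes D: "unitary_connection D" and v: "A \<in> XM" "B \<in> XM" "PH A = A" "PH B = B"
  shows "\<Theta> D (cf A (- J A)) (cf B (J B)) = 0 \<longleftrightarrow> conn2 D B A = dbar2 B A"
    and "\<Theta> D (cf B (J B)) (cf A (- J A)) = 0 \<longleftrightarrow> conn2 D B A = dbar2 B A"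
proof -
  note l = uc_linear[OF D]
  let ?C = "torsion D A B + torsion D (J A) (J B)" and ?E = "torsion D A (J B) - torsion D (J A) B"
  have m: "?C \<in> XM" "?E \<in> XM" using v by (simp_all add: XM_rules torsion_rules(1)[OF l])
  have "cbilinear (torsion D) (cf A (- J A)) (cf B (J B)) = cf ?C ?E"
    using v by (simp add: cbilinear_cf torsion_rules(1-3)[OF l] XM_rules)
  then show "\<Theta> D (cf A (- J A)) (cf B (J B)) = 0 \<longleftrightarrow> conn2 D B A = dbar2 B A"
    unfolding \<Theta>_def by (simp add: pi_plus_eq_0[OF m] torsion11[OF D v]) (auto simp: eq_commute)
  have "cbilinear (torsion D) (cf B (J B)) (cf A (- J A)) = cf (- ?C) (- ?E)"
    using v by (simp add: cbilinear_cf torsion_rules(1-3)[OF l] torsion_rules(4)[OF l v(1,2)]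
        torsion_rules(4)[OF l XM_J[OF v(1)] XM_J[OF v(2)]] torsion_rules(4)[OF l v(1) XM_J[OF v(2)]]
        torsion_rules(4)[OF l XM_J[OF v(1)] v(2)] XM_rules)
  moreover have "PH (- ?C) + J (- ?E) = conn2 D B A - dbar2 B A"
    using torsion11[OF D v] m by (simp only: PH_minus J_minus) (simp add: algebra_simps)
  ultimately show "\<Theta> D (cf B (J B)) (cf A (- J A)) = 0 \<longleftrightarrow> conn2 D B A = dbar2 B A"
    unfolding \<Theta>_def using pi_plus_eq_0[OF XM_minus[OF m(1)] XM_minus[OF m(2)]] by simp
qed

lemma Theta11_zero_iff:
  assumes D: "unitary_connection D"
  shows "(\<forall>Z\<in>cvfields UNIV. \<forall>W\<in>cvfields UNIV. \<Theta>11 D Z W = 0) \<longleftrightarrow>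
    (\<forall>A\<in>XM. \<forall>B\<in>XM. PH A = A \<longrightarrow> PH B = B \<longrightarrow> conn2 D A B = dbar2 A B)"
proof (intro iffI ballI impI)
  fix A B assume T: "\<forall>Z\<in>cvfields UNIV. \<forall>W\<in>cvfields UNIV. \<Theta>11 D Z W = 0"
    and v: "A \<in> XM" "B \<in> XM" "PH A = A" "PH B = B"
  \<comment> \<open>With \<open>?Z\<close> of type (1,0) and \<open>?W\<close> of type (0,1), the
    second summand of \<open>\<Theta>11\<close> has zero arguments and only the first
    remains.\<close>
  let ?Z = "cf B (- J B)" and ?W = "cf A (J A)"
  have half: "fscale (\<lambda>_. 1/2) (X + X) = X" for X :: "'a vfield" by (simp add: fscale_def fun_eq_iff)
  have p: "pi_plus ?Z = ?Z" "pi_minus ?Z = cf 0 0" "pi_plus ?W = cf 0 0" "pi_minus ?W = ?W"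
    using v by (simp_all add: pi_plus_cf pi_minus_cf part10_def part01_def XM_rules JP half[unfolded mult_2[symmetric]])
  have "cbilinear (torsion D) (cf 0 0) (cf 0 0) = cf 0 0"
    unfolding cbilinear_cf using lc_minus(3)[OF uc_linear[OF D] XM_zero XM_zero]
    by (simp add: torsion_def XM_zero)
  moreover have "pi_plus (cf 0 0) = 0" by (simp only: pi_plus_eq_0[OF XM_zero XM_zero] PH_zero J_zero) simp
  ultimately have "\<Theta> D (cf 0 0) (cf 0 0) = 0" by (simp add: \<Theta>_def)
  moreover have "\<Theta>11 D ?Z ?W = 0" using T v by (simp add: cf_in_cvfields XM_J XM_minus)
  ultimately have "\<Theta> D ?Z ?W = 0" unfolding \<Theta>11_def p by simp
  then show "conn2 D A B = dbar2 A B" using Theta_10_01(1)[OF D v(2,1,4,3)] by simp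
next
  fix Z W assume T: "\<forall>A\<in>XM. \<forall>B\<in>XM. PH A = A \<longrightarrow> PH B = B \<longrightarrow> conn2 D A B = dbar2 A B"
    and ZW: "Z \<in> cvfields UNIV" "W \<in> cvfields UNIV"
  have plus: "\<exists>A\<in>XM. PH A = A \<and> pi_plus V = cf A (- J A)" and minus: "\<exists>B\<in>XM. PH B = B \<and> pi_minus V = cf B (J B)"
    if V: "V \<in> cvfields UNIV" for V
  proof -
    have m: "Re_field V \<in> XM" "Im_field V \<in> XM" using V by (auto simp: cvfields_def)
    show "\<exists>A\<in>XM. PH A = A \<and> pi_plus V = cf A (- J A)"
      using pi_plus_cf[OF m] m unfolding cf_Re_Im part10_def
      by (intro bexI[of _ "fscale (\<lambda>_. 1/2) (PH (Re_field V) + J (Im_field V))"]) (simp_all add: JP XM_rules)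
    show "\<exists>B\<in>XM. PH B = B \<and> pi_minus V = cf B (J B)"
      using pi_minus_cf[OF m] m unfolding cf_Re_Im part01_def
      by (intro bexI[of _ "fscale (\<lambda>_. 1/2) (PH (Re_field V) - J (Im_field V))"]) (simp_all add: JP XM_rules)
  qed
  obtain A B where A: "A \<in> XM" "PH A = A" "pi_plus Z = cf A (- J A)" and B: "B \<in> XM" "PH B = B" "pi_minus Z = cf B (J B)"
    using plus[OF ZW(1)] minus[OF ZW(1)] by blast
  obtain A' B' where A': "A' \<in> XM" "PH A' = A'" "pi_plus W = cf A' (- J A')" and B': "B' \<in> XM" "PH B' = B'" "pi_minus W = cf B' (J B')"
    using plus[OF ZW(2)] minus[OF ZW(2)] by blast
  have "\<Theta> D (pi_plus Z) (pi_minus W) = 0"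
    unfolding A(3) B'(3) Theta_10_01(1)[OF D A(1) B'(1) A(2) B'(2)] using T A B' by blast
  moreover have "\<Theta> D (pi_minus Z) (pi_plus W) = 0"
    unfolding A'(3) B(3) Theta_10_01(2)[OF D A'(1) B(1) A'(2) B(2)] using T A' B by blast
  ultimately show "\<Theta>11 D Z W = 0" by (simp add: \<Theta>11_def)
qed

section \<open>Existence and uniqueness\<close>

lemma unique_connection:
  "\<exists>!D. pseudo_hermitian_connection D \<and>
    (\<forall>Z\<in>cvfields UNIV. \<forall>W\<in>cvfields UNIV. \<Theta>11 D Z W = 0) \<and>
    (\<forall>X\<in>XM. \<forall>Y\<in>XM. h_tensor (\<sigma> D X) Y = - h_tensor X (\<sigma> D Y))"
proof (rule ex1I[of _ canonical], intro conjI)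
  show "pseudo_hermitian_connection canonical"
    by (rule unitary_imp_pseudo_hermitian[OF canonical_unitary])
  show "\<forall>Z\<in>cvfields UNIV. \<forall>W\<in>cvfields UNIV. \<Theta>11 canonical Z W = 0"
    unfolding Theta11_zero_iff[OF canonical_unitary] using canonical_conn2 by blast
  show "\<forall>X\<in>XM. \<forall>Y\<in>XM.
      h_tensor (\<sigma> canonical X) Y = - h_tensor X (\<sigma> canonical Y)"
    using canonical_sigma by (simp add: fun_eq_iff)
next
  fix D assume "pseudo_hermitian_connection D \<and>
    (\<forall>Z\<in>cvfields UNIV. \<forall>W\<in>cvfields UNIV. \<Theta>11 D Z W = 0) \<and>
    (\<forall>X\<in>XM. \<forall>Y\<in>XM. h_tensor (\<sigma> D X) Y = - h_tensor X (\<sigma> D Y))"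
  then have ph: "pseudo_hermitian_connection D" and T: "\<forall>Z\<in>cvfields UNIV. \<forall>W\<in>cvfields UNIV. \<Theta>11 D Z W = 0"
    and S: "\<And>X Y. X \<in> XM \<Longrightarrow> Y \<in> XM \<Longrightarrow> h_tensor (\<sigma> D X) Y = - h_tensor X (\<sigma> D Y)"
    by blast+
  note D = pseudo_hermitian_imp_unitary[OF ph]
  have T': "conn2 D A B = dbar2 A B" if "A \<in> XM" "B \<in> XM" "PH A = A" "PH B = B" for A B
    using T that unfolding Theta11_zero_iff[OF D] by blast
  have S': "h_tensor (\<sigma> D X) Y p = - h_tensor X (\<sigma> D Y) p" if "X \<in> XM" "Y \<in> XM" for X Y p
    using S[OF that] by simp
  have eq: "D X Y = canonical X Y" if "X \<in> XM" "Y \<in> XM" for X Y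
    by (rule characterization[OF D T' S' that])
  have ext: "E \<in> XM \<rightarrow>\<^sub>E XM \<rightarrow>\<^sub>E XM" if "linear_connection E" for E
    using that by (simp add: linear_connection_def)
  show "D = canonical"
  \<comment> \<open>Agreement on smooth fields yields equality of the functions, because linear
    connections are extensional in both arguments.\<close>
  proof (rule PiE_ext[OF ext[OF uc_linear[OF D]] ext[OF canonical_linear]])
    fix X assume X: "X \<in> XM"
    show "D X = canonical X"
      by (rule PiE_ext[OF PiE_mem[OF ext[OF uc_linear[OF D]] X] PiE_mem[OF ext[OF canonical_linear] X]]) (rule eq[OF X])
  qed
qed

end

theorem corollary2:
  fixes atlas :: "('a::{t2_space, second_countable_topology}, 'n::finite) chart set"
    and m :: nat
    and H10 :: "'a \<Rightarrow> 'a ctvec set"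
    and \<theta> :: "'a \<Rightarrow> 'a tvec \<Rightarrow> real"
    and h :: "'a \<Rightarrow> 'a tvec \<Rightarrow> 'a tvec \<Rightarrow> real"
  assumes "pseudo_hermitian_manifold atlas m H10 \<theta> h"
  shows "\<exists>!D. pseudo_hermitian_manifold.pseudo_hermitian_connection atlas H10 \<theta> h D \<and>
    (\<forall>Z\<in>smooth_manifold.cvfields atlas UNIV. \<forall>W\<in>smooth_manifold.cvfields atlas UNIV.
       pseudo_hermitian_manifold.\<Theta>11 atlas H10 \<theta> D Z W = 0) \<and>
    (\<forall>X\<in>smooth_manifold.vfields atlas UNIV. \<forall>Y\<in>smooth_manifold.vfields atlas UNIV.
       pseudo_hermitian_manifold.h_tensor atlas \<theta> h (pseudo_hermitian_manifold.\<sigma> atlas H10 \<theta> D X) Y =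
       - pseudo_hermitian_manifold.h_tensor atlas \<theta> h X (pseudo_hermitian_manifold.\<sigma> atlas H10 \<theta> D Y))"
  by (rule pseudo_hermitian_manifold.unique_connection[OF assms])

end
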